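(* Consider the sequence $\{\bar x_k\}$ generated by the exact zeroth-order scheme (ZSOL$^{1s}_{cnvx}$, exact) described in the context, applied to $\min_{x\in\mathcal X}f^{\rm imp}(x)$, under Assumptions (A1)--(A3), (C), (U) of the context. Let $\gamma_k=\gamma_0/(k+1)^a$ and $\eta_k=\eta_0/(k+1)^b$ for all $k\ge0$, with $\gamma_0,\eta_0>0$. Then the following hold. (a) Let $a=0.5$, $b\in[0.5,1)$ and $0\le r<2(1-b)$. Then for all $K\ge 2^{\frac1{1-r}}-1$, $$\mathbb E[f^{\rm imp}(\bar x_K)]-f^*\le(2-r)\Big(\tfrac{D_{\mathcal X}}{\gamma_0}+\tfrac{L_0^2n^2\gamma_0}{1-r}\Big)\tfrac1{\sqrt{K+1}}+(2-r)\Big(\tfrac{\eta_0L_0}{1-0.5r-b}\Big)\tfrac1{(K+1)^b}.$$ In particular, when $b=1-\delta$ and $r=0$, where $\delta>0$ is a small scalar, for all $K\ge1$, $$\mathbb E[f^{\rm imp}(\bar x_K)]-f^*\le 2\Big(\tfrac{D_{\mathcal X}}{\gamma_0}+L_0^2n^2\gamma_0\Big)\tfrac1{\sqrt{K+1}}+\Big(\tfrac{2\eta_0L_0}{\delta}\Big)\tfrac1{(K+1)^{1-\delta}}.$$ (b) Let $a=0.5$, $b=0.5$, $r=0$, $\gamma_0=\frac{\sqrt{D_{\mathcal X}}}{nL_0}$ and $\eta_0\le\sqrt{D_{\mathcal X}}\,n$. Then the iteration complexity $K_\epsilon$ in projection steps on $\mathcal X$, as well as the total sample complexity of upper-level evaluations,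 for achieving $\mathbb E[f^{\rm imp}(\bar x_{K_\epsilon})]-f^*\le\epsilon$ for some $\epsilon>0$ is bounded as follows: it suffices that $$K_\epsilon\ge\frac{64\,n^2L_0^2D_{\mathcal X}}{\epsilon^2}.$$ (c) For any $a\in(0.5,1]$ and $b>1-a$, there exists $x^*\in\mathcal X^*$ such that $\lim_{k\to\infty}\|\bar x_k-x^*\|^2=0$ almost surely.
   Context: Notation. $\mathbb B$ and $\mathbb S$ are the Euclidean unit ball and unit sphere of $\mathbb R^n$; $\Pi_C$ is Euclidean projection onto $C$. Problem. $\mathcal X\subseteq\mathbb R^n$, $\mathcal Y\subseteq\mathbb R^m$; $\omega$ is a random variable on a probability space $(\Omega,\mathcal F,\mathbb P)$; $\tilde f(x,y,\omega)\in\mathbb R$, $G(x,y,\omega)\in\mathbb R^m$, $F(x,y)=\mathbb E[G(x,y,\omega)]$. The single-valued map $y(\cdot)$ assigns to $x$ the solution $y(x)$ of VI$(\mathcal Y,F(x,\cdot))$: $y\in\mathcal Y$ and $(\tilde y-y)^TF(x,y)\ge0$ for all $\tilde y\in\mathcal Y$. The single-stage implicit problem is $\min_{x\in\mathcal X}f^{\rm imp}(x):=\mathbb E[\tilde f(x,y(x),\omega)]$; $\mathcal X^*$ and $f^*$ denote its solution set and optimal value, and $D_{\mathcal X}:=\frac12\sup_{x\in\mathcal X}{\rm dist}^2(x,\mathcal X^* )$. Assumptions. (A1) For some $\eta_0>0$ and every $\omega$, $x\mapsto\tilde f(x,y(x),\omega)$ is $L_0(\omega)$-Lipschitz on $\mathcal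 X+\eta_0\mathbb B$ with $L_0:=\sqrt{\mathbb E[L_0^2(\omega)]}<\infty$; and $\tilde f(x,\cdot,\omega)$ is $\tilde L_0(\omega)$-Lipschitz for all $x\in\mathcal X+\eta_0\mathbb B$, with $\tilde L_0:=\sqrt{\mathbb E[\tilde L_0^2(\omega)]}<\infty$. (A2) $\mathcal X,\mathcal Y$ are nonempty, closed, bounded, convex. (A3) $F(x,\cdot)$ is $\mu_F$-strongly monotone and $L_F$-Lipschitz on $\mathcal Y$, uniformly in $x\in\mathcal X$. (C) $f^{\rm imp}$ is convex on $\mathcal X$. (U) The $v_k$ are independent with $v_k$ uniformly distributed on $\eta_k\mathbb S$, the $\omega_k$ are iid replicates of $\omega$, and $v_k$, $\omega_k$ are independent of each other. Scheme (ZSOL$^{1s}_{cnvx}$, exact). Given $r\in[0,1)$, $x_0\in\mathcal X$, $\bar x_0=x_0$, $S_0=\gamma_0^r$. For $k=0,1,\dots$: draw $\omega_k$ and $v_k\in\eta_k\mathbb S$; evaluate $y(x_k)$, $y(x_k+v_k)$ exactly; set $$g_k=\frac{n\big(\tilde f(x_k+v_k,y(x_k+v_k),\omega_k)-\tilde f(x_k,y(x_k),\omega_k)\big)v_k}{\|v_k\|\eta_k},\quad x_{k+1}=\Pi_{\mathcal X}[x_k-\gamma_kg_k],$$ $S_{k+1}=S_k+\gamma_{k+1}^r$, $\bar x_{k+1}=(S_k\bar x_k+\gamma_{k+1}^rx_{k+1})/S_{k+1}$.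
   Formalization: Assumption (C) is strengthened: f^imp is assumed convex on X+η0·B, where the scheme samples it, not only on X; with convexity on X alone the claims fail (e.g. X=[0,1], f^imp=εx on X but steeply decreasing beyond 1, which traps iterates near 1). *)

theory Defs
  imports "HOL-Probability.Probability"
begin

text \<open>The Minkowski sum \<open>X + \<eta> B\<close>, with \<open>B\<close> the closed unit ball: for \<open>x \<in> X\<close> and
  \<open>norm v = \<eta>\<close> the scheme evaluates the objective at \<open>x + v\<close>.\<close>

definition enlargement :: "'a::euclidean_space set \<Rightarrow> real \<Rightarrow> 'a set" where
  "enlargement X \<eta> = {x + u | x u. x \<in> X \<and> u \<in> cball 0 \<eta>}"

definition VI_solutions :: "'b::euclidean_space set \<Rightarrow> ('b \<Rightarrow> 'b) \<Rightarrow> 'b set" where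
  "VI_solutions Y \<Phi> = {z \<in> Y. \<forall>z'\<in>Y. 0 \<le> (z' - z) \<bullet> \<Phi> z}"

definition strongly_monotone_on :: "real \<Rightarrow> 'b::euclidean_space set \<Rightarrow> ('b \<Rightarrow> 'b) \<Rightarrow> bool" where
  "strongly_monotone_on \<mu> Y \<Phi> \<longleftrightarrow>
     (\<forall>z\<in>Y. \<forall>z'\<in>Y. \<mu> * (norm (z - z'))\<^sup>2 \<le> (\<Phi> z - \<Phi> z') \<bullet> (z - z'))"

definition solution_set :: "'a set \<Rightarrow> ('a \<Rightarrow> real) \<Rightarrow> 'a set" where
  "solution_set X f = {x \<in> X. \<forall>z\<in>X. f x \<le> f z}"

definition optimal_value :: "'a set \<Rightarrow> ('a \<Rightarrow> real) \<Rightarrow> real" where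
  "optimal_value X f = (INF x\<in>X. f x)"

definition half_sq_distance :: "'a::metric_space set \<Rightarrow> 'a set \<Rightarrow> real" where
  "half_sq_distance X Z = (1/2) * (SUP x\<in>X. (infdist x Z)\<^sup>2)"

text \<open>The normalized surface (cone) measure on the sphere of radius \<open>\<eta>\<close>, obtained from the
  uniform distribution on the unit ball by radial projection.  The centre, which
  the projection leaves at \<open>0\<close>, has measure zero.\<close>

definition uniform_sphere :: "real \<Rightarrow> 'a::euclidean_space measure" where
  "uniform_sphere \<eta> =
     distr (uniform_measure lborel (cball 0 1)) borel (\<lambda>u. (\<eta> / norm u) *\<^sub>R u)"

text \<open>In the following, \<open>h x w\<close> stands for the implicit integrand: the upper-level objective at
  \<open>x\<close>, at the exact lower-level solution for \<open>x\<close>, and at the realization \<open>w\<close>.\<close>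

definition zo_gradient ::
  "(real^'n \<Rightarrow> 'w \<Rightarrow> real) \<Rightarrow> real \<Rightarrow> real^'n \<Rightarrow> real^'n \<Rightarrow> 'w \<Rightarrow> real^'n" where
  "zo_gradient h \<eta> x v w =
     (real CARD('n) * (h (x + v) w - h x w) / (norm v * \<eta>)) *\<^sub>R v"

text \<open>Besides the current point, the weight sum and the weighted average, the state counts the
  projections carried out and the realizations drawn so far.\<close>

record 'a zsol_state =
  iterate :: 'a
  weight :: real
  average :: 'a
  projections :: nat
  samples :: nat

definition zsol_step ::
  "(real^'n) set \<Rightarrow> (real^'n \<Rightarrow> 'w \<Rightarrow> real) \<Rightarrow> real \<Rightarrow> real \<Rightarrow> real \<Rightarrow> real \<Rightarrow> real^'n \<Rightarrow> 'w
     \<Rightarrow> (real^'n) zsol_state \<Rightarrow> (real^'n) zsol_state" where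
  "zsol_step X h r \<gamma> \<gamma>' \<eta> v w st =
     (let x' = closest_point X (iterate st - \<gamma> *\<^sub>R zo_gradient h \<eta> (iterate st) v w);
          S' = weight st + \<gamma>' powr r
      in \<lparr> iterate = x',
           weight = S',
           average = (1 / S') *\<^sub>R (weight st *\<^sub>R average st + (\<gamma>' powr r) *\<^sub>R x'),
           projections = Suc (projections st),
           samples = Suc (samples st) \<rparr>)"

primrec zsol ::
  "(real^'n) set \<Rightarrow> (real^'n \<Rightarrow> 'w \<Rightarrow> real) \<Rightarrow> real \<Rightarrow> (nat \<Rightarrow> real) \<Rightarrow> (nat \<Rightarrow> real) \<Rightarrow> real^'n
     \<Rightarrow> (nat \<Rightarrow> real^'n) \<Rightarrow> (nat \<Rightarrow> 'w) \<Rightarrow> nat \<Rightarrow> (real^'n) zsol_state" where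
  "zsol X h r \<gamma> \<eta> x0 v w 0 =
     \<lparr> iterate = x0, weight = \<gamma> 0 powr r, average = x0, projections = 0, samples = 0 \<rparr>"
| "zsol X h r \<gamma> \<eta> x0 v w (Suc k) =
     zsol_step X h r (\<gamma> k) (\<gamma> (Suc k)) (\<eta> k) (v k) (w k) (zsol X h r \<gamma> \<eta> x0 v w k)"

end

theory Submission
  imports Defs
begin

text \<open>Let \<open>f\<close> be convex and \<open>L\<close>-Lipschitz.  Smoothing \<open>f\<close> over the ball of radius \<open>\<eta>\<close> keeps it
  convex and moves it up by at most \<open>\<eta> * L\<close>, and the sphere average of \<open>n * f (x + v) / \<eta>\<close> times
  the unit normal is the gradient of the smoothed function.  Hence the conditional expectation
  of the zeroth-order gradient at \<open>x\<close>, paired with \<open>x - z\<close>, is at least \<open>f x - f z - \<eta> * L\<close>.  The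
  divergence theorem on the ball is avoided: the ball indicator is replaced by a radial ramp,
  translation invariance of Lebesgue measure moves the difference quotient from \<open>f\<close> to the
  ramp, and the width of the ramp tends to zero.

  Since the projection is nonexpansive, the squared distance to the solution set then satisfies
  the usual descent inequality.  Taking expectations and summing against the weights gives the
  rates.  For almost sure convergence, the gradient is split into its conditional mean and a
  martingale difference; the noise series converge almost surely by Kolmogorov's
  maximal inequality, so outside one null set the iterates are quasi-Fejer monotone with respect to
  every solution simultaneously, and therefore converge to a solution, as do their averages.\<close>

section \<open>Smoothing of convex functions over balls and spheres\<close>


text \<open>Convexity enters only through chord slopes, so the smoothed function is never
  differentiated: a one-sided inequality between difference quotients survives the limit and is all
  that the descent asks for.

  Two obstacles shape the probabilistic half. The integrand is measurable only for each fixed point,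
  while the scheme evaluates it at random points; it is replaced by a jointly measurable function
  that agrees with it on the enlargement of \<open>X\<close>, where every evaluation takes place.
  And conditional expectations are never formed: the joint law of past data and the fresh pair is a
  product, so Fubini's theorem exchanges the gradient for its mean against any bounded multiplier
  known from the past.

  In expectation the distance to the whole solution set is tracked, since the constant D of the rate
  is defined by it. Almost surely the limit depends on the path, so no solution can be singled out
  in advance. The 64 of part (b) is the square of 4 + 4, one 4 for each of the two terms of the
  rate.\<close>

definition ramp :: "real \<Rightarrow> 'a::real_normed_vector \<Rightarrow> real" where
  "ramp e u = max 0 (min 1 ((1 - norm u) / e))"

lemma ramp_bounds: "0 \<le> ramp e u" "ramp e u \<le> 1" "\<bar>ramp e u\<bar> \<le> 1"
  by (auto simp: ramp_def)

lemma ramp_lipschitz: "e > 0 \<Longrightarrow> \<bar>ramp e u - ramp e w\<bar> \<le> norm (u - w) / e"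
proof -
  assume e: "e > 0"
  have "\<bar>ramp e u - ramp e w\<bar> \<le> \<bar>(1 - norm u) / e - (1 - norm w) / e\<bar>"
    by (auto simp: ramp_def)
  also have "\<dots> = \<bar>norm w - norm u\<bar> / e"
    using e by (simp add: diff_divide_distrib[symmetric] abs_divide)
  also have "\<dots> \<le> norm (u - w) / e"
    using e norm_triangle_ineq3[of w u] by (intro divide_right_mono) (auto simp: norm_minus_commute)
  finally show ?thesis .
qed

lemma continuous_ramp: "e > 0 \<Longrightarrow> continuous_on A (ramp e)"
  unfolding ramp_def by (intro continuous_intros) auto

lemma ramp_eq_0: "e > 0 \<Longrightarrow> 1 \<le> norm u \<Longrightarrow> ramp e u = 0"
  by (auto simp: ramp_def divide_nonpos_pos)

lemma ramp_eq_1: "e > 0 \<Longrightarrow> norm u \<le> 1 - e \<Longrightarrow> ramp e u = 1"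
  by (auto simp: ramp_def field_simps)

text \<open>Off the two spheres bounding the shell the ramp is locally either constant or affine in
  \<open>norm u\<close>, so the directional derivative is zero or that of the norm divided by
  \<open>- e\<close>. Steps of the form \<open>1 / real (Suc i)\<close> make the limit sequential,
  as dominated convergence requires.\<close>

lemma ramp_difference_quotient:
  fixes u d :: "'a::euclidean_space"
  assumes e: "0 < e" "e < 1" and u: "norm u \<noteq> 1 - e" "norm u \<noteq> 1"
  shows "(\<lambda>i. (ramp e (u + (1 / real (Suc i)) *\<^sub>R d) - ramp e u) / (1 / real (Suc i)))
           \<longlonglongrightarrow> - (1 / e) * (indicator (cball 0 1 - cball 0 (1 - e)) u * (sgn u \<bullet> d))"
proof -
  define p where "p t = ramp e (u + t *\<^sub>R d)" for t :: real
  define D where "D = - (1 / e) * (indicator (cball 0 1 - cball 0 (1 - e)) u * (sgn u \<bullet> d))"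
  have nt: "((\<lambda>t. norm (u + t *\<^sub>R d)) \<longlongrightarrow> norm u) (at 0)"
    by (auto intro!: tendsto_eq_intros)
  have "(p has_real_derivative D) (at 0)"
  proof -
    consider "norm u < 1 - e" | "1 - e < norm u" "norm u < 1" | "1 < norm u"
      using u by linarith
    then show ?thesis
    proof cases
      case 1
      have "\<forall>\<^sub>F t in at 0. p t = 1"
        using order_tendstoD(2)[OF nt 1] by eventually_elim (use e in \<open>auto simp: p_def ramp_eq_1\<close>)
      moreover have "p 0 = 1" using 1 e by (simp add: p_def ramp_eq_1)
      moreover have "D = 0" using 1 by (auto simp: D_def)
      ultimately show ?thesis
        by (subst DERIV_cong_ev[where g = "\<lambda>_. 1", OF refl _ refl])
           (auto simp: eventually_at_filter elim: eventually_mono)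
    next
      case 3
      have "\<forall>\<^sub>F t in at 0. p t = 0"
        using order_tendstoD(1)[OF nt 3] by eventually_elim (use e in \<open>auto simp: p_def ramp_eq_0\<close>)
      moreover have "p 0 = 0" using 3 e by (simp add: p_def ramp_eq_0)
      moreover have "D = 0" using 3 by (auto simp: D_def)
      ultimately show ?thesis
        by (subst DERIV_cong_ev[where g = "\<lambda>_. 0", OF refl _ refl])
           (auto simp: eventually_at_filter elim: eventually_mono)
    next
      case 2
      have "\<forall>\<^sub>F t in at 0. p t = (1 - norm (u + t *\<^sub>R d)) / e"
        using order_tendstoD(1)[OF nt 2(1)] order_tendstoD(2)[OF nt 2(2)]
        by eventually_elim (use e in \<open>auto simp: p_def ramp_def max_def min_def field_simps\<close>)
      moreover have "p 0 = (1 - norm u) / e" using 2 e by (auto simp: p_def ramp_def max_def min_def field_simps)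
      ultimately have ev: "\<forall>\<^sub>F t in nhds 0. p t = (1 - norm (u + t *\<^sub>R d)) / e"
        by (auto simp: eventually_at_filter elim: eventually_mono)
      have u0: "u \<noteq> 0" using 2 e by auto
      have "((\<lambda>t. norm (u + t *\<^sub>R d)) has_derivative (\<lambda>t. (t *\<^sub>R d) \<bullet> sgn u)) (at 0)"
      proof (rule has_derivative_compose[where f = "\<lambda>t. u + t *\<^sub>R d" and f' = "\<lambda>t. t *\<^sub>R d" and g = norm and g' = "\<lambda>x. x \<bullet> sgn u", unfolded o_def])
        show "((\<lambda>t. u + t *\<^sub>R d) has_derivative (\<lambda>t. t *\<^sub>R d)) (at 0)"
          by (auto intro!: derivative_eq_intros)
        show "(norm has_derivative (\<lambda>x. x \<bullet> sgn u)) (at (u + 0 *\<^sub>R d))"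
          using has_derivative_norm[OF u0] by (simp add: inner_commute)
      qed
      then have nd: "((\<lambda>t. norm (u + t *\<^sub>R d)) has_real_derivative (sgn u \<bullet> d)) (at 0)"
        unfolding has_field_derivative_def
        by (rule has_derivative_eq_rhs) (auto simp: fun_eq_iff inner_commute)
      have "((\<lambda>t. (1 - norm (u + t *\<^sub>R d)) / e) has_real_derivative D) (at 0)"
        using 2 e by (auto intro!: derivative_eq_intros nd simp: D_def)
      then show ?thesis
        by (subst DERIV_cong_ev[OF refl ev refl])
    qed
  qed
  then have "((\<lambda>h. (p (0 + h) - p 0) / h) \<longlongrightarrow> D) (at 0)"
    by (simp add: DERIV_def)
  moreover have "filterlim (\<lambda>i. 1 / real (Suc i)) (at 0) sequentially"
    unfolding filterlim_at
    by (auto intro!: eventuallyI LIMSEQ_inverse_real_of_nat[unfolded inverse_eq_divide] simp del: of_nat_Suc)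
  ultimately have "(\<lambda>i. (p (0 + 1 / real (Suc i)) - p 0) / (1 / real (Suc i))) \<longlonglongrightarrow> D"
    by (rule filterlim_compose)
  then show ?thesis by (simp add: p_def D_def)
qed

section \<open>Lebesgue integrals under scaling, translation and reflection\<close>

text \<open>Scaling the variable by \<open>c\<close> leaves \<open>G\<close> unchanged, so only the
  Jacobian \<open>c ^ DIM('a)\<close> remains. The intended \<open>G\<close> are functions of the
  direction \<open>sgn u\<close>.\<close>

lemma integral_ball_scale:
  fixes G :: "'a::euclidean_space \<Rightarrow> real"
  assumes c: "c > 0" and [measurable]: "G \<in> borel_measurable borel" and G: "\<And>u. G (c *\<^sub>R u) = G u"
  shows "(\<integral>u. indicator (cball 0 c) u * G u \<partial>lborel) = c ^ DIM('a) * (\<integral>u. indicator (cball 0 1) u * G u \<partial>lborel)"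
proof -
  have m: "(\<lambda>u. indicator (cball 0 c) u * G u) \<in> borel_measurable borel"
    by (intro borel_measurable_times borel_measurable_indicator assms) auto
  have "(\<integral>u. indicator (cball 0 c) u * G u \<partial>lborel) =
      (\<integral>u. indicator (cball 0 c) u * G u \<partial>density (distr lborel borel (\<lambda>x. 0 + c *\<^sub>R x)) (\<lambda>_. ennreal (\<bar>c\<bar> ^ DIM('a))))"
    using lborel_affine[of c "0::'a"] c by simp
  also have "\<dots> = (\<integral>u. c ^ DIM('a) * (indicator (cball 0 c) (c *\<^sub>R u) * G (c *\<^sub>R u)) \<partial>lborel)"
    using c m by (subst integral_density) (auto simp: integral_distr)
  also have "\<dots> = (\<integral>u. c ^ DIM('a) * (indicator (cball 0 1) u * G u) \<partial>lborel)"
    using c by (intro Bochner_Integration.integral_cong) (auto simp: G indicator_def field_simps)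
  finally show ?thesis by simp
qed

lemma integrable_cball_continuous:
  fixes g :: "'a::euclidean_space \<Rightarrow> real"
  assumes "continuous_on UNIV g"
  shows "integrable lborel (\<lambda>u. indicator (cball a c) u * g u)"
  using borel_integrable_compact[OF compact_cball continuous_on_subset[OF assms subset_UNIV]] by simp

lemma integrable_compact_support:
  fixes g :: "'a::euclidean_space \<Rightarrow> real"
  assumes "continuous_on UNIV g" "\<And>u. c < norm u \<Longrightarrow> g u = 0"
  shows "integrable lborel g"
  using integrable_cball_continuous[OF assms(1), of 0 c]
  by (rule back_subst[where P = "integrable lborel"]) (auto simp: fun_eq_iff indicator_def assms(2))

lemma integral_lborel_translate:
  fixes g :: "'a::euclidean_space \<Rightarrow> real"
  assumes "g \<in> borel_measurable borel"
  shows "(\<integral>u. g (c + u) \<partial>lborel) = (\<integral>u. g u \<partial>lborel)"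
  by (subst (2) lborel_distr_plus[symmetric, of c], subst integral_distr) (use assms in auto)

lemma integral_lborel_uminus:
  fixes g :: "'a::euclidean_space \<Rightarrow> real"
  assumes "g \<in> borel_measurable borel"
  shows "(\<integral>u. g (- u) \<partial>lborel) = (\<integral>u. g u \<partial>lborel)"
proof -
  have "(\<integral>u. g u \<partial>lborel) = (\<integral>u. g u \<partial>density (distr lborel borel (\<lambda>x::'a. 0 + (-1) *\<^sub>R x)) (\<lambda>_. ennreal (\<bar>-1\<bar> ^ DIM('a))))"
    using lborel_affine[of "-1" "0::'a"] by simp
  also have "\<dots> = (\<integral>u. g (- u) \<partial>lborel)"
    using assms by (subst integral_density) (auto simp: integral_distr)
  finally show ?thesis by simp
qed

lemma sgn_measurable [measurable]: "(sgn :: 'a::euclidean_space \<Rightarrow> 'a) \<in> borel_measurable borel"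
  unfolding sgn_div_norm by measurable

lemma AE_lborel_notin_sphere: "AE u in lborel. u \<notin> sphere (a::'a::euclidean_space) c"
proof -
  have "AE u in lebesgue. u \<notin> sphere a c"
    using negligible_sphere[of a c] unfolding negligible_iff_null_sets by (rule AE_not_in)
  then show ?thesis by (auto simp: AE_completion_iff)
qed

text \<open>By convexity, the drop from \<open>x + u\<close> to \<open>z + u\<close> is at most the
  drop over the initial fraction \<open>t i\<close> of the segment, divided by \<open>t i\<close>.
  After integration against the ramp and a translation, this difference quotient falls on the ramp,
  whose derivative is explicit.\<close>

lemma convex_smoothing_ramp:
  fixes f :: "'a::euclidean_space \<Rightarrow> real"
  assumes e: "0 < e" "e < 1" and cont: "continuous_on UNIV f" and conv: "convex_on S f"
    and x: "cball x 1 \<subseteq> S" and z: "cball z 1 \<subseteq> S"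
  shows "(\<integral>u. (f (x + u) - f (z + u)) * ramp e u \<partial>lborel)
           \<le> (1 / e) * (\<integral>u. indicator (cball 0 1 - cball 0 (1 - e)) u * (f (x + u) * (sgn u \<bullet> (x - z))) \<partial>lborel)"
proof -
  define d where "d = x - z"
  define t where "t i = 1 / real (Suc i)" for i
  have t: "0 < t i" "t i \<le> 1" for i by (auto simp: t_def)
  note cf = continuous_on_compose2[OF cont]
  note cr = continuous_on_compose2[OF continuous_ramp[OF e(1), where A = "UNIV :: 'a set"]]
  have fb[measurable]: "f \<in> borel_measurable borel" using cont by (rule borel_measurable_continuous_onI)
  have rb[measurable]: "(ramp e :: 'a \<Rightarrow> real) \<in> borel_measurable borel"
    using continuous_ramp[OF e(1)] by (rule borel_measurable_continuous_onI)
  have ig: "integrable lborel (\<lambda>u::'a. f (a + u) * ramp e u)" for a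
    by (rule integrable_compact_support[where c = 1])
       (auto intro!: continuous_intros cf cr continuous_ramp e simp: ramp_eq_0[OF e(1)])
  have step: "(\<integral>u. (f (x + u) - f (z + u)) * ramp e u \<partial>lborel)
      \<le> - (\<integral>u. f (x + u) * ((ramp e (u + t i *\<^sub>R d) - ramp e u) / t i) \<partial>lborel)" for i
  proof -
    have pt: "(f (x + u) - f (z + u)) * ramp e u
        \<le> (1 / t i) * (f (x + u) * ramp e u - f (x - t i *\<^sub>R d + u) * ramp e u)" for u
    proof (cases "norm u \<le> 1")
      case True
      have "f ((1 - t i) *\<^sub>R (x + u) + t i *\<^sub>R (z + u)) \<le> (1 - t i) * f (x + u) + t i * f (z + u)"
        using True x z t[of i] by (intro convex_onD[OF conv]) (auto simp: dist_norm subset_iff less_imp_le)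
      also have "(1 - t i) *\<^sub>R (x + u) + t i *\<^sub>R (z + u) = x - t i *\<^sub>R d + u"
        by (simp add: d_def algebra_simps)
      finally have "t i * (f (x + u) - f (z + u)) \<le> f (x + u) - f (x - t i *\<^sub>R d + u)"
        by (simp add: algebra_simps)
      then have "f (x + u) - f (z + u) \<le> (1 / t i) * (f (x + u) - f (x - t i *\<^sub>R d + u))"
        using t[of i] by (simp add: field_simps)
      from mult_right_mono[OF this ramp_bounds(1)[of e u]] show ?thesis by (simp add: algebra_simps)
    next
      case False
      then show ?thesis by (simp add: ramp_eq_0[OF e(1)])
    qed
    have ig': "integrable lborel (\<lambda>u. f (x + u) * ramp e (u + t i *\<^sub>R d))"
    proof (rule integrable_compact_support[where c = "1 + norm (t i *\<^sub>R d)"])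
      show "continuous_on UNIV (\<lambda>u. f (x + u) * ramp e (u + t i *\<^sub>R d))"
        by (auto intro!: continuous_intros cf cr)
      fix u :: 'a assume "1 + norm (t i *\<^sub>R d) < norm u"
      then have "1 \<le> norm (u + t i *\<^sub>R d)" using norm_triangle_ineq4[of "u + t i *\<^sub>R d" "t i *\<^sub>R d"] by simp
      then show "f (x + u) * ramp e (u + t i *\<^sub>R d) = 0" by (simp add: ramp_eq_0[OF e(1)])
    qed
    have tr: "(\<integral>u. f ((x - t i *\<^sub>R d) + u) * ramp e u \<partial>lborel) = (\<integral>u. f (x + u) * ramp e (u + t i *\<^sub>R d) \<partial>lborel)"
      using integral_lborel_translate[of "\<lambda>u. f (x + u) * ramp e (u + t i *\<^sub>R d)" "- (t i *\<^sub>R d)"]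
      by (simp add: algebra_simps)
    have "(\<integral>u. (f (x + u) - f (z + u)) * ramp e u \<partial>lborel)
      \<le> (\<integral>u. (1 / t i) * (f (x + u) * ramp e u - f (x - t i *\<^sub>R d + u) * ramp e u) \<partial>lborel)"
      using ig by (intro integral_mono pt) (auto simp: left_diff_distrib simp del: add.commute)
    also have "\<dots> = (1 / t i) * ((\<integral>u. f (x + u) * ramp e u \<partial>lborel) - (\<integral>u. f (x + u) * ramp e (u + t i *\<^sub>R d) \<partial>lborel))"
      using ig by (simp add: tr)
    also have "\<dots> = - ((1 / t i) * (\<integral>u. f (x + u) * ramp e (u + t i *\<^sub>R d) - f (x + u) * ramp e u \<partial>lborel))"
      unfolding Bochner_Integration.integral_diff[OF ig' ig[of x]] by argo
    also have "\<dots> = - (\<integral>u. (1 / t i) * (f (x + u) * ramp e (u + t i *\<^sub>R d) - f (x + u) * ramp e u) \<partial>lborel)"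
      by simp
    also have "\<dots> = - (\<integral>u. f (x + u) * ((ramp e (u + t i *\<^sub>R d) - ramp e u) / t i) \<partial>lborel)"
      by (simp add: diff_divide_distrib right_diff_distrib)
    finally show ?thesis .
  qed
  have lim: "(\<lambda>i. \<integral>u. f (x + u) * ((ramp e (u + t i *\<^sub>R d) - ramp e u) / t i) \<partial>lborel)
     \<longlonglongrightarrow> (\<integral>u. f (x + u) * (- (1 / e) * (indicator (cball 0 1 - cball 0 (1 - e)) u * (sgn u \<bullet> d))) \<partial>lborel)"
  \<comment> \<open>The ramp has Lipschitz constant \<open>1 / e\<close>, which bounds its quotients
    by \<open>norm d / e\<close>; since \<open>t i \<le> 1\<close>, they vanish outside the ball of
    radius \<open>1 + norm d\<close>.\<close>
  proof (rule integral_dominated_convergence[where w = "\<lambda>u. indicator (cball 0 (1 + norm d)) u * (\<bar>f (x + u)\<bar> * (norm d / e))"])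
    show "integrable lborel (\<lambda>u. indicator (cball 0 (1 + norm d)) u * (\<bar>f (x + u)\<bar> * (norm d / e)))"
      by (intro integrable_cball_continuous continuous_intros cf) (use e in auto)
    show "AE u in lborel. (\<lambda>i. f (x + u) * ((ramp e (u + t i *\<^sub>R d) - ramp e u) / t i))
        \<longlonglongrightarrow> f (x + u) * (- (1 / e) * (indicator (cball 0 1 - cball 0 (1 - e)) u * (sgn u \<bullet> d)))"
      using AE_lborel_notin_sphere[of 0 1] AE_lborel_notin_sphere[of 0 "1 - e"]
    proof eventually_elim
      case (elim u)
      then show ?case unfolding t_def
        by (intro tendsto_intros ramp_difference_quotient e) auto
    qed
    show "AE u in lborel. norm (f (x + u) * ((ramp e (u + t i *\<^sub>R d) - ramp e u) / t i))
        \<le> indicator (cball 0 (1 + norm d)) u * (\<bar>f (x + u)\<bar> * (norm d / e))" for i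
    proof (rule AE_I2)
      fix u :: 'a
      show "norm (f (x + u) * ((ramp e (u + t i *\<^sub>R d) - ramp e u) / t i))
        \<le> indicator (cball 0 (1 + norm d)) u * (\<bar>f (x + u)\<bar> * (norm d / e))"
      proof (cases "norm u \<le> 1 + norm d")
        case True
        have "\<bar>ramp e (u + t i *\<^sub>R d) - ramp e u\<bar> \<le> t i * (norm d / e)"
          using ramp_lipschitz[OF e(1), of "u + t i *\<^sub>R d" u] t[of i] by simp
        then have "\<bar>(ramp e (u + t i *\<^sub>R d) - ramp e u) / t i\<bar> \<le> norm d / e"
          using t[of i] by (simp add: abs_divide divide_le_eq mult.commute)
        then have "\<bar>f (x + u)\<bar> * \<bar>(ramp e (u + t i *\<^sub>R d) - ramp e u) / t i\<bar> \<le> \<bar>f (x + u)\<bar> * (norm d / e)"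
          by (rule mult_left_mono) simp
        then show ?thesis using True by (simp only: abs_mult real_norm_def) simp
      next
        case False
        have "norm (t i *\<^sub>R d) \<le> norm d" using t[of i] by (simp add: mult_left_le_one_le)
        then have "1 \<le> norm (u + t i *\<^sub>R d)"
          using False norm_triangle_ineq4[of "u + t i *\<^sub>R d" "t i *\<^sub>R d"] by simp
        moreover have "1 \<le> norm u" using False norm_ge_zero[of d] by linarith
        ultimately show ?thesis using e by (simp add: ramp_eq_0)
      qed
    qed
  qed (auto intro!: borel_measurable_times borel_measurable_indicator borel_measurable_divide)
  have "(\<integral>u. (f (x + u) - f (z + u)) * ramp e u \<partial>lborel)
     \<le> - (\<integral>u. f (x + u) * (- (1 / e) * (indicator (cball 0 1 - cball 0 (1 - e)) u * (sgn u \<bullet> d))) \<partial>lborel)"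
    using tendsto_minus[OF lim] by (rule Lim_bounded2) (use step in auto)
  also have "\<dots> = - (\<integral>u. (- (1 / e)) * (indicator (cball 0 1 - cball 0 (1 - e)) u * (f (x + u) * (sgn u \<bullet> d))) \<partial>lborel)"
    by (intro arg_cong[where f = uminus] Bochner_Integration.integral_cong) (auto simp: algebra_simps)
  also have "\<dots> = (1 / e) * (\<integral>u. indicator (cball 0 1 - cball 0 (1 - e)) u * (f (x + u) * (sgn u \<bullet> d)) \<partial>lborel)"
    by simp
  finally show ?thesis unfolding d_def .
qed

text \<open>For \<open>m\<close> the dimension this is the relative volume of the shell divided by
  its width, and the origin of the dimension factor in the gradient. The widths start at 1/2 so that
  the inner radius stays positive.\<close>

lemma power_difference_quotient:
  "(\<lambda>i. (1 - (1 - 1 / real (Suc (Suc i))) ^ m) / (1 / real (Suc (Suc i)))) \<longlonglongrightarrow> real m"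
proof -
  have "((\<lambda>e::real. (1 - e) ^ m) has_real_derivative - real m) (at 0)"
    by (auto intro!: derivative_eq_intros)
  then have "((\<lambda>h::real. ((1 - (0 + h)) ^ m - (1 - 0) ^ m) / h) \<longlongrightarrow> - real m) (at 0)"
    by (simp add: DERIV_def)
  moreover have "filterlim (\<lambda>i. 1 / real (Suc (Suc i))) (at 0) sequentially"
    unfolding filterlim_at
    by (auto intro!: eventuallyI filterlim_compose[OF LIMSEQ_inverse_real_of_nat[unfolded inverse_eq_divide] filterlim_Suc] simp del: of_nat_Suc)
  ultimately have "(\<lambda>i. ((1 - (0 + 1 / real (Suc (Suc i)))) ^ m - (1 - 0) ^ m) / (1 / real (Suc (Suc i)))) \<longlonglongrightarrow> - real m"
    by (rule filterlim_compose)
  then have "(\<lambda>i. - (((1 - (0 + 1 / real (Suc (Suc i)))) ^ m - (1 - 0) ^ m) / (1 / real (Suc (Suc i))))) \<longlonglongrightarrow> - (- real m)"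
    by (rule tendsto_minus)
  then show ?thesis by (simp add: left_diff_distrib del: of_nat_Suc)
qed

text \<open>The integrand may jump at the origin, so integrability comes from a bound:
  \<open>x + sgn u\<close> stays in a compact ball, on which the continuous \<open>f\<close> is
  bounded.\<close>

lemma integrable_cball_sgn:
  fixes f :: "'a::euclidean_space \<Rightarrow> real"
  assumes cont: "continuous_on UNIV f"
  shows "integrable lborel (\<lambda>u. indicator (cball 0 c) u * (f (x + sgn u) * (sgn u \<bullet> d)))"
proof -
  have [measurable]: "f \<in> borel_measurable borel" using cont by (rule borel_measurable_continuous_onI)
  have "compact (f ` cball x 1)"
    by (intro compact_continuous_image continuous_on_subset[OF cont]) auto
  then obtain K where "\<forall>w\<in>cball x 1. \<bar>f w\<bar> \<le> K"
    by (auto dest!: compact_imp_bounded simp: bounded_iff)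
  then have K: "\<bar>f w\<bar> \<le> K" if "w \<in> cball x 1" for w using that by blast
  have K0: "0 \<le> K" using K[of x] by simp
  have "integrable lborel (\<lambda>u. indicator (cball 0 c) u *\<^sub>R (f (x + sgn u) * (sgn u \<bullet> d)))"
  proof (rule integrableI_bounded_set_indicator[where B = "K * norm d"])
    show "AE u in lborel. u \<in> cball 0 c \<longrightarrow> norm (f (x + sgn u) * (sgn u \<bullet> d)) \<le> K * norm d"
    proof (intro AE_I2 impI)
      fix u :: 'a
      have n1: "norm (sgn u) \<le> 1" by (auto simp: norm_sgn)
      then have "\<bar>f (x + sgn u)\<bar> \<le> K" by (intro K) (auto simp: dist_norm)
      moreover have "\<bar>sgn u \<bullet> d\<bar> \<le> norm d"
        using Cauchy_Schwarz_ineq2[of "sgn u" d] mult_right_mono[OF n1, of "norm d"] by simp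
      ultimately show "norm (f (x + sgn u) * (sgn u \<bullet> d)) \<le> K * norm d"
        using K0 by (simp add: abs_mult mult_mono)
    qed
    show "emeasure lborel (cball (0::'a) c) < \<infinity>" by (rule emeasure_lborel_cball_finite)
  qed auto
  then show ?thesis by simp
qed

text \<open>On a thin shell, replacing \<open>f (x + u)\<close> by \<open>f (x + sgn u)\<close>
  costs at most \<open>L\<close> times the width. What remains depends on the direction only, so its
  shell integral is an explicit fraction of the ball integral, and that fraction divided by the
  width tends to \<open>DIM('a)\<close>.\<close>

lemma convex_ball_difference_le_sphere:
  fixes f :: "'a::euclidean_space \<Rightarrow> real"
  assumes cont: "continuous_on UNIV f" and conv: "convex_on S f" and lip: "L-lipschitz_on S f"
    and x: "cball x 1 \<subseteq> S" and z: "cball z 1 \<subseteq> S"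
  shows "(\<integral>u. indicator (cball 0 1) u * (f (x + u) - f (z + u)) \<partial>lborel)
           \<le> real DIM('a) * (\<integral>u. indicator (cball 0 1) u * (f (x + sgn u) * (sgn u \<bullet> (x - z))) \<partial>lborel)"
proof -
  define d where "d = x - z"
  define e where "e i = 1 / real (Suc (Suc i))" for i
  define J where "J = (\<integral>u. indicator (cball 0 1) u * (f (x + sgn u) * (sgn u \<bullet> d)) \<partial>lborel)"
  define V where "V = measure lborel (cball (0::'a) 1)"
  have e: "0 < e i" "e i < 1" for i by (auto simp: e_def)
  have e0: "e \<longlonglongrightarrow> 0"
    unfolding e_def by (rule filterlim_compose[OF LIMSEQ_inverse_real_of_nat[unfolded inverse_eq_divide] filterlim_Suc])
  have L: "0 \<le> L" using lip by (rule lipschitz_on_nonneg)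
  note cf = continuous_on_compose2[OF cont]
  have [measurable]: "f \<in> borel_measurable borel" using cont by (rule borel_measurable_continuous_onI)
  have i1: "integrable lborel (\<lambda>u. indicator (cball (0::'a) c) u * k)" for k c :: real
    by (intro integrable_cball_continuous continuous_intros)
  have i2: "integrable lborel (\<lambda>u. indicator (cball 0 c) u * (f (x + sgn u) * (sgn u \<bullet> d) + k))" for c k
    using Bochner_Integration.integrable_add[OF integrable_cball_sgn[OF cont, of c x d] i1[of c k]]
    by (simp add: distrib_left)
  have est: "(\<integral>u. (f (x + u) - f (z + u)) * ramp (e i) u \<partial>lborel)
      \<le> (1 - (1 - e i) ^ DIM('a)) / e i * (J + L * e i * norm d * V)" for i
  proof -
    \<comment> \<open>The replacement error is absorbed as a constant: \<open>H\<close> then bounds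
      the shell integrand pointwise and is still invariant under positive scaling.\<close>
    define H where "H u = f (x + sgn u) * (sgn u \<bullet> d) + L * e i * norm d" for u
    have Hm[measurable]: "H \<in> borel_measurable borel" unfolding H_def by measurable
    have ind: "indicator (cball 0 1 - cball 0 (1 - e i)) u = indicator (cball (0::'a) 1) u - indicator (cball 0 (1 - e i)) u * (1::real)" for u
      using e[of i] by (auto simp: indicator_def)
    have pt: "indicator (cball 0 1 - cball 0 (1 - e i)) u * (f (x + u) * (sgn u \<bullet> d))
        \<le> indicator (cball 0 1) u * H u - indicator (cball 0 (1 - e i)) u * H u" for u
    proof (cases "u \<in> cball 0 1 - cball 0 (1 - e i)")
      case True
      then have u: "norm u \<le> 1" "1 - e i < norm u" "u \<noteq> 0" using e[of i] by auto
      have n1: "norm (sgn u) = 1" using u by (simp add: norm_sgn)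
      have "u - sgn u = (norm u - 1) *\<^sub>R sgn u"
        using u by (simp add: scaleR_left_diff_distrib sgn_div_norm left_diff_distrib)
      then have "norm (u - sgn u) = 1 - norm u" using u n1 by simp
      moreover have "\<bar>f (x + u) - f (x + sgn u)\<bar> \<le> L * norm (u - sgn u)"
        using lipschitz_onD[OF lip, of "x + u" "x + sgn u"] x u n1
        by (auto simp: dist_norm subset_iff)
      ultimately have fd: "\<bar>f (x + u) - f (x + sgn u)\<bar> \<le> L * e i"
        using u L by (smt (verit) mult_left_mono)
      have "f (x + u) * (sgn u \<bullet> d) - f (x + sgn u) * (sgn u \<bullet> d) \<le> \<bar>f (x + u) - f (x + sgn u)\<bar> * \<bar>sgn u \<bullet> d\<bar>"
        by (simp add: abs_mult[symmetric] left_diff_distrib[symmetric])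
      also have "\<dots> \<le> (L * e i) * norm d"
        using fd Cauchy_Schwarz_ineq2[of "sgn u" d] n1 L e[of i] by (intro mult_mono) auto
      finally show ?thesis using True by (simp add: H_def)
    next
      case False
      then show ?thesis using e[of i] by (auto simp: indicator_def)
    qed
    have iH: "integrable lborel (\<lambda>u. indicator (cball 0 c) u * H u)" for c
      unfolding H_def by (rule i2)
    have iL: "integrable lborel (\<lambda>u. indicator (cball 0 1 - cball 0 (1 - e i)) u * (f (x + u) * (sgn u \<bullet> d)))"
    proof (rule Bochner_Integration.integrable_bound[OF integrable_cball_continuous[where a = 0 and c = 1 and g = "\<lambda>u. \<bar>f (x + u)\<bar> * norm d"]])
      show "AE u in lborel. norm (indicator (cball 0 1 - cball 0 (1 - e i)) u * (f (x + u) * (sgn u \<bullet> d)))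
        \<le> norm (indicator (cball 0 1) u * (\<bar>f (x + u)\<bar> * norm d))"
      proof (rule AE_I2)
        fix u :: 'a
        have "\<bar>sgn u \<bullet> d\<bar> \<le> norm d"
          using Cauchy_Schwarz_ineq2[of "sgn u" d] by (auto simp: norm_sgn split: if_splits)
        then show "norm (indicator (cball 0 1 - cball 0 (1 - e i)) u * (f (x + u) * (sgn u \<bullet> d)))
          \<le> norm (indicator (cball 0 1) u * (\<bar>f (x + u)\<bar> * norm d))"
          by (auto simp: indicator_def abs_mult mult_left_mono)
      qed
    qed (auto intro!: continuous_intros cf borel_measurable_times borel_measurable_indicator)
    have "(\<integral>u. (f (x + u) - f (z + u)) * ramp (e i) u \<partial>lborel)
      \<le> (1 / e i) * (\<integral>u. indicator (cball 0 1 - cball 0 (1 - e i)) u * (f (x + u) * (sgn u \<bullet> d)) \<partial>lborel)"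
      unfolding d_def by (rule convex_smoothing_ramp[OF e cont conv x z])
    also have "\<dots> \<le> (1 / e i) * (\<integral>u. indicator (cball 0 1) u * H u - indicator (cball 0 (1 - e i)) u * H u \<partial>lborel)"
      using e[of i] by (intro mult_left_mono integral_mono iL Bochner_Integration.integrable_diff iH pt) auto
    also have "(\<integral>u. indicator (cball 0 1) u * H u - indicator (cball 0 (1 - e i)) u * H u \<partial>lborel)
        = (1 - (1 - e i) ^ DIM('a)) * (\<integral>u. indicator (cball 0 1) u * H u \<partial>lborel)"
    proof -
      have "(\<integral>u. indicator (cball 0 (1 - e i)) u * H u \<partial>lborel) = (1 - e i) ^ DIM('a) * (\<integral>u. indicator (cball 0 1) u * H u \<partial>lborel)"
        using e[of i] by (intro integral_ball_scale) (auto simp: H_def sgn_scaleR)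
      then show ?thesis
        by (subst Bochner_Integration.integral_diff[OF iH iH]) (simp add: left_diff_distrib)
    qed
    also have "(\<integral>u. indicator (cball 0 1) u * H u \<partial>lborel) = J + L * e i * norm d * V"
      using integrable_cball_sgn[OF cont, of 1 x d] i1[of 1 "L * e i * norm d"]
      by (simp add: H_def distrib_left J_def V_def)
    finally show ?thesis by (simp add: mult.assoc)
  qed
  have lim1: "(\<lambda>i. \<integral>u. (f (x + u) - f (z + u)) * ramp (e i) u \<partial>lborel)
      \<longlonglongrightarrow> (\<integral>u. indicator (cball 0 1) u * (f (x + u) - f (z + u)) \<partial>lborel)"
  proof (rule integral_dominated_convergence[where w = "\<lambda>u. indicator (cball 0 1) u * \<bar>f (x + u) - f (z + u)\<bar>"])
    show "integrable lborel (\<lambda>u. indicator (cball 0 1) u * \<bar>f (x + u) - f (z + u)\<bar>)"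
      by (intro integrable_cball_continuous continuous_intros cf) auto
    show "AE u in lborel. (\<lambda>i. (f (x + u) - f (z + u)) * ramp (e i) u)
        \<longlonglongrightarrow> indicator (cball 0 1) u * (f (x + u) - f (z + u))"
      using AE_lborel_notin_sphere[of 0 1]
    proof eventually_elim
      case (elim u)
      consider "norm u < 1" | "1 < norm u" using elim by fastforce
      then show ?case
      proof cases
        case 1
        have "\<forall>\<^sub>F i in sequentially. e i < 1 - norm u" using 1 e0 by (intro order_tendstoD) auto
        then have "\<forall>\<^sub>F i in sequentially. indicator (cball 0 1) u * (f (x + u) - f (z + u)) = (f (x + u) - f (z + u)) * ramp (e i) u"
          by eventually_elim (use 1 e in \<open>simp add: ramp_eq_1\<close>)
        then show ?thesis by (rule Lim_transform_eventually[OF tendsto_const])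
      qed (use e in \<open>simp add: ramp_eq_0\<close>)
    qed
    show "AE u in lborel. norm ((f (x + u) - f (z + u)) * ramp (e i) u)
        \<le> indicator (cball 0 1) u * \<bar>f (x + u) - f (z + u)\<bar>" for i
      using ramp_bounds[of "e i"] e[of i]
      by (intro AE_I2) (auto simp: indicator_def abs_mult ramp_eq_0 ramp_bounds intro!: mult_left_le)
    show "(\<lambda>u. (f (x + u) - f (z + u)) * ramp (e i) u) \<in> borel_measurable lborel" for i
      using continuous_ramp[OF e(1)[of i], where A = "UNIV::'a set", THEN borel_measurable_continuous_onI] by measurable
  qed (auto intro!: borel_measurable_times borel_measurable_indicator)
  have "(\<lambda>i. (1 - (1 - e i) ^ DIM('a)) / e i * (J + L * e i * norm d * V)) \<longlonglongrightarrow> real DIM('a) * (J + L * 0 * norm d * V)"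
    by (intro tendsto_intros e0 power_difference_quotient[of "DIM('a)", folded e_def])
  from LIMSEQ_le[OF lim1 this] est show ?thesis
    unfolding d_def[symmetric] J_def by auto
qed

text \<open>At \<open>x\<close>, pairing \<open>u\<close> with \<open>- u\<close> shows that the
  ball average of a convex function is at least its central value; at \<open>z\<close>, the
  Lipschitz bound keeps the average below \<open>f z + L\<close>.\<close>

lemma convex_value_difference_le_unit_sphere:
  fixes f :: "'a::euclidean_space \<Rightarrow> real"
  assumes cont: "continuous_on UNIV f" and conv: "convex_on S f" and lip: "L-lipschitz_on S f"
    and x: "cball x 1 \<subseteq> S" and z: "cball z 1 \<subseteq> S"
  shows "measure lborel (cball (0::'a) 1) * (f x - f z - L)
           \<le> real DIM('a) * (\<integral>u. indicator (cball 0 1) u * (f (x + sgn u) * (sgn u \<bullet> (x - z))) \<partial>lborel)"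
proof -
  define V where "V = measure lborel (cball (0::'a) 1)"
  note cf = continuous_on_compose2[OF cont]
  have [measurable]: "f \<in> borel_measurable borel" using cont by (rule borel_measurable_continuous_onI)
  have ig: "integrable lborel (\<lambda>u. indicator (cball 0 1) u * f (a + u))" for a
    by (intro integrable_cball_continuous continuous_intros cf) auto
  have ig': "integrable lborel (\<lambda>u. indicator (cball 0 1) u * f (a - u))" for a
    by (intro integrable_cball_continuous continuous_intros cf) auto
  have ic: "integrable lborel (\<lambda>u. indicator (cball (0::'a) 1) u * (k::real))" for k
    by (intro integrable_cball_continuous continuous_intros)
  have sym: "(\<integral>u. indicator (cball 0 1) u * f (x - u) \<partial>lborel) = (\<integral>u. indicator (cball 0 1) u * f (x + u) \<partial>lborel)"
    using integral_lborel_uminus[of "\<lambda>u. indicator (cball 0 1) u * f (x + u)"] by (simp add: indicator_def)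
  have "2 * f x * V = (\<integral>u. indicator (cball (0::'a) 1) u * (2 * f x) \<partial>lborel)" by (simp add: V_def)
  also have "\<dots> \<le> (\<integral>u. indicator (cball 0 1) u * f (x + u) + indicator (cball 0 1) u * f (x - u) \<partial>lborel)"
  proof (intro integral_mono ic Bochner_Integration.integrable_add ig ig')
    fix u :: 'a
    show "indicator (cball 0 1) u * (2 * f x) \<le> indicator (cball 0 1) u * f (x + u) + indicator (cball 0 1) u * f (x - u)"
    proof (cases "norm u \<le> 1")
      case True
      have "f ((1 - 1/2) *\<^sub>R (x + u) + (1/2) *\<^sub>R (x - u)) \<le> (1 - 1/2) * f (x + u) + (1/2) * f (x - u)"
        using True x by (intro convex_onD[OF conv]) (auto simp: dist_norm subset_iff)
      moreover have "(1 - 1/2) *\<^sub>R (x + u) + (1/2) *\<^sub>R (x - u) = x"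
        by (simp add: algebra_simps flip: scaleR_add_left)
      ultimately show ?thesis using True by simp
    qed simp
  qed
  also have "\<dots> = 2 * (\<integral>u. indicator (cball 0 1) u * f (x + u) \<partial>lborel)"
    using ig ig' by (simp add: sym)
  finally have 1: "V * f x \<le> (\<integral>u. indicator (cball 0 1) u * f (x + u) \<partial>lborel)" by (simp add: mult.commute)
  have "(\<integral>u. indicator (cball 0 1) u * f (z + u) \<partial>lborel) \<le> (\<integral>u. indicator (cball (0::'a) 1) u * (f z + L) \<partial>lborel)"
  proof (intro integral_mono ic ig)
    fix u :: 'a
    show "indicator (cball 0 1) u * f (z + u) \<le> indicator (cball 0 1) u * (f z + L)"
    proof (cases "norm u \<le> 1")
      case True
      have "\<bar>f (z + u) - f z\<bar> \<le> L * norm u"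
        using lipschitz_onD[OF lip, of "z + u" z] z True by (auto simp: dist_norm subset_iff)
      also have "\<dots> \<le> L" using True lipschitz_on_nonneg[OF lip] by (simp add: mult_left_le)
      finally show ?thesis using True by simp
    qed simp
  qed
  also have "\<dots> = V * (f z + L)" by (simp add: V_def)
  finally have 2: "(\<integral>u. indicator (cball 0 1) u * f (z + u) \<partial>lborel) \<le> V * (f z + L)" .
  have "V * (f x - f z - L) \<le> (\<integral>u. indicator (cball 0 1) u * f (x + u) - indicator (cball 0 1) u * f (z + u) \<partial>lborel)"
    using 1 2 by (subst Bochner_Integration.integral_diff[OF ig ig]) (simp add: algebra_simps)
  also have "\<dots> = (\<integral>u. indicator (cball 0 1) u * (f (x + u) - f (z + u)) \<partial>lborel)"
    by (simp add: right_diff_distrib)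
  finally show ?thesis
    using convex_ball_difference_le_sphere[OF assms] unfolding V_def by linarith
qed

section \<open>Integration against the uniform law on a sphere\<close>

lemma integral_uniform_sphere:
  fixes g :: "'a::euclidean_space \<Rightarrow> real"
  assumes [measurable]: "g \<in> borel_measurable borel"
  shows "(\<integral>v. g v \<partial>uniform_sphere \<eta>)
    = (\<integral>u. indicator (cball 0 1) u * g (\<eta> *\<^sub>R sgn u) \<partial>lborel) / measure lborel (cball (0::'a) 1)"
proof -
  define V where "V = measure lborel (cball (0::'a) 1)"
  have V: "V > 0" unfolding V_def by (simp add: content_cball_pos)
  have eV: "emeasure lborel (cball (0::'a) 1) = ennreal V"
    unfolding V_def by (intro emeasure_eq_ennreal_measure) (use emeasure_lborel_cball_finite in \<open>auto simp: less_top\<close>)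
  have dens: "uniform_measure lborel (cball 0 1) = density lborel (\<lambda>u::'a. ennreal (indicator (cball 0 1) u / V))"
    unfolding uniform_measure_def eV using V
    by (intro arg_cong[where f = "density lborel"]) (auto simp: fun_eq_iff divide_ennreal indicator_def ennreal_1[symmetric] simp del: ennreal_1)
  have "(\<integral>v. g v \<partial>uniform_sphere \<eta>) = (\<integral>u. g ((\<eta> / norm u) *\<^sub>R u) \<partial>uniform_measure lborel (cball 0 1))"
    unfolding uniform_sphere_def by (intro integral_distr) auto
  also have "\<dots> = (\<integral>u. (indicator (cball 0 1) u / V) * g ((\<eta> / norm u) *\<^sub>R u) \<partial>lborel)"
    unfolding dens
    using V by (subst integral_density) (auto intro!: borel_measurable_divide borel_measurable_indicator)
  also have "\<dots> = (\<integral>u. (indicator (cball 0 1) u * g (\<eta> *\<^sub>R sgn u)) / V \<partial>lborel)"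
    by (simp add: sgn_div_norm field_simps)
  finally show ?thesis by (simp add: V_def)
qed

theorem convex_sphere_gradient_inequality:
  fixes f :: "'a::euclidean_space \<Rightarrow> real"
  assumes \<eta>: "\<eta> > 0" and cont: "continuous_on UNIV f" and conv: "convex_on S f"
    and lip: "L-lipschitz_on S f" and x: "cball x \<eta> \<subseteq> S" and z: "cball z \<eta> \<subseteq> S"
  shows "f x - f z - \<eta> * L \<le>
    (\<integral>v. (real DIM('a) * (f (x + v) - f x) / (norm v * \<eta>)) * (v \<bullet> (x - z)) \<partial>uniform_sphere \<eta>)"
proof -
  define V where "V = measure lborel (cball (0::'a) 1)"
  have V: "V > 0" unfolding V_def by (simp add: content_cball_pos)
  \<comment> \<open>Scaling by \<open>1 / \<eta>\<close> reduces to the unit ball and changes the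
    Lipschitz constant to \<open>\<eta> * L\<close>. Subtracting the constant \<open>f x\<close> at
    the outset produces the increment \<open>f (x + v) - f x\<close> directly, without a separate
    argument that the unit normal has mean zero.\<close>
  define F where "F w = f (\<eta> *\<^sub>R w) - f x" for w
  define T where "T = (\<lambda>w. (1 / \<eta>) *\<^sub>R w) ` S"
  have T: "w \<in> T \<longleftrightarrow> \<eta> *\<^sub>R w \<in> S" for w
    using \<eta> by (force simp: T_def image_iff)
  have S: "convex S" using conv by (rule convex_on_imp_convex)
  have [measurable]: "f \<in> borel_measurable borel" using cont by (rule borel_measurable_continuous_onI)
  have sub: "cball ((1 / \<eta>) *\<^sub>R a) 1 \<subseteq> T" if "cball a \<eta> \<subseteq> S" for a
  proof
    fix w assume "w \<in> cball ((1 / \<eta>) *\<^sub>R a) 1"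
    then have "\<eta> * norm ((1 / \<eta>) *\<^sub>R a - w) \<le> \<eta> * 1" using \<eta> by (intro mult_left_mono) (auto simp: dist_norm)
    then have "norm (\<eta> *\<^sub>R ((1 / \<eta>) *\<^sub>R a - w)) \<le> \<eta>" using \<eta> by simp
    then have "\<eta> *\<^sub>R w \<in> cball a \<eta>" using \<eta> by (simp add: dist_norm scaleR_right_diff_distrib)
    then show "w \<in> T" using that by (auto simp: T)
  qed
  have "V * (F ((1 / \<eta>) *\<^sub>R x) - F ((1 / \<eta>) *\<^sub>R z) - \<eta> * L)
     \<le> real DIM('a) * (\<integral>u. indicator (cball 0 1) u * (F ((1 / \<eta>) *\<^sub>R x + sgn u) * (sgn u \<bullet> ((1 / \<eta>) *\<^sub>R x - (1 / \<eta>) *\<^sub>R z))) \<partial>lborel)"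
    unfolding V_def
  proof (rule convex_value_difference_le_unit_sphere[where S = T])
    show "continuous_on UNIV F"
      unfolding F_def by (intro continuous_intros continuous_on_compose2[OF cont]) auto
    show "convex_on T F"
    proof (rule convex_onI)
      show "convex T" unfolding T_def using S by (rule convex_scaling)
      fix t :: real and u w assume "0 < t" "t < 1" "u \<in> T" "w \<in> T"
      then have "f ((1 - t) *\<^sub>R (\<eta> *\<^sub>R u) + t *\<^sub>R (\<eta> *\<^sub>R w)) \<le> (1 - t) * f (\<eta> *\<^sub>R u) + t * f (\<eta> *\<^sub>R w)"
        by (intro convex_onD[OF conv]) (auto simp: T)
      then show "F ((1 - t) *\<^sub>R u + t *\<^sub>R w) \<le> (1 - t) * F u + t * F w"
        by (simp add: F_def algebra_simps)
    qed
    show "(\<eta> * L)-lipschitz_on T F"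
    proof (rule lipschitz_onI)
      fix u w assume "u \<in> T" "w \<in> T"
      then have "dist (f (\<eta> *\<^sub>R u)) (f (\<eta> *\<^sub>R w)) \<le> L * dist (\<eta> *\<^sub>R u) (\<eta> *\<^sub>R w)"
        by (intro lipschitz_onD[OF lip]) (auto simp: T)
      then show "dist (F u) (F w) \<le> \<eta> * L * dist u w"
        using \<eta> by (simp add: F_def dist_norm mult_ac flip: scaleR_right_diff_distrib)
    qed (use \<eta> lipschitz_on_nonneg[OF lip] in auto)
  qed (use sub x z in auto)
  then have "f x - f z - \<eta> * L \<le>
     (real DIM('a) * (\<integral>u. indicator (cball 0 1) u * (F ((1 / \<eta>) *\<^sub>R x + sgn u) * (sgn u \<bullet> ((1 / \<eta>) *\<^sub>R x - (1 / \<eta>) *\<^sub>R z))) \<partial>lborel)) / V"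
    using V \<eta> by (simp add: F_def field_simps)
  also have "\<dots> = (\<integral>u. indicator (cball 0 1) u *
      ((real DIM('a) * (f (x + \<eta> *\<^sub>R sgn u) - f x) / (norm (\<eta> *\<^sub>R sgn u) * \<eta>)) * ((\<eta> *\<^sub>R sgn u) \<bullet> (x - z))) \<partial>lborel) / V"
  proof -
    have "real DIM('a) * (indicator (cball 0 1) u * (F ((1 / \<eta>) *\<^sub>R x + sgn u) * (sgn u \<bullet> ((1 / \<eta>) *\<^sub>R x - (1 / \<eta>) *\<^sub>R z))))
      = indicator (cball 0 1) u *
      ((real DIM('a) * (f (x + \<eta> *\<^sub>R sgn u) - f x) / (norm (\<eta> *\<^sub>R sgn u) * \<eta>)) * ((\<eta> *\<^sub>R sgn u) \<bullet> (x - z)))" for u :: 'a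
    proof -
      have "sgn u \<bullet> ((1 / \<eta>) *\<^sub>R x - (1 / \<eta>) *\<^sub>R z) = (sgn u \<bullet> (x - z)) / \<eta>"
        by (simp add: inner_diff_right diff_divide_distrib)
      then show ?thesis using \<eta> by (simp add: F_def scaleR_add_right norm_sgn)
    qed
    then show ?thesis
      unfolding Bochner_Integration.integral_mult_right_zero[symmetric] by (simp only:)
  qed
  also have "\<dots> = (\<integral>v. (real DIM('a) * (f (x + v) - f x) / (norm v * \<eta>)) * (v \<bullet> (x - z)) \<partial>uniform_sphere \<eta>)"
    unfolding V_def by (subst integral_uniform_sphere) auto
  finally show ?thesis .
qed

section \<open>Sequences, series and martingale differences\<close>


text \<open>Subtracting the partial sums of \<open>e\<close> from \<open>a\<close> gives a
  decreasing sequence that is bounded below. The errors may have either sign, as gradient noise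
  does; only convergence of their series matters.\<close>

lemma quasi_fejer_convergent:
  fixes a b e :: "nat \<Rightarrow> real"
  assumes a: "\<And>k. 0 \<le> a k" and b: "\<And>k. 0 \<le> b k" and e: "summable e"
    and step: "\<And>k. a (Suc k) \<le> a k - b k + e k"
  shows "convergent a" and "summable b"
proof -
  define c where "c k = a k - (\<Sum>i<k. e i)" for k
  have se: "(\<lambda>k. \<Sum>i<k. e i) \<longlonglongrightarrow> suminf e" using e by (rule summable_LIMSEQ)
  then have "Bseq (\<lambda>k. \<Sum>i<k. e i)" by (intro convergent_imp_Bseq convergentI)
  then obtain B where B: "\<And>k. \<bar>\<Sum>i<k. e i\<bar> \<le> B" by (auto simp: Bseq_def)
  have "c (Suc k) \<le> c k" for k using step[of k] b[of k] by (simp add: c_def)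
  then have "decseq c" by (rule decseq_SucI)
  moreover have "- B \<le> c k" for k using a[of k] B[of k] by (auto simp: c_def)
  ultimately obtain l where "c \<longlonglongrightarrow> l" using decseq_convergent by blast
  from tendsto_add[OF this se] have "a \<longlonglongrightarrow> l + suminf e" by (simp add: c_def)
  then show "convergent a" by (rule convergentI)
  have "(\<Sum>i<k. b i) \<le> a 0 - c k" for k
  proof (induction k)
    case 0 then show ?case by (simp add: c_def)
  next
    case (Suc k) then show ?case using step[of k] by (simp add: c_def)
  qed
  then have "(\<Sum>i<k. b i) \<le> a 0 + B" for k using \<open>\<And>k. - B \<le> c k\<close>[of k] by (smt (verit))
  then show "summable b" by (intro summableI_nonneg_bounded b)
qed

text \<open>A Cesaro argument: from \<open>N\<close> on every term is within \<open>r / 2\<close> of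
  the limit, and the fixed contribution \<open>C\<close> of the earlier terms is outweighed in the
  end because the weights have a divergent sum.\<close>

lemma weighted_average_tendsto:
  fixes x :: "nat \<Rightarrow> 'a::real_normed_vector" and c :: "nat \<Rightarrow> real"
  assumes c: "\<And>k. 0 < c k" and div: "\<not> summable c" and x: "x \<longlonglongrightarrow> l"
  shows "(\<lambda>k. (1 / (\<Sum>i\<le>k. c i)) *\<^sub>R (\<Sum>i\<le>k. c i *\<^sub>R x i)) \<longlonglongrightarrow> l"
proof (rule LIMSEQ_I)
  fix r :: real assume r: "0 < r"
  define S where "S k = (\<Sum>i\<le>k. c i)" for k
  have S: "0 < S k" for k unfolding S_def using c by (intro sum_pos) auto
  obtain N where N: "\<And>k. k \<ge> N \<Longrightarrow> norm (x k - l) < r / 2"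
    using LIMSEQ_D[OF x, of "r / 2"] r by auto
  define C where "C = (\<Sum>i<N. c i * norm (x i - l))"
  have C: "0 \<le> C" unfolding C_def using c by (intro sum_nonneg mult_nonneg_nonneg) (auto simp: less_imp_le)
  have "\<not> (\<forall>k. (\<Sum>i<k. c i) \<le> 2 * C / r)"
    using div summableI_nonneg_bounded[of c] c by (meson less_imp_le)
  then obtain k0 where k0: "2 * C / r < (\<Sum>i<k0. c i)" by (auto simp: not_le)
  show "\<exists>no. \<forall>n\<ge>no. norm ((1 / (\<Sum>i\<le>n. c i)) *\<^sub>R (\<Sum>i\<le>n. c i *\<^sub>R x i) - l) < r"
  proof (intro exI allI impI)
    fix k assume k: "max k0 N \<le> k"
    have "(\<Sum>i<k0. c i) \<le> S k"
      unfolding S_def using k c by (intro sum_mono2) (auto simp: less_imp_le)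
    then have "2 * C / r < S k" using k0 by linarith
    then have CS: "C < r / 2 * S k" using r by (simp add: field_simps)
    have eq: "(1 / S k) *\<^sub>R (\<Sum>i\<le>k. c i *\<^sub>R x i) - l = (1 / S k) *\<^sub>R (\<Sum>i\<le>k. c i *\<^sub>R (x i - l))"
      using S[of k] by (simp add: scaleR_right_diff_distrib sum_subtractf S_def flip: scaleR_sum_left)
    have "norm (\<Sum>i\<le>k. c i *\<^sub>R (x i - l)) \<le> (\<Sum>i\<le>k. c i * norm (x i - l))"
      using c by (intro order_trans[OF norm_sum] sum_mono) (auto simp: less_imp_le)
    also have "\<dots> = C + (\<Sum>i=N..k. c i * norm (x i - l))"
      unfolding C_def using k by (subst sum.union_disjoint[symmetric]) (auto intro!: sum.cong)
    also have "(\<Sum>i=N..k. c i * norm (x i - l)) \<le> (\<Sum>i=N..k. c i * (r / 2))"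
      using N c by (intro sum_mono mult_left_mono) (auto simp: less_imp_le)
    also have "\<dots> \<le> (\<Sum>i\<le>k. c i * (r / 2))"
      using c r by (intro sum_mono2) (auto simp: less_imp_le)
    also have "\<dots> = r / 2 * S k" by (simp add: S_def sum_distrib_left mult.commute)
    finally have "norm (\<Sum>i\<le>k. c i *\<^sub>R (x i - l)) < r * S k" using CS by simp
    then show "norm ((1 / (\<Sum>i\<le>k. c i)) *\<^sub>R (\<Sum>i\<le>k. c i *\<^sub>R x i) - l) < r"
      unfolding S_def[symmetric] eq using S[of k] by (simp add: divide_less_eq)
  qed
qed

text \<open>Mean value theorem; the derivative is non-increasing because its exponent
  \<open>s - 1\<close> is non-positive. Telescoping these bounds replaces the comparison of power
  sums with integrals.\<close>

lemma powr_increment_bounds: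
  fixes x s :: real
  assumes x: "0 < x" and s: "0 < s" "s \<le> 1"
  shows "s * (x + 1) powr (s - 1) \<le> (x + 1) powr s - x powr s"
    and "(x + 1) powr s - x powr s \<le> s * x powr (s - 1)"
proof -
  have "\<exists>z>x. z < x + 1 \<and> (x + 1) powr s - x powr s = (x + 1 - x) * (s * z powr (s - 1))"
    using x by (intro MVT2) (auto intro!: derivative_eq_intros)
  then obtain z where z: "x < z" "z < x + 1" "(x + 1) powr s - x powr s = s * z powr (s - 1)" by auto
  show "s * (x + 1) powr (s - 1) \<le> (x + 1) powr s - x powr s"
    unfolding z(3) using x s z by (intro mult_left_mono powr_mono2') auto
  show "(x + 1) powr s - x powr s \<le> s * x powr (s - 1)"
    unfolding z(3) using x s z by (intro mult_left_mono powr_mono2') auto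
qed

lemma sum_powr_upper:
  fixes q :: real
  assumes q: "0 \<le> q" "q < 1"
  shows "(\<Sum>k<N. (real k + 1) powr - q) \<le> real N powr (1 - q) / (1 - q)"
proof (induction N)
  case (Suc N)
  have "(1 - q) * (real N + 1) powr - q \<le> (real N + 1) powr (1 - q) - real N powr (1 - q)"
  proof (cases "N = 0")
    case False
    then show ?thesis using powr_increment_bounds(1)[of "real N" "1 - q"] q by simp
  qed (use q in simp)
  then have "(real N + 1) powr - q \<le> (real N + 1) powr (1 - q) / (1 - q) - real N powr (1 - q) / (1 - q)"
    using q by (simp add: pos_le_divide_eq mult.commute flip: diff_divide_distrib)
  then show ?case using Suc by (simp add: add.commute)
qed simp

lemma sum_powr_lower:
  fixes p :: real
  assumes p: "0 \<le> p" "p < 1"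
  shows "((real N + 1) powr (1 - p) - 1) / (1 - p) \<le> (\<Sum>k<N. (real k + 1) powr - p)"
proof (induction N)
  case (Suc N)
  have "(real N + 1 + 1) powr (1 - p) - (real N + 1) powr (1 - p) \<le> (1 - p) * (real N + 1) powr - p"
    using powr_increment_bounds(2)[of "real N + 1" "1 - p"] p by simp
  then have "((real N + 1 + 1) powr (1 - p) - 1) / (1 - p) - ((real N + 1) powr (1 - p) - 1) / (1 - p) \<le> (real N + 1) powr - p"
    using p by (simp add: pos_divide_le_eq mult.commute flip: diff_divide_distrib)
  then show ?case using Suc by (simp add: add.commute add.left_commute)
qed simp

section \<open>Martingale differences with summable second moments\<close>

context prob_space
begin

text \<open>The martingale difference property is encoded as orthogonality to every bounded
  multiplier measurable for \<open>F k\<close>, while \<open>D k\<close> itself becomes known at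
  time \<open>Suc k\<close>.\<close>

context
  fixes F :: "nat \<Rightarrow> 'a measure" and D :: "nat \<Rightarrow> 'a \<Rightarrow> real"
  assumes sub: "\<And>k. subalgebra M (F k)" and mono: "\<And>k. sets (F k) \<subseteq> sets (F (Suc k))"
    and D_meas: "\<And>k. D k \<in> borel_measurable (F (Suc k))"
    and D_sq: "\<And>k. integrable M (\<lambda>s. (D k s)\<^sup>2)"
    and orth: "\<And>k W B. W \<in> borel_measurable (F k) \<Longrightarrow> (\<And>s. \<bar>W s\<bar> \<le> B) \<Longrightarrow> (\<integral>s. W s * D k s \<partial>M) = 0"
begin

lemma filtration_subset: "i \<le> j \<Longrightarrow> sets (F i) \<subseteq> sets (F j)"
  using mono by (rule lift_Suc_mono_le)

lemma filtration_measurable: "i \<le> j \<Longrightarrow> f \<in> borel_measurable (F i) \<Longrightarrow> f \<in> borel_measurable (F j)"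
  using filtration_subset sub unfolding measurable_def subalgebra_def by auto

lemma filtration_random_variable: "f \<in> borel_measurable (F i) \<Longrightarrow> random_variable borel f"
  using sub measurable_from_subalg by blast

text \<open>The sum is stopped at the first time its absolute value reaches \<open>l\<close>; orthogonality
  bounds the second moment of the stopped sum.\<close>

lemma maximal_inequality:
  assumes l: "l > 0"
  shows "prob {s \<in> space M. \<exists>j\<le>N. l \<le> \<bar>\<Sum>i<j. D (m + i) s\<bar>} \<le> (\<Sum>i<N. expectation (\<lambda>s. (D (m + i) s)\<^sup>2)) / l\<^sup>2"
proof -
  define T where "T j s = (\<Sum>i<j. D (m + i) s)" for j s
  \<comment> \<open>\<open>I j\<close> says that the level has not been reached up to time
    \<open>j\<close>. It is known at time \<open>m + j\<close>, before the increment
    \<open>D (m + j)\<close> is revealed.\<close>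
  define I where "I j s = (if \<forall>i\<le>j. \<bar>T i s\<bar> < l then 1 else 0 :: real)" for j s
  define U where "U j s = (\<Sum>i<j. I i s * D (m + i) s)" for j s
  have Dm: "D (m + i) \<in> borel_measurable (F (m + j))" if "i < j" for i j
    by (rule filtration_measurable[OF _ D_meas]) (use that in auto)
  have Tm: "T i \<in> borel_measurable (F (m + j))" if "i \<le> j" for i j
    unfolding T_def using Dm that by (intro borel_measurable_sum) auto
  have Im: "I j \<in> borel_measurable (F (m + j))" for j
  proof -
    have [measurable]: "T i \<in> borel_measurable (F (m + j))" if "i \<in> {..j}" for i using Tm that by auto
    have "Measurable.pred (F (m + j)) (\<lambda>s. \<forall>i\<in>{..j}. \<bar>T i s\<bar> < l)" by measurable
    then show ?thesis unfolding I_def Ball_def atMost_iff by measurable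
  qed
  have I01: "I j s = 0 \<or> I j s = 1" for j s by (auto simp: I_def)
  have [measurable]: "random_variable borel (D k)" "random_variable borel (T k)" "random_variable borel (I k)" for k
    using filtration_random_variable[OF D_meas] filtration_random_variable[OF Tm[of k k]]
      filtration_random_variable[OF Im[of k]] by auto
  have [measurable]: "random_variable borel (U k)" for k unfolding U_def by measurable
  \<comment> \<open>As long as the level has not been reached, stopped and unstopped sums agree.
    Hence \<open>I j s * U j s\<close> is bounded by \<open>l\<close>, which makes it an admissible
    multiplier in \<open>orth\<close>.\<close>
  have IT: "I j s * U j s = I j s * T j s" for j s
  proof (cases "\<forall>i\<le>j. \<bar>T i s\<bar> < l")
    case True
    then have "I i s = 1" if "i < j" for i using that by (auto simp: I_def)
    then show ?thesis by (simp add: U_def T_def)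
  next
    case False
    then have "I j s = 0" unfolding I_def by (rule if_not_P)
    then show ?thesis by simp
  qed
  have sq: "integrable M (\<lambda>s. (U j s)\<^sup>2) \<and> expectation (\<lambda>s. (U j s)\<^sup>2) \<le> (\<Sum>i<j. expectation (\<lambda>s. (D (m + i) s)\<^sup>2))" for j
  proof (induction j)
    case 0 then show ?case by (simp add: U_def)
  next
    case (Suc j)
    define W where "W s = I j s * T j s" for s
    have W: "W \<in> borel_measurable (F (m + j))" unfolding W_def using Im[of j] Tm[of j j] by measurable
    have Wb: "\<bar>W s\<bar> \<le> l" for s using l by (auto simp: W_def I_def less_imp_le)
    have [measurable]: "random_variable borel W" by (rule filtration_random_variable[OF W])
    have iD: "integrable M (D (m + j))"
      by (rule square_integrable_imp_integrable[OF _ D_sq]) auto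
    have iWD: "integrable M (\<lambda>s. W s * D (m + j) s)"
      by (rule Bochner_Integration.integrable_bound[OF Bochner_Integration.integrable_mult_right[OF iD, of l]])
         (use Wb l in \<open>auto simp: abs_mult intro!: mult_right_mono\<close>)
    have iID: "integrable M (\<lambda>s. I j s * (D (m + j) s)\<^sup>2)"
      by (rule Bochner_Integration.integrable_bound[OF D_sq[of "m + j"]]) (auto simp: I_def)
    have eq: "(U (Suc j) s)\<^sup>2 = (U j s)\<^sup>2 + 2 * (W s * D (m + j) s) + I j s * (D (m + j) s)\<^sup>2" for s
    proof -
      have "(U (Suc j) s)\<^sup>2 = (U j s)\<^sup>2 + 2 * ((I j s * U j s) * D (m + j) s) + (I j s)\<^sup>2 * (D (m + j) s)\<^sup>2"
        by (simp add: U_def power2_eq_square algebra_simps)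
      then show ?thesis using I01[of j s] unfolding IT by (auto simp: W_def)
    qed
    have "expectation (\<lambda>s. (U (Suc j) s)\<^sup>2) = expectation (\<lambda>s. (U j s)\<^sup>2) + 2 * expectation (\<lambda>s. W s * D (m + j) s) + expectation (\<lambda>s. I j s * (D (m + j) s)\<^sup>2)"
      using Suc iWD iID by (simp add: eq)
    also have "expectation (\<lambda>s. W s * D (m + j) s) = 0" by (rule orth[OF W Wb])
    also have "expectation (\<lambda>s. I j s * (D (m + j) s)\<^sup>2) \<le> expectation (\<lambda>s. (D (m + j) s)\<^sup>2)"
      by (rule integral_mono[OF iID D_sq]) (auto simp: I_def)
    finally show ?case using Suc iWD iID by (simp add: eq)
  qed
  \<comment> \<open>From the first hitting time on all increments are switched off, so
    \<open>U N\<close> keeps the value attained there.\<close>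
  have UN: "l \<le> \<bar>U N s\<bar>" if ex: "\<exists>j\<le>N. l \<le> \<bar>T j s\<bar>" for s
  proof -
    define j where "j = (LEAST j. l \<le> \<bar>T j s\<bar>)"
    obtain j' where j': "j' \<le> N" "l \<le> \<bar>T j' s\<bar>" using ex by auto
    have j: "l \<le> \<bar>T j s\<bar>" unfolding j_def using j'(2) by (rule LeastI)
    have jl: "\<bar>T i s\<bar> < l" if "i < j" for i using not_less_Least[of i "\<lambda>j. l \<le> \<bar>T j s\<bar>"] that by (auto simp: j_def)
    have jN: "j \<le> N" using j' Least_le[of "\<lambda>j. l \<le> \<bar>T j s\<bar>" j'] by (auto simp: j_def)
    have "U N s = (\<Sum>i<N. if i < j then D (m + i) s else 0)"
      unfolding U_def using j jl by (intro sum.cong) (auto simp: I_def not_less dest: leD)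
    also have "\<dots> = T j s"
      unfolding T_def using jN by (subst sum.If_cases) (auto intro!: sum.cong)
    finally show ?thesis using j by simp
  qed
  have "prob {s \<in> space M. \<exists>j\<le>N. l \<le> \<bar>T j s\<bar>} \<le> prob {s \<in> space M. l \<le> \<bar>U N s\<bar>}"
    by (intro finite_measure_mono) (use UN in auto)
  also have "\<dots> \<le> expectation (\<lambda>s. (U N s)\<^sup>2) / l\<^sup>2"
    using sq[of N] l by (intro second_moment_method) auto
  also have "\<dots> \<le> (\<Sum>i<N. expectation (\<lambda>s. (D (m + i) s)\<^sup>2)) / l\<^sup>2"
    using sq[of N] l by (intro divide_right_mono) auto
  finally show ?thesis by (simp add: T_def)
qed

text \<open>For blocks starting at \<open>m\<close>, the maximal inequality bounds the probability
  that some block sum reaches \<open>l\<close> by a tail of the variance series, which vanishes as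
  \<open>m\<close> grows. Countably many levels then yield the Cauchy criterion outside one null
  set.\<close>

lemma AE_summable_martingale_differences:
  assumes sum: "summable (\<lambda>k. expectation (\<lambda>s. (D k s)\<^sup>2))"
  shows "AE s in M. summable (\<lambda>k. D k s)"
proof -
  define v where "v k = expectation (\<lambda>s. (D k s)\<^sup>2)" for k
  have v0: "0 \<le> v k" for k by (simp add: v_def)
  have [measurable]: "random_variable borel (D k)" for k using filtration_random_variable[OF D_meas] .
  have tail: "AE s in M. \<exists>m. \<forall>j. \<bar>\<Sum>i<j. D (m + i) s\<bar> < l" if l: "l > 0" for l :: real
  proof -
    define E where "E m N = {s \<in> space M. \<exists>j\<le>N. l \<le> \<bar>\<Sum>i<j. D (m + i) s\<bar>}" for m N
    have Em[measurable]: "E m N \<in> events" for m N unfolding E_def by measurable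
    have Eb: "prob (\<Union>N. E m N) \<le> (\<Sum>i. v (m + i)) / l\<^sup>2" for m
    proof -
      have "(\<lambda>N. prob (E m N)) \<longlonglongrightarrow> prob (\<Union>N. E m N)"
        by (rule finite_Lim_measure_incseq) (use Em in \<open>auto simp: incseq_def E_def intro: order_trans\<close>)
      moreover have "prob (E m N) \<le> (\<Sum>i. v (m + i)) / l\<^sup>2" for N
      proof -
        have "prob (E m N) \<le> (\<Sum>i<N. v (m + i)) / l\<^sup>2"
          unfolding E_def v_def by (rule maximal_inequality[OF l])
        also have "\<dots> \<le> (\<Sum>i. v (m + i)) / l\<^sup>2"
          using summable_ignore_initial_segment[OF sum, of m] v0
          by (intro divide_right_mono sum_le_suminf) (auto simp: v_def add.commute)
        finally show ?thesis .
      qed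
      ultimately show ?thesis by (intro LIMSEQ_le_const2) auto
    qed
    have "(\<lambda>m. (\<Sum>i. v (i + m)) / l\<^sup>2) \<longlonglongrightarrow> 0 / l\<^sup>2"
      using suminf_exist_split2[OF sum, folded v_def] l by (intro tendsto_divide) auto
    then have lim: "(\<lambda>m. (\<Sum>i. v (m + i)) / l\<^sup>2) \<longlonglongrightarrow> 0" by (simp add: add.commute)
    have "prob (\<Inter>m. \<Union>N. E m N) \<le> (\<Sum>i. v (m + i)) / l\<^sup>2" for m
      by (rule order_trans[OF finite_measure_mono Eb[of m]]) auto
    then have "prob (\<Inter>m. \<Union>N. E m N) \<le> 0"
      by (intro LIMSEQ_le_const[OF lim]) auto
    then have "prob (\<Inter>m. \<Union>N. E m N) = 0" by (simp add: measure_le_0_iff)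
    then have "(\<Inter>m. \<Union>N. E m N) \<in> null_sets M" by (auto simp: null_sets_def emeasure_eq_measure)
    then show ?thesis by (rule AE_I') (fastforce simp: E_def not_less)
  qed
  have "AE s in M. \<forall>p::nat. \<exists>m. \<forall>j. \<bar>\<Sum>i<j. D (m + i) s\<bar> < 1 / real (Suc p)"
    unfolding AE_all_countable by (intro allI tail) auto
  then show ?thesis
  proof eventually_elim
    case (elim s)
    show ?case unfolding summable_Cauchy
    proof (intro allI impI)
      fix e :: real assume "0 < e"
      then obtain p where p: "1 / real (Suc p) < e / 2" using nat_approx_posE[of "e / 2"] by auto
      obtain m where m: "\<And>j. \<bar>\<Sum>i<j. D (m + i) s\<bar> < 1 / real (Suc p)" using elim by blast
      have sm: "\<bar>\<Sum>i=m..<k. D i s\<bar> < e / 2" for k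
      proof -
        have "(\<Sum>i=m..<k. D i s) = (\<Sum>i<k - m. D (m + i) s)"
          using sum.atLeastLessThan_shift_0[of "\<lambda>i. D i s" m k] by (simp add: atLeast0LessThan add.commute)
        then show ?thesis using m[of "k - m"] p by simp
      qed
      show "\<exists>N. \<forall>k\<ge>N. \<forall>n. norm (\<Sum>i=k..<n. D i s) < e"
      proof (intro exI allI impI)
        fix k n assume k: "m \<le> k"
        show "norm (\<Sum>i=k..<n. D i s) < e"
        proof (cases "k \<le> n")
          case True
          have "(\<Sum>i=m..<n. D i s) = (\<Sum>i=m..<k. D i s) + (\<Sum>i=k..<n. D i s)"
            using k True by (rule sum.atLeastLessThan_concat[symmetric])
          then show ?thesis unfolding real_norm_def using sm[of k] sm[of n] by linarith
        qed (use \<open>0 < e\<close> in simp)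
      qed
    qed
  qed
qed

end
end

section \<open>The zeroth-order gradient and its conditional mean\<close>


lemma (in prob_space) expectation_le_sqrt_second_moment:
  fixes g :: "'a \<Rightarrow> real"
  assumes g: "g \<in> borel_measurable M" and sq: "integrable M (\<lambda>s. (g s)\<^sup>2)"
  shows "expectation g \<le> sqrt (expectation (\<lambda>s. (g s)\<^sup>2))"
proof -
  have "integrable M g" by (rule square_integrable_imp_integrable[OF g sq])
  then have "variance g = expectation (\<lambda>s. (g s)\<^sup>2) - (expectation g)\<^sup>2" using sq by (rule variance_eq)
  moreover have "0 \<le> variance g" by (rule variance_positive)
  ultimately show ?thesis by (intro real_le_rsqrt) simp
qed

text \<open>By monotone convergence the sum has a finite integral, so it is finite almost
  everywhere.\<close>

lemma AE_summable_of_summable_integral: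
  fixes f :: "nat \<Rightarrow> 'a \<Rightarrow> real"
  assumes int: "\<And>k. integrable M (f k)" and nonneg: "\<And>k s. s \<in> space M \<Longrightarrow> 0 \<le> f k s"
    and sum: "summable (\<lambda>k. \<integral>s. f k s \<partial>M)"
  shows "AE s in M. summable (\<lambda>k. f k s)"
proof -
  have [measurable]: "f k \<in> borel_measurable M" for k using int by auto
  have "(\<integral>\<^sup>+s. (\<Sum>k. ennreal (f k s)) \<partial>M) = (\<Sum>k. \<integral>\<^sup>+s. ennreal (f k s) \<partial>M)"
    by (rule nn_integral_suminf) measurable
  also have "\<dots> = (\<Sum>k. ennreal (\<integral>s. f k s \<partial>M))"
    by (intro suminf_cong nn_integral_eq_integral int AE_I2 nonneg)
  also have "\<dots> = ennreal (\<Sum>k. \<integral>s. f k s \<partial>M)"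
    by (intro suminf_ennreal_eq summable_sums sum integral_nonneg_AE AE_I2 nonneg)
  finally have "(\<integral>\<^sup>+s. (\<Sum>k. ennreal (f k s)) \<partial>M) \<noteq> \<infinity>" by simp
  then have "AE s in M. (\<Sum>k. ennreal (f k s)) \<noteq> \<infinity>"
    by (intro nn_integral_PInf_AE) measurable
  with AE_space show ?thesis
  proof eventually_elim
    case (elim s)
    then show ?case by (intro summable_suminf_not_top nonneg) auto
  qed
qed

lemma norm_integral_le:
  fixes f :: "'a \<Rightarrow> 'b::{banach, second_countable_topology}" and g :: "'a \<Rightarrow> real"
  assumes "integrable M f" "integrable M g" "AE s in M. norm (f s) \<le> g s"
  shows "norm (\<integral>s. f s \<partial>M) \<le> (\<integral>s. g s \<partial>M)"
  by (rule order_trans[OF integral_norm_bound integral_mono_AE]) (use assms in auto)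

lemma lipschitz_on_norm_le:
  assumes "(L::real)-lipschitz_on S g" "x \<in> S" "y \<in> S"
  shows "norm (g x - g y) \<le> L * norm (x - y)"
  using lipschitz_onD[OF assms] by (simp add: dist_norm)

text \<open>\<open>S\<close> contains all points at which the scheme evaluates the objective; outside \<open>S\<close> the values
  of \<open>h\<close> and \<open>f\<close> are irrelevant, except that \<open>h\<close> is jointly measurable on the whole space.\<close>

locale zeroth_order_scheme = prob_space M for M :: "'s measure" +
  fixes P :: "'w measure" and X S :: "(real^'n) set" and h :: "real^'n \<Rightarrow> 'w \<Rightarrow> real"
    and L :: "'w \<Rightarrow> real" and f :: "real^'n \<Rightarrow> real"
    and v :: "nat \<Rightarrow> 's \<Rightarrow> real^'n" and w :: "nat \<Rightarrow> 's \<Rightarrow> 'w"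
    and \<gamma> \<eta> :: "nat \<Rightarrow> real" and x0 :: "real^'n"
  assumes P: "prob_space P"
    and h_meas: "(\<lambda>p. h (fst p) (snd p)) \<in> borel_measurable (borel \<Otimes>\<^sub>M P)"
    and L_meas [measurable]: "L \<in> borel_measurable P"
    and L_sq: "integrable P (\<lambda>w. (L w)\<^sup>2)"
    and h_lip: "\<And>w. w \<in> space P \<Longrightarrow> (L w)-lipschitz_on S (\<lambda>x. h x w)"
    and h_int: "\<And>x. x \<in> S \<Longrightarrow> integrable P (h x)"
    and f_def: "\<And>x. x \<in> S \<Longrightarrow> f x = (\<integral>w. h x w \<partial>P)"
    and f_convex: "convex_on S f"
    and S_closed: "closed S"
    and X: "X \<noteq> {}" "compact X" "convex X"
    and X_S: "\<And>x k. x \<in> X \<Longrightarrow> cball x (\<eta> k) \<subseteq> S"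
    and \<gamma>_pos: "\<And>k. 0 < \<gamma> k" and \<eta>_pos: "\<And>k. 0 < \<eta> k"
    and v_norm: "\<And>k s. s \<in> space M \<Longrightarrow> norm (v k s) = \<eta> k"
    and v_law: "\<And>k. distr M borel (v k) = uniform_sphere (\<eta> k)"
    and w_law: "\<And>k. distr M P (w k) = P"
    and vw_law: "\<And>k. distr M (borel \<Otimes>\<^sub>M P) (\<lambda>s. (v k s, w k s)) = uniform_sphere (\<eta> k) \<Otimes>\<^sub>M P"
    and vw_indep: "indep_vars (\<lambda>_. borel \<Otimes>\<^sub>M P) (\<lambda>k s. (v k s, w k s)) UNIV"
    and x0: "x0 \<in> X"
begin

sublocale P: prob_space P by (rule P)

definition lip :: real where "lip = sqrt (\<integral>w. (L w)\<^sup>2 \<partial>P)"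

text \<open>The information in the pairs with index below \<open>k\<close>. Generating it by a
  single tuple lets independence of disjoint index blocks apply to it directly.\<close>

definition past :: "nat \<Rightarrow> 's measure" where
  "past k = vimage_algebra (space M) (\<lambda>s. restrict (\<lambda>i. (v i s, w i s)) {..<k}) (PiM {..<k} (\<lambda>_. borel \<Otimes>\<^sub>M P))"

definition mean_gradient :: "nat \<Rightarrow> real^'n \<Rightarrow> real^'n" where
  "mean_gradient k x = (\<integral>p. zo_gradient h (\<eta> k) x (fst p) (snd p) \<partial>(uniform_sphere (\<eta> k) \<Otimes>\<^sub>M P))"

text \<open>The projected recursion without the averaging, driven by the jointly measurable
  \<open>h\<close>; \<open>zsol_eq\<close> later identifies it with the scheme run on the original
  integrand.\<close>

primrec iter :: "nat \<Rightarrow> 's \<Rightarrow> real^'n" where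
  "iter 0 s = x0"
| "iter (Suc k) s = closest_point X (iter k s - \<gamma> k *\<^sub>R zo_gradient h (\<eta> k) (iter k s) (v k s) (w k s))"

definition grad :: "nat \<Rightarrow> 's \<Rightarrow> real^'n" where
  "grad k s = zo_gradient h (\<eta> k) (iter k s) (v k s) (w k s)"

lemma X_closed: "closed X" using X(2) by (rule compact_imp_closed)

lemma X_sub_S: "X \<subseteq> S"
  using X_S[of _ 0] \<eta>_pos[of 0] by (force simp: subset_iff)

lemma L_nonneg: "x \<in> space P \<Longrightarrow> 0 \<le> L x" using h_lip by (rule lipschitz_on_nonneg)

lemma L_integrable: "integrable P L"
  by (rule P.square_integrable_imp_integrable[OF L_meas L_sq])

lemma lip_nonneg: "0 \<le> lip" by (simp add: lip_def)

lemma lip_sq: "lip\<^sup>2 = (\<integral>w. (L w)\<^sup>2 \<partial>P)" by (simp add: lip_def)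

lemma L_expectation: "(\<integral>w. L w \<partial>P) \<le> lip"
  unfolding lip_def by (rule P.expectation_le_sqrt_second_moment[OF L_meas L_sq])

text \<open>Integration produces the mean of \<open>L\<close>, which is at most its root mean
  square.\<close>

lemma f_lip: "lip-lipschitz_on S f"
proof (rule lipschitz_onI[OF _ lip_nonneg])
  fix x y assume xy: "x \<in> S" "y \<in> S"
  have "dist (f x) (f y) = norm (\<integral>w. h x w - h y w \<partial>P)"
    using xy h_int by (simp add: f_def dist_real_def)
  also have "\<dots> \<le> (\<integral>w. L w * norm (x - y) \<partial>P)"
    using xy h_int L_integrable lipschitz_on_norm_le[OF h_lip]
    by (intro norm_integral_le AE_I2) auto
  also have "\<dots> = (\<integral>w. L w \<partial>P) * norm (x - y)" by simp
  also have "\<dots> \<le> lip * dist x y"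
    unfolding dist_norm using L_expectation by (rule mult_right_mono) simp
  finally show "dist (f x) (f y) \<le> lip * dist x y" .
qed

lemma f_cont: "continuous_on S f" using f_lip by (rule lipschitz_on_continuous_on)

lemma f_cont_X: "continuous_on X f" using f_cont X_sub_S by (rule continuous_on_subset)

lemma vw_rv [measurable]: "(\<lambda>s. (v k s, w k s)) \<in> M \<rightarrow>\<^sub>M borel \<Otimes>\<^sub>M P"
  using vw_indep by (auto simp: indep_vars_def)

lemma v_rv [measurable]: "v k \<in> borel_measurable M"
  using measurable_compose[OF vw_rv measurable_fst] by simp

lemma w_rv [measurable]: "w k \<in> M \<rightarrow>\<^sub>M P"
  using measurable_compose[OF vw_rv measurable_snd] by simp

lemma prob_space_sphere: "prob_space (uniform_sphere (\<eta> k) :: (real^'n) measure)"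
  unfolding v_law[symmetric] by (rule prob_space_distr) simp

lemma sets_sphere [simp, measurable_cong]: "sets (uniform_sphere c) = sets borel"
  by (simp add: uniform_sphere_def)

lemma space_sphere [simp]: "space (uniform_sphere c) = UNIV"
  by (simp add: uniform_sphere_def)

lemma prob_space_law: "prob_space (uniform_sphere (\<eta> k) \<Otimes>\<^sub>M P :: ((real^'n) \<times> 'w) measure)"
  unfolding vw_law[symmetric] by (rule prob_space_distr) simp

lemma AE_law_norm: "AE p in (uniform_sphere (\<eta> k) \<Otimes>\<^sub>M P). norm (fst p :: real^'n) = \<eta> k \<and> snd p \<in> space P"
proof -
  have "AE p in distr M (borel \<Otimes>\<^sub>M P) (\<lambda>s. (v k s, w k s)). norm (fst p) = \<eta> k"
    by (subst AE_distr_iff) (auto simp: v_norm)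
  moreover have "AE p in distr M (borel \<Otimes>\<^sub>M P) (\<lambda>s. (v k s, w k s)). snd p \<in> space P"
    by (rule AE_I2) (auto simp: space_pair_measure)
  ultimately show ?thesis unfolding vw_law by eventually_elim simp
qed

lemma AE_sphere_norm: "AE u in uniform_sphere (\<eta> k). norm (u :: real^'n) = \<eta> k"
  unfolding v_law[symmetric] by (subst AE_distr_iff) (auto simp: v_norm)

lemma zo_gradient_measurable [measurable]:
  "(\<lambda>q. zo_gradient h c (fst q) (fst (snd q)) (snd (snd q))) \<in> borel_measurable (borel \<Otimes>\<^sub>M (borel \<Otimes>\<^sub>M P))"
proof -
  have 1: "(\<lambda>q. h (fst q + fst (snd q)) (snd (snd q))) \<in> borel_measurable (borel \<Otimes>\<^sub>M (borel \<Otimes>\<^sub>M P))"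
    using measurable_compose[OF _ h_meas, of "\<lambda>q. (fst q + fst (snd q), snd (snd q))"] by simp
  have 2: "(\<lambda>q. h (fst q) (snd (snd q))) \<in> borel_measurable (borel \<Otimes>\<^sub>M ((borel :: (real^'n) measure) \<Otimes>\<^sub>M P))"
    using measurable_compose[OF _ h_meas, of "\<lambda>q :: (real^'n) \<times> ((real^'n) \<times> 'w). (fst q, snd (snd q))"] by simp
  show ?thesis unfolding zo_gradient_def using 1 2 by measurable
qed

lemma zo_gradient_section_measurable [measurable]:
  "(\<lambda>p. zo_gradient h c x (fst p) (snd p)) \<in> borel_measurable (borel \<Otimes>\<^sub>M P)"
  using measurable_compose[OF _ zo_gradient_measurable, of "\<lambda>p. (x, p)"] by simp

text \<open>The increment of \<open>h\<close> is at most \<open>L b * \<eta> k\<close>, which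
  cancels the division by \<open>\<eta> k\<close>; this is why the second moment of the gradient
  stays bounded as the radii shrink.\<close>

lemma zo_gradient_norm_le:
  assumes x: "x \<in> X" and u: "norm u = \<eta> k" and b: "b \<in> space P"
  shows "norm (zo_gradient h (\<eta> k) x u b) \<le> real CARD('n) * L b"
proof -
  have "x + u \<in> S" using X_S[OF x, of k] u by (auto simp: subset_iff dist_norm)
  then have "\<bar>h (x + u) b - h x b\<bar> \<le> L b * \<eta> k"
    using lipschitz_on_norm_le[OF h_lip[OF b], of "x + u" x] x X_sub_S u by auto
  then have "real CARD('n) * \<bar>h (x + u) b - h x b\<bar> / \<eta> k \<le> real CARD('n) * (L b * \<eta> k) / \<eta> k"
    using \<eta>_pos[of k] by (intro divide_right_mono mult_left_mono) auto
  then show ?thesis using \<eta>_pos[of k] u by (simp add: zo_gradient_def abs_mult abs_divide)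
qed

lemma L_snd_integrable: "integrable (uniform_sphere (\<eta> k) \<Otimes>\<^sub>M P) (\<lambda>p :: (real^'n) \<times> 'w. c * L (snd p))"
proof -
  have "integrable (distr M P (w k)) (\<lambda>b. c * L b)" unfolding w_law using L_integrable by simp
  then have "integrable M (\<lambda>s. c * L (w k s))" by (rule integrable_distr[rotated]) simp
  then show ?thesis unfolding vw_law[symmetric] by (subst integrable_distr_eq) auto
qed

lemma zo_gradient_integrable:
  assumes x: "x \<in> X"
  shows "integrable (uniform_sphere (\<eta> k) \<Otimes>\<^sub>M P) (\<lambda>p. zo_gradient h (\<eta> k) x (fst p) (snd p))"
proof (rule Bochner_Integration.integrable_bound[OF L_snd_integrable[of k "real CARD('n)"]])
  show "AE p in uniform_sphere (\<eta> k) \<Otimes>\<^sub>M P. norm (zo_gradient h (\<eta> k) x (fst p) (snd p)) \<le> norm (real CARD('n) * L (snd p))"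
    using AE_law_norm
  proof eventually_elim
    case (elim p)
    then show ?case using zo_gradient_norm_le[OF x, of "fst p" k "snd p"] L_nonneg[of "snd p"] by simp
  qed
qed measurable

lemma mean_gradient_measurable [measurable]: "mean_gradient k \<in> borel_measurable borel"
proof -
  interpret U: prob_space "uniform_sphere (\<eta> k) \<Otimes>\<^sub>M P :: ((real^'n) \<times> 'w) measure" by (rule prob_space_law)
  have "(\<lambda>x. \<integral>p. (\<lambda>q. zo_gradient h (\<eta> k) (fst q) (fst (snd q)) (snd (snd q))) (x, p) \<partial>(uniform_sphere (\<eta> k) \<Otimes>\<^sub>M P)) \<in> borel_measurable borel"
    by (rule U.borel_measurable_lebesgue_integral) measurable
  then show ?thesis by (simp add: mean_gradient_def[abs_def])
qed

lemma mean_gradient_norm_le: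
  assumes x: "x \<in> X"
  shows "norm (mean_gradient k x) \<le> real CARD('n) * lip"
proof -
  interpret U: prob_space "uniform_sphere (\<eta> k) \<Otimes>\<^sub>M P :: ((real^'n) \<times> 'w) measure" by (rule prob_space_law)
  have "norm (mean_gradient k x) \<le> (\<integral>p. real CARD('n) * L (snd p) \<partial>(uniform_sphere (\<eta> k) \<Otimes>\<^sub>M P :: ((real^'n) \<times> 'w) measure))"
    unfolding mean_gradient_def
    by (rule norm_integral_le[OF zo_gradient_integrable[OF x] L_snd_integrable])
      (use AE_law_norm in eventually_elim, use zo_gradient_norm_le[OF x] in auto)
  also have "\<dots> = (\<integral>s. real CARD('n) * L (w k s) \<partial>M)"
    unfolding vw_law[symmetric] by (subst integral_distr) auto
  also have "\<dots> = (\<integral>b. real CARD('n) * L b \<partial>distr M P (w k))" by (subst integral_distr) auto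
  also have "\<dots> = real CARD('n) * (\<integral>b. L b \<partial>P)" unfolding w_law by simp
  also have "\<dots> \<le> real CARD('n) * lip" using L_expectation by (rule mult_left_mono) simp
  finally show ?thesis .
qed

text \<open>Integrating over the realization first turns increments of \<open>h\<close> into
  increments of \<open>f\<close>, to which the sphere inequality applies. Fubini's theorem joins the
  two integrals into \<open>mean_gradient\<close>.\<close>

lemma mean_gradient_inequality:
  assumes x: "x \<in> X" and z: "z \<in> X"
  shows "f x - f z - \<eta> k * lip \<le> mean_gradient k x \<bullet> (x - z)"
proof -
  interpret U: prob_space "uniform_sphere (\<eta> k) :: (real^'n) measure" by (rule prob_space_sphere)
  interpret UP: pair_sigma_finite "uniform_sphere (\<eta> k) :: (real^'n) measure" P ..
  \<comment> \<open>The sphere inequality asks for continuity on the whole space, while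
    \<open>f\<close> is controlled on \<open>S\<close> only. All points that matter lie in
    \<open>S\<close>, where the Tietze extension agrees with \<open>f\<close>.\<close>
  obtain g where g: "continuous_on UNIV g" "\<And>y. y \<in> S \<Longrightarrow> g y = f y"
    using Tietze_unbounded[OF f_cont, of UNIV] S_closed by auto
  have [measurable]: "g \<in> borel_measurable borel" using g(1) by (rule borel_measurable_continuous_onI)
  have S: "convex S" using f_convex by (rule convex_on_imp_convex)
  have xS: "x \<in> S" "z \<in> S" using x z X_sub_S by auto
  have "f x - f z - \<eta> k * lip = g x - g z - \<eta> k * lip" using xS g by simp
  also have "\<dots> \<le> (\<integral>u. (real DIM(real^'n) * (g (x + u) - g x) / (norm u * \<eta> k)) * (u \<bullet> (x - z)) \<partial>uniform_sphere (\<eta> k))"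
  proof (rule convex_sphere_gradient_inequality[where S = S])
    show "convex_on S g"
      using f_convex S unfolding convex_on_def by (auto simp: g(2) convex_def)
    show "lip-lipschitz_on S g"
      using f_lip by (rule lipschitz_on_transform) (simp add: g(2))
  qed (use \<eta>_pos x z X_S g in auto)
  also have "\<dots> = (\<integral>u. (\<integral>b. zo_gradient h (\<eta> k) x u b \<bullet> (x - z) \<partial>P) \<partial>uniform_sphere (\<eta> k))"
  proof (rule integral_cong_AE)
    show "AE u in uniform_sphere (\<eta> k). (real DIM(real^'n) * (g (x + u) - g x) / (norm u * \<eta> k)) * (u \<bullet> (x - z))
       = (\<integral>b. zo_gradient h (\<eta> k) x u b \<bullet> (x - z) \<partial>P)"
      using AE_sphere_norm
    proof eventually_elim
      case (elim u)
      have xu: "x + u \<in> S" using X_S[OF x, of k] elim by (auto simp: subset_iff dist_norm)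
      have "(\<integral>b. zo_gradient h (\<eta> k) x u b \<bullet> (x - z) \<partial>P)
          = (\<integral>b. (real CARD('n) * (u \<bullet> (x - z)) / (norm u * \<eta> k)) * (h (x + u) b - h x b) \<partial>P)"
        by (intro Bochner_Integration.integral_cong) (auto simp: zo_gradient_def)
      also have "\<dots> = (real CARD('n) * (u \<bullet> (x - z)) / (norm u * \<eta> k)) * (g (x + u) - g x)"
        using h_int[OF xu] h_int[OF xS(1)] xu xS by (simp add: g(2) f_def)
      finally show ?case by simp
    qed
    have "(\<lambda>u. \<integral>b. (\<lambda>p. zo_gradient h (\<eta> k) x (fst p) (snd p) \<bullet> (x - z)) (u, b) \<partial>P) \<in> borel_measurable (uniform_sphere (\<eta> k))"
      by (rule P.borel_measurable_lebesgue_integral) measurable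
    then show "(\<lambda>u. \<integral>b. zo_gradient h (\<eta> k) x u b \<bullet> (x - z) \<partial>P) \<in> borel_measurable (uniform_sphere (\<eta> k))"
      by simp
  qed measurable
  also have "\<dots> = (\<integral>p. zo_gradient h (\<eta> k) x (fst p) (snd p) \<bullet> (x - z) \<partial>(uniform_sphere (\<eta> k) \<Otimes>\<^sub>M P))"
    using UP.integral_fst'[of "\<lambda>p. zo_gradient h (\<eta> k) x (fst p) (snd p) \<bullet> (x - z)"] zo_gradient_integrable[OF x, of k]
    by simp
  also have "\<dots> = mean_gradient k x \<bullet> (x - z)"
    unfolding mean_gradient_def using zo_gradient_integrable[OF x, of k] by (simp add: integral_inner_left)
  finally show ?thesis .
qed

end

section \<open>Past information and gradient noise\<close>


lemma (in prob_space) distr_pair_eq_product: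
  assumes Y [measurable]: "Y \<in> M \<rightarrow>\<^sub>M Q" and Z [measurable]: "Z \<in> M \<rightarrow>\<^sub>M R"
    and prod: "\<And>A B. A \<in> sets Q \<Longrightarrow> B \<in> sets R \<Longrightarrow>
      prob ((Y -` A \<inter> space M) \<inter> (Z -` B \<inter> space M)) = prob (Y -` A \<inter> space M) * prob (Z -` B \<inter> space M)"
  shows "distr M (Q \<Otimes>\<^sub>M R) (\<lambda>s. (Y s, Z s)) = distr M Q Y \<Otimes>\<^sub>M distr M R Z"
proof (rule pair_measure_eqI[symmetric])
  interpret Q: prob_space "distr M Q Y" by (rule prob_space_distr) simp
  interpret R: prob_space "distr M R Z" by (rule prob_space_distr) simp
  show "sigma_finite_measure (distr M Q Y)" "sigma_finite_measure (distr M R Z)" by unfold_locales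
  fix A B assume "A \<in> sets (distr M Q Y)" "B \<in> sets (distr M R Z)"
  then have AB: "A \<in> sets Q" "B \<in> sets R" by auto
  have "(\<lambda>s. (Y s, Z s)) -` (A \<times> B) \<inter> space M = (Y -` A \<inter> space M) \<inter> (Z -` B \<inter> space M)" by auto
  then show "emeasure (distr M Q Y) A * emeasure (distr M R Z) B = emeasure (distr M (Q \<Otimes>\<^sub>M R) (\<lambda>s. (Y s, Z s))) (A \<times> B)"
    using AB prod[OF AB] by (simp add: emeasure_distr emeasure_eq_measure ennreal_mult)
qed simp

context zeroth_order_scheme
begin

lemma iter_in_X: "iter k s \<in> X"
  using x0 closest_point_in_set[OF X_closed X(1)] by (cases k) auto

lemma past_map_measurable:
  "(\<lambda>s. restrict (\<lambda>i. (v i s, w i s)) {..<k}) \<in> M \<rightarrow>\<^sub>M PiM {..<k} (\<lambda>_. borel \<Otimes>\<^sub>M P)"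
  by (rule measurable_restrict) simp

lemma space_past [simp]: "space (past k) = space M" by (simp add: past_def)

lemma past_subalgebra: "subalgebra M (past k)"
  unfolding subalgebra_def past_def
  using sets_image_in_sets[OF _ past_map_measurable[of k]] by auto

lemma past_vw: "i < k \<Longrightarrow> (\<lambda>s. (v i s, w i s)) \<in> past k \<rightarrow>\<^sub>M borel \<Otimes>\<^sub>M P"
proof -
  assume i: "i < k"
  have "(\<lambda>s. restrict (\<lambda>i. (v i s, w i s)) {..<k}) \<in> past k \<rightarrow>\<^sub>M PiM {..<k} (\<lambda>_. borel \<Otimes>\<^sub>M P)"
    unfolding past_def using measurable_space[OF past_map_measurable[of k]] by (intro measurable_vimage_algebra1) auto
  from measurable_compose[OF this measurable_component_singleton[of i]] i show ?thesis by simp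
qed

lemma past_mono: "sets (past k) \<subseteq> sets (past (Suc k))"
proof -
  have "(\<lambda>s. restrict (\<lambda>i. (v i s, w i s)) {..<k}) \<in> past (Suc k) \<rightarrow>\<^sub>M PiM {..<k} (\<lambda>_. borel \<Otimes>\<^sub>M P)"
    by (rule measurable_restrict) (simp add: past_vw)
  then show ?thesis
    unfolding past_def[of k] using sets_image_in_sets[of "past (Suc k)" "space M"] by simp
qed

lemma past_mono_measurable: "g \<in> borel_measurable (past k) \<Longrightarrow> g \<in> borel_measurable (past (Suc k))"
  using past_mono[of k] by (auto simp: measurable_def)

lemma past_rv: "g \<in> past k \<rightarrow>\<^sub>M Q \<Longrightarrow> g \<in> M \<rightarrow>\<^sub>M Q"
  using past_subalgebra by (rule measurable_from_subalg)

lemma closest_point_measurable [measurable]: "closest_point X \<in> borel_measurable borel"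
  by (rule borel_measurable_continuous_onI) (rule continuous_on_closest_point[OF X(3) X_closed X(1)])

text \<open>Split off with its hypothesis because the induction in \<open>iter_past\<close> passes
  from the iterate to the gradient and on to the next iterate.\<close>

lemma grad_past_of_iter:
  assumes "iter k \<in> borel_measurable (past k)"
  shows "grad k \<in> borel_measurable (past (Suc k))"
proof -
  have [measurable]: "iter k \<in> borel_measurable (past (Suc k))" using assms by (rule past_mono_measurable)
  have [measurable]: "(\<lambda>s. (v k s, w k s)) \<in> past (Suc k) \<rightarrow>\<^sub>M borel \<Otimes>\<^sub>M P" by (rule past_vw) simp
  have "(\<lambda>s. (iter k s, (v k s, w k s))) \<in> past (Suc k) \<rightarrow>\<^sub>M borel \<Otimes>\<^sub>M (borel \<Otimes>\<^sub>M P)" by measurable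
  from measurable_compose[OF this zo_gradient_measurable[of "\<eta> k"]] show ?thesis
    by (simp add: grad_def[abs_def])
qed

lemma iter_past: "iter k \<in> borel_measurable (past k)"
proof (induction k)
  case 0
  have "iter 0 = (\<lambda>s. x0)" by (simp add: fun_eq_iff)
  then show ?case by simp
next
  case (Suc k)
  have [measurable]: "iter k \<in> borel_measurable (past (Suc k))" using Suc by (rule past_mono_measurable)
  have [measurable]: "grad k \<in> borel_measurable (past (Suc k))" using Suc by (rule grad_past_of_iter)
  have "(\<lambda>s. closest_point X (iter k s - \<gamma> k *\<^sub>R grad k s)) \<in> borel_measurable (past (Suc k))" by measurable
  then show ?case by (simp add: grad_def fun_eq_iff[symmetric] cong: measurable_cong)
qed

lemma grad_past: "grad k \<in> borel_measurable (past (Suc k))"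
  using iter_past by (rule grad_past_of_iter)

lemma iter_rv [measurable]: "iter k \<in> borel_measurable M" using iter_past by (rule past_rv)
lemma grad_rv [measurable]: "grad k \<in> borel_measurable M" using grad_past by (rule past_rv)

lemma iter_Suc_grad: "iter (Suc k) s = closest_point X (iter k s - \<gamma> k *\<^sub>R grad k s)"
  by (simp add: grad_def)

text \<open>Independence in the form of a product law, ready for Fubini's theorem; \<open>Y\<close>
  can be any quantity determined by the past.\<close>

lemma past_indep:
  assumes Y: "Y \<in> past k \<rightarrow>\<^sub>M Q"
  shows "distr M (Q \<Otimes>\<^sub>M (borel \<Otimes>\<^sub>M P)) (\<lambda>s. (Y s, (v k s, w k s)))
    = distr M Q Y \<Otimes>\<^sub>M (uniform_sphere (\<eta> k) \<Otimes>\<^sub>M P)"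
proof -
  let ?B = "borel \<Otimes>\<^sub>M P :: ((real^'n) \<times> 'w) measure"
  let ?Z = "\<lambda>A s. restrict (\<lambda>i. (v i s, w i s)) A"
  have "indep_var (PiM {..<k} (\<lambda>_. ?B)) (?Z {..<k}) (PiM {k} (\<lambda>_. ?B)) (?Z {k})"
    by (rule indep_var_restrict[OF vw_indep]) auto
  then have ind: "indep_set (sets (past k)) (sigma_sets (space M) {?Z {k} -` A \<inter> space M | A. A \<in> sets (PiM {k} (\<lambda>_. ?B))})"
    unfolding indep_var_eq past_def sets_vimage_algebra by blast
  show ?thesis unfolding vw_law[symmetric]
  proof (rule distr_pair_eq_product[OF past_rv[OF Y] vw_rv])
    fix A B assume A: "A \<in> sets Q" and B: "B \<in> sets ?B"
    \<comment> \<open>Independence is available for the tuple over the block \<open>{k}\<close>, so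
      the event is rewritten as a cylinder over this one index.\<close>
    have "(\<lambda>s. (v k s, w k s)) -` B \<inter> space M = ?Z {k} -` (PiE {k} (\<lambda>_. B)) \<inter> space M"
      by (auto simp: PiE_iff)
    moreover have "PiE {k} (\<lambda>_. B) \<in> sets (PiM {k} (\<lambda>_. ?B))" using B by (intro sets_PiM_I_finite) auto
    ultimately have "(\<lambda>s. (v k s, w k s)) -` B \<inter> space M \<in> sigma_sets (space M) {?Z {k} -` A \<inter> space M | A. A \<in> sets (PiM {k} (\<lambda>_. ?B))}"
      by (intro sigma_sets.Basic) blast
    moreover have "Y -` A \<inter> space M \<in> sets (past k)" using measurable_sets[OF Y A] by simp
    ultimately show "prob ((Y -` A \<inter> space M) \<inter> ((\<lambda>s. (v k s, w k s)) -` B \<inter> space M))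
        = prob (Y -` A \<inter> space M) * prob ((\<lambda>s. (v k s, w k s)) -` B \<inter> space M)"
      by (intro indep_setD[OF ind])
  qed
qed

lemma L_w_sq_integrable: "integrable M (\<lambda>s. (L (w k s))\<^sup>2)"
  and L_w_sq_expectation: "expectation (\<lambda>s. (L (w k s))\<^sup>2) = lip\<^sup>2"
proof -
  have "integrable (distr M P (w k)) (\<lambda>b. (L b)\<^sup>2)" unfolding w_law by (rule L_sq)
  then show "integrable M (\<lambda>s. (L (w k s))\<^sup>2)" by (rule integrable_distr[rotated]) simp
  have "(\<integral>b. (L b)\<^sup>2 \<partial>distr M P (w k)) = expectation (\<lambda>s. (L (w k s))\<^sup>2)" by (rule integral_distr) auto
  then show "expectation (\<lambda>s. (L (w k s))\<^sup>2) = lip\<^sup>2" by (simp add: w_law lip_sq)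
qed

lemma w_space: "s \<in> space M \<Longrightarrow> w k s \<in> space P"
  using w_rv by (rule measurable_space)

lemma grad_norm_le: "s \<in> space M \<Longrightarrow> norm (grad k s) \<le> real CARD('n) * L (w k s)"
  unfolding grad_def by (rule zo_gradient_norm_le) (auto simp: iter_in_X v_norm w_space)

lemma grad_norm_sq_le: "s \<in> space M \<Longrightarrow> (norm (grad k s))\<^sup>2 \<le> (real CARD('n))\<^sup>2 * (L (w k s))\<^sup>2"
  using power_mono[OF grad_norm_le, of s k 2] by (simp add: power_mult_distrib)

lemma grad_sq_integrable: "integrable M (\<lambda>s. (norm (grad k s))\<^sup>2)"
  by (rule Bochner_Integration.integrable_bound[OF Bochner_Integration.integrable_mult_right[OF L_w_sq_integrable[of k], of "(real CARD('n))\<^sup>2"]])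
     (auto intro!: AE_I2 grad_norm_sq_le)

lemma grad_sq_expectation: "expectation (\<lambda>s. (norm (grad k s))\<^sup>2) \<le> (real CARD('n))\<^sup>2 * lip\<^sup>2"
proof -
  have "expectation (\<lambda>s. (norm (grad k s))\<^sup>2) \<le> expectation (\<lambda>s. (real CARD('n))\<^sup>2 * (L (w k s))\<^sup>2)"
    using L_w_sq_integrable by (intro integral_mono grad_sq_integrable) (auto intro!: grad_norm_sq_le)
  then show ?thesis by (simp add: L_w_sq_expectation)
qed

lemma grad_norm_integrable: "integrable M (\<lambda>s. norm (grad k s))"
  using square_integrable_imp_integrable[of "\<lambda>s. norm (grad k s)"] grad_sq_integrable by simp

lemma integrable_bounded_multiple_grad:
  fixes V :: "'s \<Rightarrow> real^'n"
  assumes V [measurable]: "V \<in> borel_measurable M" and b: "\<And>s. s \<in> space M \<Longrightarrow> norm (V s) \<le> B"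
  shows "integrable M (\<lambda>s. grad k s \<bullet> V s)"
proof (rule Bochner_Integration.integrable_bound[OF Bochner_Integration.integrable_mult_right[OF grad_norm_integrable[of k], of B]])
  show "AE s in M. norm (grad k s \<bullet> V s) \<le> norm (B * norm (grad k s))"
  proof (rule AE_I2)
    fix s assume s: "s \<in> space M"
    have "\<bar>grad k s \<bullet> V s\<bar> \<le> norm (grad k s) * norm (V s)" by (rule Cauchy_Schwarz_ineq2)
    also have "\<dots> \<le> norm (grad k s) * B" using b[OF s] by (rule mult_left_mono) simp
    also have "\<dots> \<le> \<bar>B * norm (grad k s)\<bar>" by (simp add: mult.commute)
    finally show "norm (grad k s \<bullet> V s) \<le> norm (B * norm (grad k s))" by simp
  qed
qed measurable

text \<open>The past enters through \<open>V\<close> and the current iterate, so by independence \<open>mean_gradient\<close>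
  plays the role of the conditional expectation of \<open>grad\<close>.\<close>

lemma expectation_grad_past:
  assumes V: "V \<in> borel_measurable (past k)" and b: "\<And>s. s \<in> space M \<Longrightarrow> norm (V s) \<le> B"
  shows "expectation (\<lambda>s. grad k s \<bullet> V s) = expectation (\<lambda>s. mean_gradient k (iter k s) \<bullet> V s)"
proof -
  let ?U = "uniform_sphere (\<eta> k) \<Otimes>\<^sub>M P :: ((real^'n) \<times> 'w) measure"
  let ?B = "borel \<Otimes>\<^sub>M borel :: ((real^'n) \<times> (real^'n)) measure"
  \<comment> \<open>Pairing the multiplier with the iterate makes the integrand a function of
    \<open>Y\<close> and the fresh pair alone.\<close>
  define Y where "Y s = (V s, iter k s)" for s
  have Y: "Y \<in> past k \<rightarrow>\<^sub>M ?B" unfolding Y_def using V iter_past by measurable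
  have Ym [measurable]: "Y \<in> M \<rightarrow>\<^sub>M ?B" using Y by (rule past_rv)
  interpret U: prob_space ?U by (rule prob_space_law)
  interpret D: prob_space "distr M ?B Y" by (rule prob_space_distr) simp
  interpret DU: pair_sigma_finite "distr M ?B Y" ?U ..
  define \<Phi> where "\<Phi> q = zo_gradient h (\<eta> k) (snd (fst q)) (fst (snd q)) (snd (snd q)) \<bullet> fst (fst q)" for q :: "((real^'n) \<times> (real^'n)) \<times> ((real^'n) \<times> 'w)"
  have \<Phi>m [measurable]: "\<Phi> \<in> borel_measurable (?B \<Otimes>\<^sub>M (borel \<Otimes>\<^sub>M P))"
  proof -
    have "(\<lambda>q :: ((real^'n) \<times> (real^'n)) \<times> ((real^'n) \<times> 'w). (snd (fst q), snd q)) \<in> ?B \<Otimes>\<^sub>M (borel \<Otimes>\<^sub>M P) \<rightarrow>\<^sub>M borel \<Otimes>\<^sub>M (borel \<Otimes>\<^sub>M P)"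
      by measurable
    from measurable_compose[OF this zo_gradient_measurable[of "\<eta> k"]]
    have [measurable]: "(\<lambda>q. zo_gradient h (\<eta> k) (snd (fst q)) (fst (snd q)) (snd (snd q))) \<in> borel_measurable (?B \<Otimes>\<^sub>M (borel \<Otimes>\<^sub>M P))" by simp
    show ?thesis unfolding \<Phi>_def by measurable
  qed
  have eq: "\<Phi> (Y s, (v k s, w k s)) = grad k s \<bullet> V s" for s
    by (simp add: \<Phi>_def Y_def grad_def)
  have "integrable M (\<lambda>s. \<Phi> (Y s, (v k s, w k s)))"
    unfolding eq using past_rv[OF V] b by (rule integrable_bounded_multiple_grad)
  then have int: "integrable (distr M ?B Y \<Otimes>\<^sub>M ?U) \<Phi>"
    unfolding past_indep[OF Y, symmetric] by (subst integrable_distr_eq) auto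
  have "expectation (\<lambda>s. grad k s \<bullet> V s) = (\<integral>q. \<Phi> q \<partial>(distr M ?B Y \<Otimes>\<^sub>M ?U))"
    unfolding past_indep[OF Y, symmetric] by (subst integral_distr) (auto simp: eq)
  also have "\<dots> = (\<integral>a. (\<integral>p. \<Phi> (a, p) \<partial>?U) \<partial>distr M ?B Y)"
    using DU.integral_fst'[OF int] by simp
  also have "\<dots> = expectation (\<lambda>s. \<integral>p. \<Phi> (Y s, p) \<partial>?U)"
  proof (rule integral_distr[OF Ym])
    have "\<Phi> \<in> borel_measurable (?B \<Otimes>\<^sub>M ?U)" by measurable
    then show "(\<lambda>a. \<integral>p. \<Phi> (a, p) \<partial>?U) \<in> borel_measurable ?B" by (intro U.borel_measurable_lebesgue_integral) simp
  qed
  also have "\<dots> = expectation (\<lambda>s. mean_gradient k (iter k s) \<bullet> V s)"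
    by (intro Bochner_Integration.integral_cong refl)
       (simp add: \<Phi>_def Y_def mean_gradient_def integral_inner_left[OF zo_gradient_integrable[OF iter_in_X]])
  finally show ?thesis .
qed

definition noise :: "nat \<Rightarrow> 's \<Rightarrow> real^'n" where
  "noise k s = grad k s - mean_gradient k (iter k s)"

lemma mean_gradient_iter_past: "(\<lambda>s. mean_gradient k (iter k s)) \<in> borel_measurable (past k)"
  using measurable_compose[OF iter_past mean_gradient_measurable] .

lemma noise_past: "noise k \<in> borel_measurable (past (Suc k))"
  unfolding noise_def[abs_def] using grad_past past_mono_measurable[OF mean_gradient_iter_past]
  by measurable

lemma noise_rv [measurable]: "noise k \<in> borel_measurable M" using noise_past by (rule past_rv)

lemma noise_norm_sq_le: "(norm (noise k s))\<^sup>2 \<le> 2 * (norm (grad k s))\<^sup>2 + 2 * (real CARD('n) * lip)\<^sup>2"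
proof -
  have "norm (noise k s) \<le> norm (grad k s) + norm (mean_gradient k (iter k s))"
    unfolding noise_def by (rule norm_triangle_ineq4)
  also have "\<dots> \<le> norm (grad k s) + real CARD('n) * lip"
    using mean_gradient_norm_le[OF iter_in_X] by simp
  finally have "(norm (noise k s))\<^sup>2 \<le> (norm (grad k s) + real CARD('n) * lip)\<^sup>2" by (rule power_mono) simp
  also have "\<dots> \<le> 2 * (norm (grad k s))\<^sup>2 + 2 * (real CARD('n) * lip)\<^sup>2"
    using zero_le_power2[of "norm (grad k s) - real CARD('n) * lip"] by (simp add: power2_eq_square algebra_simps)
  finally show ?thesis .
qed

lemma noise_sq_integrable: "integrable M (\<lambda>s. (norm (noise k s))\<^sup>2)"
  by (rule Bochner_Integration.integrable_bound[where f = "\<lambda>s. 2 * (norm (grad k s))\<^sup>2 + 2 * (real CARD('n) * lip)\<^sup>2"])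
     (auto intro!: grad_sq_integrable AE_I2 noise_norm_sq_le)

text \<open>The second moment of the gradient and the squared norm of its mean are both at most
  \<open>(real CARD('n) * lip)\<^sup>2\<close>, and each enters with a factor 2.\<close>

lemma noise_sq_expectation: "expectation (\<lambda>s. (norm (noise k s))\<^sup>2) \<le> 4 * (real CARD('n) * lip)\<^sup>2"
proof -
  have "expectation (\<lambda>s. (norm (noise k s))\<^sup>2) \<le> expectation (\<lambda>s. 2 * (norm (grad k s))\<^sup>2 + 2 * (real CARD('n) * lip)\<^sup>2)"
    by (intro integral_mono noise_sq_integrable noise_norm_sq_le) (auto intro!: grad_sq_integrable)
  also have "\<dots> = 2 * expectation (\<lambda>s. (norm (grad k s))\<^sup>2) + 2 * (real CARD('n) * lip)\<^sup>2"
    using grad_sq_integrable by (simp add: prob_space)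
  also have "\<dots> \<le> 4 * (real CARD('n) * lip)\<^sup>2"
    using grad_sq_expectation[of k] by (simp add: power_mult_distrib mult.commute)
  finally show ?thesis .
qed

text \<open>This supplies the multiplier form of the martingale difference property for the
  vector-valued noise.\<close>

lemma noise_orthogonal:
  assumes V: "V \<in> borel_measurable (past k)" and b: "\<And>s. s \<in> space M \<Longrightarrow> norm (V s) \<le> B"
  shows "expectation (\<lambda>s. noise k s \<bullet> V s) = 0"
proof -
  have [measurable]: "V \<in> borel_measurable M" using V by (rule past_rv)
  have "integrable M (\<lambda>s. mean_gradient k (iter k s) \<bullet> V s)"
  proof (rule integrable_const_bound[where B = "(real CARD('n) * lip) * B"])
    show "AE s in M. norm (mean_gradient k (iter k s) \<bullet> V s) \<le> (real CARD('n) * lip) * B"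
    proof (rule AE_I2)
      fix s assume "s \<in> space M"
      then show "norm (mean_gradient k (iter k s) \<bullet> V s) \<le> (real CARD('n) * lip) * B"
        using mult_mono[OF mean_gradient_norm_le[OF iter_in_X[of k s], of k] b[of s]] lip_nonneg
          Cauchy_Schwarz_ineq2[of "mean_gradient k (iter k s)" "V s"] by force
    qed
  qed measurable
  then show ?thesis
    using expectation_grad_past[OF V b] integrable_bounded_multiple_grad[OF _ b, where k = k]
    by (simp add: noise_def inner_diff_left)
qed

text \<open>Meant for \<open>A\<close> the identity and for constant basis vectors. Since
  \<open>A\<close> is bounded on \<open>X\<close>, the second moments are at most a constant times
  \<open>(\<gamma> k)\<^sup>2\<close>.\<close>

lemma AE_summable_noise:
  fixes A :: "real^'n \<Rightarrow> real^'n"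
  assumes A: "A \<in> borel_measurable borel" and b: "\<And>x. x \<in> X \<Longrightarrow> norm (A x) \<le> C"
    and \<gamma>2: "summable (\<lambda>k. (\<gamma> k)\<^sup>2)"
  shows "AE s in M. summable (\<lambda>k. \<gamma> k * (noise k s \<bullet> A (iter k s)))"
proof (rule AE_summable_martingale_differences[where F = past])
  have C: "0 \<le> C" using b[OF x0] norm_ge_zero order_trans by blast
  have Ap: "(\<lambda>s. A (iter k s)) \<in> borel_measurable (past k)" for k
    by (rule measurable_compose[OF iter_past A])
  have [measurable]: "(\<lambda>s. A (iter k s)) \<in> borel_measurable M" for k using Ap by (rule past_rv)
  show "subalgebra M (past k)" "sets (past k) \<subseteq> sets (past (Suc k))" for k
    by (rule past_subalgebra past_mono)+
  show "(\<lambda>s. \<gamma> k * (noise k s \<bullet> A (iter k s))) \<in> borel_measurable (past (Suc k))" for k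
    using noise_past[of k] past_mono_measurable[OF Ap[of k]] by measurable
  have pt: "(\<gamma> k * (noise k s \<bullet> A (iter k s)))\<^sup>2 \<le> (\<gamma> k)\<^sup>2 * (C\<^sup>2 * (norm (noise k s))\<^sup>2)" for k s
  proof -
    have "\<bar>noise k s \<bullet> A (iter k s)\<bar> \<le> norm (noise k s) * norm (A (iter k s))" by (rule Cauchy_Schwarz_ineq2)
    also have "\<dots> \<le> norm (noise k s) * C" using b[OF iter_in_X] by (rule mult_left_mono) simp
    finally have "\<bar>noise k s \<bullet> A (iter k s)\<bar>\<^sup>2 \<le> (norm (noise k s) * C)\<^sup>2" by (rule power_mono) simp
    then show ?thesis by (simp add: power_mult_distrib mult_left_mono mult.commute)
  qed
  show sq: "integrable M (\<lambda>s. (\<gamma> k * (noise k s \<bullet> A (iter k s)))\<^sup>2)" for k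
    by (rule Bochner_Integration.integrable_bound[where f = "\<lambda>s. (\<gamma> k)\<^sup>2 * (C\<^sup>2 * (norm (noise k s))\<^sup>2)"])
       (auto intro!: noise_sq_integrable AE_I2 pt)
  have le: "expectation (\<lambda>s. (\<gamma> k * (noise k s \<bullet> A (iter k s)))\<^sup>2) \<le> (\<gamma> k)\<^sup>2 * (C\<^sup>2 * (4 * (real CARD('n) * lip)\<^sup>2))" for k
  proof -
    have "expectation (\<lambda>s. (\<gamma> k * (noise k s \<bullet> A (iter k s)))\<^sup>2) \<le> expectation (\<lambda>s. (\<gamma> k)\<^sup>2 * (C\<^sup>2 * (norm (noise k s))\<^sup>2))"
      by (intro integral_mono sq pt) (auto intro!: noise_sq_integrable)
    also have "\<dots> = (\<gamma> k)\<^sup>2 * (C\<^sup>2 * expectation (\<lambda>s. (norm (noise k s))\<^sup>2))" by simp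
    also have "\<dots> \<le> (\<gamma> k)\<^sup>2 * (C\<^sup>2 * (4 * (real CARD('n) * lip)\<^sup>2))"
      by (intro mult_left_mono noise_sq_expectation) auto
    finally show ?thesis .
  qed
  show "summable (\<lambda>k. expectation (\<lambda>s. (\<gamma> k * (noise k s \<bullet> A (iter k s)))\<^sup>2))"
    by (rule summable_comparison_test'[OF summable_mult2[OF \<gamma>2, of "C\<^sup>2 * (4 * (real CARD('n) * lip)\<^sup>2)"]])
       (use le in auto)
  show "expectation (\<lambda>s. W s * (\<gamma> k * (noise k s \<bullet> A (iter k s)))) = 0"
    if W: "W \<in> borel_measurable (past k)" "\<And>s. \<bar>W s\<bar> \<le> B" for k W B
  proof -
    \<comment> \<open>The scalar multiplier and the step size are moved into the vector
      multiplier.\<close>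
    have "expectation (\<lambda>s. noise k s \<bullet> ((W s * \<gamma> k) *\<^sub>R A (iter k s))) = 0"
    proof (rule noise_orthogonal[where B = "(B * \<gamma> k) * C"])
      show "(\<lambda>s. (W s * \<gamma> k) *\<^sub>R A (iter k s)) \<in> borel_measurable (past k)" using W(1) Ap by measurable
      fix s
      have "0 \<le> B" using W(2)[of s] by simp
      then show "norm ((W s * \<gamma> k) *\<^sub>R A (iter k s)) \<le> (B * \<gamma> k) * C"
        using W(2)[of s] b[OF iter_in_X[of k s]] \<gamma>_pos[of k] C
        by (auto simp: abs_mult intro!: mult_mono)
    qed
    then show ?thesis by (simp add: mult.assoc)
  qed
qed

end

section \<open>Descent, rates and almost sure convergence\<close>


text \<open>Summation by parts. Written in terms of the non-negative gaps \<open>D - d k\<close>, an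
  increase of the weight from \<open>\<beta> K\<close> to \<open>\<beta> (Suc K)\<close> can only
  enlarge the bound.\<close>

lemma weighted_telescoping_le:
  fixes d \<beta> :: "nat \<Rightarrow> real"
  assumes \<beta>: "incseq \<beta>" and d: "\<And>k. d k \<le> D"
  shows "(\<Sum>k\<le>K. \<beta> k * (d k - d (Suc k))) \<le> \<beta> K * (D - d (Suc K)) - \<beta> 0 * (D - d 0)"
proof (induction K)
  case 0
  show ?case by (simp add: algebra_simps)
next
  case (Suc K)
  have "\<beta> K * (D - d (Suc K)) \<le> \<beta> (Suc K) * (D - d (Suc K))"
    using \<beta> d by (intro mult_right_mono) (auto simp: incseq_Suc_iff)
  then show ?case using Suc by (simp add: algebra_simps)
qed

context zeroth_order_scheme
begin

definition avg :: "real \<Rightarrow> nat \<Rightarrow> 's \<Rightarrow> real^'n" where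
  "avg r k s = (1 / (\<Sum>i\<le>k. \<gamma> i powr r)) *\<^sub>R (\<Sum>i\<le>k. (\<gamma> i powr r) *\<^sub>R iter i s)"

definition opt :: "(real^'n) set" where "opt = solution_set X f"

definition fopt :: real where "fopt = optimal_value X f"

lemma \<gamma>_powr_pos: "0 < \<gamma> k powr r"
  using \<gamma>_pos[of k] by simp

lemma weight_pos: "0 < (\<Sum>i\<le>k. \<gamma> i powr r)"
  by (intro sum_pos \<gamma>_powr_pos) auto

lemma zo_gradient_cong:
  assumes "\<And>x b. x \<in> S \<Longrightarrow> b \<in> space P \<Longrightarrow> h' x b = h x b" and "x \<in> X" and "s \<in> space M"
  shows "zo_gradient h' (\<eta> k) x (v k s) (w k s) = zo_gradient h (\<eta> k) x (v k s) (w k s)"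
proof -
  have "x + v k s \<in> S" using X_S[of x k] v_norm[of s k] assms by (auto simp: subset_iff dist_norm)
  then show ?thesis using assms w_space X_sub_S by (auto simp: zo_gradient_def)
qed

text \<open>All evaluations happen at points of \<open>S\<close>, so an integrand that agrees with
  \<open>h\<close> there produces the same trajectory. The recursive average unfolds because weight
  times average is the running weighted sum.\<close>

lemma zsol_eq:
  assumes eq: "\<And>x b. x \<in> S \<Longrightarrow> b \<in> space P \<Longrightarrow> h' x b = h x b" and s: "s \<in> space M"
  shows "iterate (zsol X h' r \<gamma> \<eta> x0 (\<lambda>i. v i s) (\<lambda>i. w i s) k) = iter k s
    \<and> weight (zsol X h' r \<gamma> \<eta> x0 (\<lambda>i. v i s) (\<lambda>i. w i s) k) = (\<Sum>i\<le>k. \<gamma> i powr r)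
    \<and> average (zsol X h' r \<gamma> \<eta> x0 (\<lambda>i. v i s) (\<lambda>i. w i s) k) = avg r k s"
proof (induction k)
  case 0
  then show ?case using weight_pos[of r 0] by (simp add: avg_def)
next
  case (Suc k)
  have "zo_gradient h' (\<eta> k) (iter k s) (v k s) (w k s) = zo_gradient h (\<eta> k) (iter k s) (v k s) (w k s)"
    by (rule zo_gradient_cong[OF eq iter_in_X s])
  moreover have "(\<Sum>i\<le>k. \<gamma> i powr r) *\<^sub>R avg r k s = (\<Sum>i\<le>k. (\<gamma> i powr r) *\<^sub>R iter i s)"
    using weight_pos[of r k] by (simp add: avg_def)
  ultimately show ?case using Suc by (simp add: zsol_step_def Let_def avg_def)
qed

section \<open>The solution set and the value of the averaged iterate\<close>

lemma opt_nonempty: "opt \<noteq> {}"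
proof -
  obtain z where "z \<in> X" "\<forall>x\<in>X. f z \<le> f x"
    using continuous_attains_inf[OF X(2,1) f_cont_X] by blast
  then have "z \<in> opt" by (simp add: opt_def solution_set_def)
  then show ?thesis by auto
qed

lemma opt_subset: "opt \<subseteq> X" by (auto simp: opt_def solution_set_def)

lemma fopt_eq: "z \<in> opt \<Longrightarrow> f z = fopt"
  unfolding fopt_def optimal_value_def opt_def solution_set_def
  by (intro cInf_eq_minimum[symmetric]) auto

lemma fopt_le: "x \<in> X \<Longrightarrow> fopt \<le> f x"
proof -
  assume x: "x \<in> X"
  obtain z where z: "z \<in> opt" using opt_nonempty by blast
  then have "f z \<le> f x" using x by (simp add: opt_def solution_set_def)
  then show ?thesis using fopt_eq[OF z] by simp
qed

text \<open>The sublevel form from which closedness and convexity of the solution set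
  follow.\<close>

lemma opt_eq: "opt = {x \<in> X. f x \<le> fopt}"
proof (intro equalityI subsetI)
  fix x assume "x \<in> opt"
  then show "x \<in> {x \<in> X. f x \<le> fopt}" using opt_subset fopt_eq[of x] by auto
next
  fix x assume x: "x \<in> {x \<in> X. f x \<le> fopt}"
  have "f x \<le> f z" if "z \<in> X" for z using x fopt_le[OF that] by simp
  then show "x \<in> opt" using x by (simp add: opt_def solution_set_def)
qed

lemma opt_closed: "closed opt"
  unfolding opt_eq by (rule continuous_on_closed_Collect_le[OF f_cont_X continuous_on_const X_closed])

lemma opt_convex: "convex opt"
proof (rule convexI)
  fix x y and u v :: real
  assume xy: "x \<in> opt" "y \<in> opt" and u: "0 \<le> u" "0 \<le> v" "u + v = 1"
  then have X': "u *\<^sub>R x + v *\<^sub>R y \<in> X" using X(3) opt_subset by (intro convexD) auto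
  have "f (u *\<^sub>R x + v *\<^sub>R y) \<le> u * f x + v * f y"
  proof -
    have "x \<in> S" "y \<in> S" using xy opt_subset X_sub_S by auto
    then show ?thesis using u f_convex unfolding convex_on_def by blast
  qed
  also have "\<dots> = (u + v) * fopt" using xy by (simp add: fopt_eq distrib_right)
  finally show "u *\<^sub>R x + v *\<^sub>R y \<in> opt" using X' u by (simp add: opt_eq)
qed

text \<open>Outside \<open>S\<close> nothing is known about \<open>f\<close>, so measurability goes
  through a continuous extension that agrees with \<open>f\<close> wherever \<open>Y\<close> takes
  its values.\<close>

lemma f_comp_measurable:
  assumes Y: "Y \<in> borel_measurable M" and YX: "\<And>s. s \<in> space M \<Longrightarrow> Y s \<in> X"
  shows "(\<lambda>s. f (Y s)) \<in> borel_measurable M"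
proof -
  obtain g where g: "continuous_on UNIV g" "\<And>y. y \<in> S \<Longrightarrow> g y = f y"
    using Tietze_unbounded[OF f_cont, of UNIV] S_closed by auto
  have "(\<lambda>s. g (Y s)) \<in> borel_measurable M"
    using borel_measurable_continuous_onI[OF g(1)] Y by measurable
  then show ?thesis
    by (rule measurable_cong[THEN iffD1, rotated]) (use YX X_sub_S g(2) in auto)
qed

lemma f_comp_integrable:
  assumes Y: "Y \<in> borel_measurable M" and YX: "\<And>s. s \<in> space M \<Longrightarrow> Y s \<in> X"
  shows "integrable M (\<lambda>s. f (Y s))"
proof -
  have "compact (f ` X)" using f_cont_X X(2) by (rule compact_continuous_image)
  then obtain B where "\<forall>x\<in>X. \<bar>f x\<bar> \<le> B" by (auto dest!: compact_imp_bounded simp: bounded_iff)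
  then show ?thesis
    using YX by (intro integrable_const_bound[where B = B] f_comp_measurable[OF Y] AE_I2) auto
qed

lemma avg_rv [measurable]: "avg r k \<in> borel_measurable M"
  unfolding avg_def[abs_def] by measurable

lemma avg_eq_convex_combination:
  "avg r k s = (\<Sum>i\<le>k. (\<gamma> i powr r / (\<Sum>i\<le>k. \<gamma> i powr r)) *\<^sub>R iter i s)"
  by (simp add: avg_def scaleR_sum_right)

lemma avg_in_X: "avg r k s \<in> X"
  unfolding avg_eq_convex_combination
  using weight_pos[of r k] X(3) iter_in_X by (intro convex_sum) (auto simp flip: sum_divide_distrib)

lemma f_avg_le: "f (avg r k s) \<le> (\<Sum>i\<le>k. (\<gamma> i powr r / (\<Sum>i\<le>k. \<gamma> i powr r)) * f (iter i s))"
  unfolding avg_eq_convex_combination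
  using weight_pos[of r k] iter_in_X X_sub_S
  by (intro convex_on_sum[OF _ _ f_convex]) (auto simp flip: sum_divide_distrib)

section \<open>Descent in expectation\<close>

lemma iter_descent:
  assumes z: "z \<in> X"
  shows "(norm (iter (Suc k) s - z))\<^sup>2 \<le> (norm (iter k s - z))\<^sup>2 - 2 * \<gamma> k * (grad k s \<bullet> (iter k s - z)) + (\<gamma> k)\<^sup>2 * (norm (grad k s))\<^sup>2"
proof -
  have "norm (iter (Suc k) s - z) \<le> norm (iter k s - \<gamma> k *\<^sub>R grad k s - z)"
    using closest_point_lipschitz[OF X(3) X_closed X(1), of "iter k s - \<gamma> k *\<^sub>R grad k s" z]
    unfolding closest_point_self[OF z] dist_norm iter_Suc_grad .
  then have "(norm (iter (Suc k) s - z))\<^sup>2 \<le> (norm ((iter k s - z) - \<gamma> k *\<^sub>R grad k s))\<^sup>2"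
    by (intro power_mono) (auto simp: algebra_simps)
  also have "\<dots> = (norm (iter k s - z))\<^sup>2 - 2 * \<gamma> k * (grad k s \<bullet> (iter k s - z)) + (\<gamma> k)\<^sup>2 * (norm (grad k s))\<^sup>2"
    by (simp only: power2_norm_eq_inner) (simp add: inner_diff_left inner_diff_right inner_commute power2_eq_square algebra_simps)
  finally show ?thesis .
qed

definition sq_dist :: "nat \<Rightarrow> 's \<Rightarrow> real" where
  "sq_dist k s = (infdist (iter k s) opt)\<^sup>2"

abbreviation "D \<equiv> half_sq_distance X opt"

lemma infdist_sq_le:
  assumes "x \<in> X"
  shows "(infdist x opt)\<^sup>2 \<le> 2 * D"
proof -
  have "compact ((\<lambda>x. (infdist x opt)\<^sup>2) ` X)"
    using X(2) by (intro compact_continuous_image continuous_intros)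
  then have "bdd_above ((\<lambda>x. (infdist x opt)\<^sup>2) ` X)"
    by (intro bounded_imp_bdd_above compact_imp_bounded)
  then show ?thesis
    using cSUP_upper[OF assms, of "\<lambda>x. (infdist x opt)\<^sup>2"] by (simp add: half_sq_distance_def)
qed

lemma sq_dist_rv [measurable]: "sq_dist k \<in> borel_measurable M"
proof -
  have "(\<lambda>x. infdist x opt) \<in> borel_measurable borel"
    by (intro borel_measurable_continuous_onI continuous_intros)
  then show ?thesis unfolding sq_dist_def[abs_def] by measurable
qed

lemma sq_dist_le: "sq_dist k s \<le> 2 * D"
  unfolding sq_dist_def using iter_in_X by (rule infdist_sq_le)

lemma sq_dist_integrable: "integrable M (sq_dist k)"
  by (rule integrable_const_bound[where B = "2 * D"]) (use sq_dist_le in \<open>auto simp: sq_dist_def\<close>)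

text \<open>The comparison point is the projection of the current iterate onto the solution set. It
  is random but determined by the past and bounded away by at most \<open>sqrt (2 * D)\<close>, so
  the gradient may be exchanged for its mean.\<close>

lemma expected_descent:
  "expectation (sq_dist (Suc k)) \<le> expectation (sq_dist k)
     - 2 * \<gamma> k * (expectation (\<lambda>s. f (iter k s)) - fopt - \<eta> k * lip) + (\<gamma> k)\<^sup>2 * ((real CARD('n))\<^sup>2 * lip\<^sup>2)"
proof -
  define \<pi> where "\<pi> = closest_point opt"
  have \<pi>m [measurable]: "\<pi> \<in> borel_measurable borel"
    unfolding \<pi>_def by (intro borel_measurable_continuous_onI continuous_on_closest_point opt_convex opt_closed opt_nonempty)
  have \<pi>: "\<pi> x \<in> opt" for x unfolding \<pi>_def by (rule closest_point_in_set[OF opt_closed opt_nonempty])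
  have \<pi>X: "\<pi> x \<in> X" for x using \<pi> opt_subset by auto
  have \<pi>d: "norm (x - \<pi> x) = infdist x opt" for x
  proof -
    obtain z where z: "z \<in> opt" "infdist x opt = dist x z"
      using infdist_attains_inf[OF opt_closed opt_nonempty] by metis
    have "dist x (\<pi> x) \<le> dist x z" unfolding \<pi>_def by (rule closest_point_le[OF opt_closed z(1)])
    then show ?thesis using z(2) infdist_le[OF \<pi>[of x], of x] by (simp add: dist_norm)
  qed
  define V where "V s = iter k s - \<pi> (iter k s)" for s
  have Vp: "V \<in> borel_measurable (past k)"
    unfolding V_def using measurable_compose[OF iter_past \<pi>m] iter_past by measurable
  have [measurable]: "V \<in> borel_measurable M" using Vp by (rule past_rv)
  have Vb: "norm (V s) \<le> sqrt (2 * D)" for s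
    unfolding V_def \<pi>d using infdist_sq_le[OF iter_in_X] by (intro real_le_rsqrt) auto
  have iV: "integrable M (\<lambda>s. grad k s \<bullet> V s)"
    by (rule integrable_bounded_multiple_grad[OF _ Vb]) measurable
  have pt: "sq_dist (Suc k) s \<le> sq_dist k s - 2 * \<gamma> k * (grad k s \<bullet> V s) + (\<gamma> k)\<^sup>2 * (norm (grad k s))\<^sup>2" for s
  proof -
    \<comment> \<open>The projection of the old iterate is still a solution, hence a competitor for
      the distance of the new one.\<close>
    have "sq_dist (Suc k) s \<le> (norm (iter (Suc k) s - \<pi> (iter k s)))\<^sup>2"
      unfolding sq_dist_def using infdist_le[OF \<pi>] by (intro power_mono) (auto simp: dist_norm infdist_nonneg simp del: iter.simps)
    then show ?thesis
      using iter_descent[OF \<pi>X, of k s "iter k s"] unfolding V_def sq_dist_def \<pi>d[symmetric] by linarith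
  qed
  have if': "integrable M (\<lambda>s. f (iter k s))" by (rule f_comp_integrable) (auto simp: iter_in_X)
  have mg: "f (iter k s) - fopt - \<eta> k * lip \<le> mean_gradient k (iter k s) \<bullet> V s" for s
    using mean_gradient_inequality[OF iter_in_X \<pi>X, of k s "iter k s" k] unfolding V_def by (simp add: fopt_eq \<pi>)
  have mi: "integrable M (\<lambda>s. mean_gradient k (iter k s) \<bullet> V s)"
  proof -
    \<comment> \<open>The mean term is the gradient term minus the noise term; the latter is
      dominated through the elementary bound on a product by the sum of squares.\<close>
    have "integrable M (\<lambda>s. noise k s \<bullet> V s)"
    proof (rule Bochner_Integration.integrable_bound[where f = "\<lambda>s. (norm (noise k s))\<^sup>2 + 2 * D"])
      show "AE s in M. norm (noise k s \<bullet> V s) \<le> norm ((norm (noise k s))\<^sup>2 + 2 * D)"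
      proof (rule AE_I2)
        fix s
        have "(norm (V s))\<^sup>2 \<le> 2 * D" unfolding V_def \<pi>d by (rule infdist_sq_le[OF iter_in_X])
        moreover have "0 \<le> 2 * D" using infdist_sq_le[OF x0] by (meson order_trans zero_le_power2)
        moreover have "\<bar>noise k s \<bullet> V s\<bar> \<le> norm (noise k s) * norm (V s)" by (rule Cauchy_Schwarz_ineq2)
        moreover have "2 * (norm (noise k s) * norm (V s)) \<le> (norm (noise k s))\<^sup>2 + (norm (V s))\<^sup>2"
          using sum_squares_bound[of "norm (noise k s)" "norm (V s)"] by simp
        moreover have "0 \<le> (norm (noise k s))\<^sup>2" "0 \<le> norm (noise k s) * norm (V s)" by auto
        ultimately show "norm (noise k s \<bullet> V s) \<le> norm ((norm (noise k s))\<^sup>2 + 2 * D)" by simp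
      qed
    qed (auto intro!: noise_sq_integrable)
    from Bochner_Integration.integrable_diff[OF iV this] show ?thesis
      by (simp add: noise_def inner_diff_left)
  qed
  have "expectation (\<lambda>s. f (iter k s) - fopt - \<eta> k * lip) \<le> expectation (\<lambda>s. mean_gradient k (iter k s) \<bullet> V s)"
    using if' mi mg by (intro integral_mono) auto
  then have m: "expectation (\<lambda>s. f (iter k s)) - fopt - \<eta> k * lip \<le> expectation (\<lambda>s. grad k s \<bullet> V s)"
    unfolding expectation_grad_past[OF Vp Vb] using if' by (simp add: prob_space)
  have "expectation (sq_dist (Suc k)) \<le> expectation (\<lambda>s. sq_dist k s - 2 * \<gamma> k * (grad k s \<bullet> V s) + (\<gamma> k)\<^sup>2 * (norm (grad k s))\<^sup>2)"
    using sq_dist_integrable iV grad_sq_integrable pt by (intro integral_mono) auto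
  also have "\<dots> = expectation (sq_dist k) - 2 * \<gamma> k * expectation (\<lambda>s. grad k s \<bullet> V s) + (\<gamma> k)\<^sup>2 * expectation (\<lambda>s. (norm (grad k s))\<^sup>2)"
    using sq_dist_integrable iV grad_sq_integrable by simp
  also have "\<dots> \<le> expectation (sq_dist k) - 2 * \<gamma> k * (expectation (\<lambda>s. f (iter k s)) - fopt - \<eta> k * lip) + (\<gamma> k)\<^sup>2 * ((real CARD('n))\<^sup>2 * lip\<^sup>2)"
    using m \<gamma>_pos[of k] grad_sq_expectation[of k] by (intro add_mono diff_mono mult_left_mono) auto
  finally show ?thesis .
qed

text \<open>Multiplying the descent inequality by \<open>\<gamma> k powr (r - 1)\<close> puts the
  weight \<open>\<gamma> k powr r\<close> on the gap. Since the steps decrease and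
  \<open>r \<le> 1\<close>, these factors increase, so summation by parts leaves only the last one
  times \<open>2 * D\<close>. Convexity passes from weighted gaps to the average.\<close>

theorem expected_suboptimality:
  assumes dec: "decseq \<gamma>" and r: "r \<le> 1"
  shows "(expectation (\<lambda>s. f (avg r K s)) - fopt) * (\<Sum>k\<le>K. \<gamma> k powr r)
    \<le> D * \<gamma> K powr (r - 1) + (1/2) * ((real CARD('n))\<^sup>2 * lip\<^sup>2) * (\<Sum>k\<le>K. \<gamma> k powr (r + 1))
       + lip * (\<Sum>k\<le>K. \<gamma> k powr r * \<eta> k)"
proof -
  define W where "W = (\<Sum>k\<le>K. \<gamma> k powr r)"
  define F where "F k = expectation (\<lambda>s. f (iter k s)) - fopt" for k
  define d where "d k = expectation (sq_dist k)" for k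
  define C where "C = (real CARD('n))\<^sup>2 * lip\<^sup>2"
  have W: "0 < W" unfolding W_def by (rule weight_pos)
  have ii: "integrable M (\<lambda>s. f (iter k s))" for k by (rule f_comp_integrable) (auto simp: iter_in_X)
  have "expectation (\<lambda>s. f (avg r K s)) \<le> expectation (\<lambda>s. \<Sum>i\<le>K. (\<gamma> i powr r / W) * f (iter i s))"
    unfolding W_def using ii by (intro integral_mono f_comp_integrable f_avg_le) (auto simp: avg_in_X)
  also have "\<dots> = (\<Sum>i\<le>K. (\<gamma> i powr r / W) * expectation (\<lambda>s. f (iter i s)))" using ii by simp
  finally have "W * expectation (\<lambda>s. f (avg r K s)) \<le> W * (\<Sum>i\<le>K. (\<gamma> i powr r / W) * expectation (\<lambda>s. f (iter i s)))"
    using W by (intro mult_left_mono) auto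
  also have "\<dots> = (\<Sum>i\<le>K. \<gamma> i powr r * expectation (\<lambda>s. f (iter i s)))" using W by (simp add: sum_distrib_left)
  finally have le: "W * expectation (\<lambda>s. f (avg r K s)) \<le> (\<Sum>i\<le>K. \<gamma> i powr r * expectation (\<lambda>s. f (iter i s)))" .
  have 1: "(expectation (\<lambda>s. f (avg r K s)) - fopt) * W \<le> (\<Sum>k\<le>K. \<gamma> k powr r * F k)"
  proof -
    have "(\<Sum>k\<le>K. \<gamma> k powr r * F k) = (\<Sum>k\<le>K. \<gamma> k powr r * expectation (\<lambda>s. f (iter k s))) - W * fopt"
      by (simp add: F_def right_diff_distrib sum_subtractf W_def sum_distrib_right)
    then show ?thesis using le unfolding left_diff_distrib by (simp only: mult.commute[of W])
  qed
  have step: "\<gamma> k powr r * F k \<le> (1/2) * (\<gamma> k powr (r - 1) * (d k - d (Suc k))) + (1/2) * C * \<gamma> k powr (r + 1) + lip * (\<gamma> k powr r * \<eta> k)" for k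
  proof -
    have g: "\<gamma> k powr r = \<gamma> k powr (r - 1) * \<gamma> k"
      using powr_add[of "\<gamma> k" "r - 1" 1, unfolded diff_add_cancel] \<gamma>_pos[of k] by simp
    have g2: "\<gamma> k powr (r + 1) = \<gamma> k powr (r - 1) * (\<gamma> k)\<^sup>2"
    proof -
      have "r + 1 = (r - 1) + 2" by simp
      then have "\<gamma> k powr (r + 1) = \<gamma> k powr (r - 1) * \<gamma> k powr 2" by (metis powr_add)
      then show ?thesis using \<gamma>_pos[of k] by (simp add: powr_numeral)
    qed
    have "2 * \<gamma> k * (F k - \<eta> k * lip) \<le> d k - d (Suc k) + (\<gamma> k)\<^sup>2 * C"
      using expected_descent[of k] unfolding F_def d_def C_def by linarith
    then have "\<gamma> k powr (r - 1) * (2 * \<gamma> k * (F k - \<eta> k * lip)) \<le> \<gamma> k powr (r - 1) * (d k - d (Suc k) + (\<gamma> k)\<^sup>2 * C)"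
      by (rule mult_left_mono) simp
    then show ?thesis unfolding g g2 by (simp add: algebra_simps)
  qed
  have d2: "d k \<le> 2 * D" for k
  proof -
    have "d k \<le> expectation (\<lambda>s. 2 * D)" unfolding d_def
      by (intro integral_mono sq_dist_integrable sq_dist_le) auto
    then show ?thesis by (simp add: prob_space)
  qed
  have d0: "0 \<le> d k" for k unfolding d_def sq_dist_def by simp
  have "(\<Sum>k\<le>K. \<gamma> k powr (r - 1) * (d k - d (Suc k))) \<le> \<gamma> K powr (r - 1) * (2 * D - d (Suc K)) - \<gamma> 0 powr (r - 1) * (2 * D - d 0)"
  proof (rule weighted_telescoping_le[OF _ d2])
    show "incseq (\<lambda>k. \<gamma> k powr (r - 1))"
      using dec r \<gamma>_pos by (auto simp: incseq_def decseq_def intro!: powr_mono2')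
  qed
  also have "\<dots> \<le> \<gamma> K powr (r - 1) * (2 * D)"
  proof -
    have "\<gamma> K powr (r - 1) * (2 * D - d (Suc K)) \<le> \<gamma> K powr (r - 1) * (2 * D)"
      using d0 by (intro mult_left_mono) auto
    moreover have "0 \<le> \<gamma> 0 powr (r - 1) * (2 * D - d 0)" using d2[of 0] by simp
    ultimately show ?thesis by linarith
  qed
  finally have 2: "(\<Sum>k\<le>K. \<gamma> k powr (r - 1) * (d k - d (Suc k))) \<le> \<gamma> K powr (r - 1) * (2 * D)" .
  have "(\<Sum>k\<le>K. \<gamma> k powr r * F k) \<le> (\<Sum>k\<le>K. (1/2) * (\<gamma> k powr (r - 1) * (d k - d (Suc k))) + (1/2) * C * \<gamma> k powr (r + 1) + lip * (\<gamma> k powr r * \<eta> k))"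
    by (intro sum_mono step)
  also have "\<dots> = (1/2) * (\<Sum>k\<le>K. \<gamma> k powr (r - 1) * (d k - d (Suc k))) + (1/2) * C * (\<Sum>k\<le>K. \<gamma> k powr (r + 1)) + lip * (\<Sum>k\<le>K. \<gamma> k powr r * \<eta> k)"
    by (simp only: sum.distrib sum_distrib_left)
  finally have 3: "(\<Sum>k\<le>K. \<gamma> k powr r * F k) \<le> (1/2) * (\<Sum>k\<le>K. \<gamma> k powr (r - 1) * (d k - d (Suc k))) + (1/2) * C * (\<Sum>k\<le>K. \<gamma> k powr (r + 1)) + lip * (\<Sum>k\<le>K. \<gamma> k powr r * \<eta> k)" .
  have "\<gamma> K powr (r - 1) * (2 * D) = 2 * (D * \<gamma> K powr (r - 1))" by simp
  with 1 2 3 show ?thesis unfolding W_def C_def by linarith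
qed

section \<open>Pathwise convergence to a solution\<close>

text \<open>None of the path conditions mentions a solution, so the quasi-Fejer property holds along
  this path for all solutions. That is what allows it to be applied to the cluster point
  \<open>l\<close>, which is known only once the path is given.\<close>

lemma iter_converges:
  assumes s: "s \<in> space M" and s\<gamma>\<eta>: "summable (\<lambda>k. \<gamma> k * \<eta> k)" and d\<gamma>: "\<not> summable \<gamma>"
    and n1: "summable (\<lambda>k. \<gamma> k * (noise k s \<bullet> iter k s))"
    and n2: "\<And>i. i \<in> Basis \<Longrightarrow> summable (\<lambda>k. \<gamma> k * (noise k s \<bullet> i))"
    and n3: "summable (\<lambda>k. (\<gamma> k)\<^sup>2 * (norm (grad k s))\<^sup>2)"
  obtains l where "l \<in> opt" "(\<lambda>k. iter k s) \<longlonglongrightarrow> l"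
proof -
  have fejer: "convergent (\<lambda>k. (norm (iter k s - z))\<^sup>2)" "summable (\<lambda>k. 2 * \<gamma> k * (f (iter k s) - fopt))"
    if z: "z \<in> opt" for z
  proof -
    define e where "e k = 2 * lip * (\<gamma> k * \<eta> k) - 2 * (\<gamma> k * (noise k s \<bullet> iter k s)) + 2 * (\<gamma> k * (noise k s \<bullet> z)) + (\<gamma> k)\<^sup>2 * (norm (grad k s))\<^sup>2" for k
    have zX: "z \<in> X" using z opt_subset by auto
    \<comment> \<open>Expansion in the basis reduces uncountably many solutions \<open>z\<close> to
      finitely many noise series.\<close>
    have "(\<lambda>k. \<gamma> k * (noise k s \<bullet> z)) = (\<lambda>k. \<Sum>i\<in>Basis. (z \<bullet> i) * (\<gamma> k * (noise k s \<bullet> i)))"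
      by (simp add: euclidean_inner[of _ z] sum_distrib_left mult_ac)
    moreover have "summable (\<lambda>k. \<Sum>i\<in>Basis. (z \<bullet> i) * (\<gamma> k * (noise k s \<bullet> i)))"
      by (intro summable_sum summable_mult n2)
    ultimately have nz: "summable (\<lambda>k. \<gamma> k * (noise k s \<bullet> z))" by simp
    have se: "summable e"
      unfolding e_def by (intro summable_add summable_diff summable_mult n1 n3 nz s\<gamma>\<eta>)
    have step: "(norm (iter (Suc k) s - z))\<^sup>2 \<le> (norm (iter k s - z))\<^sup>2 - 2 * \<gamma> k * (f (iter k s) - fopt) + e k" for k
    proof -
      have "f (iter k s) - fopt - \<eta> k * lip + noise k s \<bullet> (iter k s - z) \<le> grad k s \<bullet> (iter k s - z)"
        using mean_gradient_inequality[OF iter_in_X zX, of k s k] by (simp add: noise_def inner_diff_left fopt_eq[OF z])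
      then have "2 * \<gamma> k * (f (iter k s) - fopt - \<eta> k * lip + noise k s \<bullet> (iter k s - z)) \<le> 2 * \<gamma> k * (grad k s \<bullet> (iter k s - z))"
        using \<gamma>_pos[of k] by (intro mult_left_mono) auto
      then show ?thesis
        using iter_descent[OF zX, of k s] unfolding e_def by (simp add: inner_diff_right algebra_simps)
    qed
    have b: "0 \<le> 2 * \<gamma> k * (f (iter k s) - fopt)" for k
      using \<gamma>_pos[of k] fopt_le[OF iter_in_X] by simp
    show "convergent (\<lambda>k. (norm (iter k s - z))\<^sup>2)" "summable (\<lambda>k. 2 * \<gamma> k * (f (iter k s) - fopt))"
      using quasi_fejer_convergent[of "\<lambda>k. (norm (iter k s - z))\<^sup>2", OF _ b se step] by auto
  qed
  obtain z0 where z0: "z0 \<in> opt" using opt_nonempty by auto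
  \<comment> \<open>Otherwise the gap would eventually be bounded below, and the summable weighted
    gaps would force the step sizes to be summable.\<close>
  have "\<exists>k\<ge>j. f (iter k s) - fopt < 1 / real (Suc j)" for j
  proof (rule ccontr)
    assume "\<not> ?thesis"
    then have ge: "1 / real (Suc j) \<le> f (iter k s) - fopt" if "k \<ge> j" for k using that by (auto simp: not_less)
    have "summable (\<lambda>k. (real (Suc j) / 2) * (2 * \<gamma> k * (f (iter k s) - fopt)))"
      by (intro summable_mult fejer(2)[OF z0])
    then have "summable \<gamma>"
    proof (rule summable_comparison_test'[where N = j])
      fix k assume "j \<le> k"
      have "1 \<le> real (Suc j) * (f (iter k s) - fopt)"
        using mult_left_mono[OF ge[OF \<open>j \<le> k\<close>], of "real (Suc j)"] by simp
      from mult_left_mono[OF this, of "\<gamma> k"] \<gamma>_pos[of k]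
      have "norm (\<gamma> k) \<le> \<gamma> k * (real (Suc j) * (f (iter k s) - fopt))" by simp
      also have "\<dots> = (real (Suc j) / 2) * (2 * \<gamma> k * (f (iter k s) - fopt))" by simp
      finally show "norm (\<gamma> k) \<le> (real (Suc j) / 2) * (2 * \<gamma> k * (f (iter k s) - fopt))" .
    qed
    with d\<gamma> show False ..
  qed
  then have "\<forall>j. \<exists>k. k \<ge> j \<and> f (iter k s) - fopt < 1 / real (Suc j)" by blast
  from choice[OF this] obtain \<kappa> where "\<forall>j. \<kappa> j \<ge> j \<and> f (iter (\<kappa> j) s) - fopt < 1 / real (Suc j)" ..
  then have \<kappa>: "\<And>j. \<kappa> j \<ge> j" "\<And>j. f (iter (\<kappa> j) s) - fopt < 1 / real (Suc j)" by auto
  have "seq_compact X" using X(2) by (simp add: compact_eq_seq_compact_metric)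
  then obtain l \<rho> where l: "l \<in> X" "strict_mono \<rho>" "((\<lambda>j. iter (\<kappa> j) s) \<circ> \<rho>) \<longlonglongrightarrow> l"
    by (rule seq_compactE[of _ "\<lambda>j. iter (\<kappa> j) s"]) (auto simp: iter_in_X)
  define q where "q j = \<kappa> (\<rho> j)" for j
  have q: "(\<lambda>j. iter (q j) s) \<longlonglongrightarrow> l" using l(3) by (simp add: q_def comp_def)
  have q_top: "filterlim q at_top sequentially"
    by (rule filterlim_at_top_mono[OF filterlim_subseq[OF l(2)]]) (auto simp: q_def \<kappa>)
  have "(\<lambda>j. f (iter (q j) s)) \<longlonglongrightarrow> f l"
    using f_cont_X q l(1) by (rule continuous_on_tendsto_compose) (intro always_eventually allI iter_in_X)
  then have "f l \<le> fopt"
  proof (rule LIMSEQ_le)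
    have "(\<lambda>j. 1 / real (Suc (\<rho> j))) \<longlonglongrightarrow> 0"
      using filterlim_compose[OF LIMSEQ_inverse_real_of_nat filterlim_subseq[OF l(2)]]
      by (simp add: inverse_eq_divide)
    from tendsto_add[OF tendsto_const[of fopt] this]
    show "(\<lambda>j. fopt + 1 / real (Suc (\<rho> j))) \<longlonglongrightarrow> fopt" by simp
    have "f (iter (q j) s) \<le> fopt + 1 / real (Suc (\<rho> j))" for j
      using \<kappa>(2)[of "\<rho> j"] unfolding q_def by linarith
    then show "\<exists>N. \<forall>j\<ge>N. f (iter (q j) s) \<le> fopt + 1 / real (Suc (\<rho> j))" by blast
  qed
  then have lopt: "l \<in> opt" using l(1) by (simp add: opt_eq)
  \<comment> \<open>The distances to the solution \<open>l\<close> converge as a full sequence; a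
    subsequence of them tends to zero, so the limit is zero.\<close>
  obtain A where A: "(\<lambda>k. (norm (iter k s - l))\<^sup>2) \<longlonglongrightarrow> A"
    using fejer(1)[OF lopt] by (auto simp: convergent_def)
  have "(\<lambda>j. (norm (iter (q j) s - l))\<^sup>2) \<longlonglongrightarrow> A" using filterlim_compose[OF A q_top] .
  moreover have "(\<lambda>j. (norm (iter (q j) s - l))\<^sup>2) \<longlonglongrightarrow> (norm (l - l))\<^sup>2" by (intro tendsto_intros q)
  ultimately have "A = (norm (l - l))\<^sup>2" by (rule LIMSEQ_unique)
  then have "A = 0" by simp
  then have "(\<lambda>k. sqrt ((norm (iter k s - l))\<^sup>2)) \<longlonglongrightarrow> sqrt 0" using A by (intro tendsto_real_sqrt) auto
  then have "(\<lambda>k. norm (iter k s - l)) \<longlonglongrightarrow> 0" by simp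
  then have "(\<lambda>k. iter k s) \<longlonglongrightarrow> l" by (simp add: LIM_zero_cancel tendsto_norm_zero_iff)
  with lopt show thesis by (rule that)
qed

theorem AE_avg_converges:
  assumes s\<gamma>2: "summable (\<lambda>k. (\<gamma> k)\<^sup>2)" and s\<gamma>\<eta>: "summable (\<lambda>k. \<gamma> k * \<eta> k)"
    and d\<gamma>: "\<not> summable \<gamma>" and d\<gamma>r: "\<not> summable (\<lambda>k. \<gamma> k powr r)"
  shows "\<exists>xstar \<in> borel_measurable M. (\<forall>s\<in>space M. xstar s \<in> opt) \<and> (AE s in M. (\<lambda>k. avg r k s) \<longlonglongrightarrow> xstar s)"
proof -
  obtain z0 where z0: "z0 \<in> opt" using opt_nonempty by auto
  \<comment> \<open>The fallback \<open>z0\<close> makes the limit a solution for every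
    \<open>s\<close>, while measurability is kept because \<open>opt\<close> is closed.\<close>
  define xstar where "xstar s = (if lim (\<lambda>k. avg r k s) \<in> opt then lim (\<lambda>k. avg r k s) else z0)" for s
  have [measurable]: "opt \<in> sets borel" using opt_closed by simp
  have [measurable]: "(\<lambda>s. lim (\<lambda>k. avg r k s)) \<in> borel_measurable M" by measurable
  have xm: "xstar \<in> borel_measurable M" unfolding xstar_def by measurable
  have xo: "xstar s \<in> opt" for s using z0 by (simp add: xstar_def)
  obtain B where B: "\<And>x. x \<in> X \<Longrightarrow> norm x \<le> B"
    using compact_imp_bounded[OF X(2)] by (auto simp: bounded_iff)
  have a1: "AE s in M. summable (\<lambda>k. \<gamma> k * (noise k s \<bullet> iter k s))"
    using AE_summable_noise[of "\<lambda>x. x", OF _ B s\<gamma>2] by simp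
  have a2: "AE s in M. \<forall>i\<in>Basis. summable (\<lambda>k. \<gamma> k * (noise k s \<bullet> i))"
    using AE_summable_noise[of "\<lambda>_. i" "norm i" for i :: "real^'n", OF _ _ s\<gamma>2] by (intro AE_finite_allI) auto
  have a3: "AE s in M. summable (\<lambda>k. (\<gamma> k)\<^sup>2 * (norm (grad k s))\<^sup>2)"
  proof (rule AE_summable_of_summable_integral)
    show "integrable M (\<lambda>s. (\<gamma> k)\<^sup>2 * (norm (grad k s))\<^sup>2)" for k using grad_sq_integrable by simp
    show "summable (\<lambda>k. expectation (\<lambda>s. (\<gamma> k)\<^sup>2 * (norm (grad k s))\<^sup>2))"
      by (rule summable_comparison_test'[OF summable_mult2[OF s\<gamma>2, of "(real CARD('n))\<^sup>2 * lip\<^sup>2"]])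
         (use grad_sq_expectation in \<open>auto intro!: mult_left_mono\<close>)
  qed auto
  have "AE s in M. (\<lambda>k. avg r k s) \<longlonglongrightarrow> xstar s"
    using AE_space a1 a2 a3
  proof eventually_elim
    case (elim s)
    obtain l where l: "l \<in> opt" "(\<lambda>k. iter k s) \<longlonglongrightarrow> l"
      by (rule iter_converges[OF elim(1) s\<gamma>\<eta> d\<gamma> elim(2) bspec[OF elim(3)] elim(4)])
    have "(\<lambda>k. avg r k s) \<longlonglongrightarrow> l"
      unfolding avg_def by (intro weighted_average_tendsto d\<gamma>r l(2) \<gamma>_powr_pos)
    then show ?case using l(1) by (simp add: xstar_def limI)
  qed
  then show ?thesis using xm xo by (intro bexI[of _ xstar] conjI ballI)
qed

end

section \<open>Lipschitz extension and power step sizes\<close>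


text \<open>McShane's extension, with the infimum over a countable dense subset so that joint
  measurability survives.\<close>

lemma measurable_lipschitz_extension:
  fixes h :: "'a::euclidean_space \<Rightarrow> 'w \<Rightarrow> real"
  assumes S: "S \<noteq> {}" and h: "\<And>x. x \<in> S \<Longrightarrow> h x \<in> borel_measurable N" and L [measurable]: "L \<in> borel_measurable N"
    and lip: "\<And>w. w \<in> space N \<Longrightarrow> (L w)-lipschitz_on S (\<lambda>x. h x w)"
  obtains g where "(\<lambda>p. g (fst p) (snd p)) \<in> borel_measurable (borel \<Otimes>\<^sub>M N)"
    and "\<And>x w. x \<in> S \<Longrightarrow> w \<in> space N \<Longrightarrow> g x w = h x w"
proof -
  obtain T where T: "countable T" "T \<subseteq> S" "S \<subseteq> closure T" by (rule separable)
  have T0: "T \<noteq> {}" using S T by auto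
  define g where "g x w = (INF z\<in>T. h z w + L w * norm (x - z))" for x w
  have "(\<lambda>p. g (fst p) (snd p)) \<in> borel_measurable (borel \<Otimes>\<^sub>M N)"
    unfolding g_def
  proof (rule borel_measurable_cINF_real[OF T(1)])
    fix z assume "z \<in> T"
    then have [measurable]: "h z \<in> borel_measurable N" using T h by auto
    show "(\<lambda>p. h z (snd p) + L (snd p) * norm (fst p - z)) \<in> borel_measurable (borel \<Otimes>\<^sub>M N)" by measurable
  qed
  moreover have "g x w = h x w" if x: "x \<in> S" and w: "w \<in> space N" for x w
  proof (rule antisym)
    have Lw: "0 \<le> L w" using lip[OF w] by (rule lipschitz_on_nonneg)
    have d: "\<bar>h z w - h x w\<bar> \<le> L w * norm (x - z)" if "z \<in> T" for z
      using lipschitz_onD[OF lip[OF w], of z x] that T x by (auto simp: dist_norm norm_minus_commute)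
    have lower: "h x w \<le> h z w + L w * norm (x - z)" if "z \<in> T" for z using d[OF that] by simp
    then show "h x w \<le> g x w" unfolding g_def using T0 by (intro cINF_greatest)
    show "g x w \<le> h x w"
    proof (rule field_le_epsilon)
      fix e :: real assume e: "0 < e"
      \<comment> \<open>Near \<open>x\<close> the error is at most
        \<open>2 * L w * norm (x - z)\<close>: one part from the change of \<open>h\<close>, one
        from the penalty. The added 1 keeps the denominator positive when
        \<open>L w = 0\<close>.\<close>
      have "0 < e / (2 * L w + 1)" using e Lw by simp
      then obtain z where z: "z \<in> T" "dist z x < e / (2 * L w + 1)"
        using T(3) x by (meson closure_approachable subsetD)
      then have "norm (x - z) * (2 * L w + 1) \<le> e" using Lw by (simp add: dist_norm norm_minus_commute field_simps)
      moreover have "norm (x - z) * (2 * L w + 1) = 2 * (L w * norm (x - z)) + norm (x - z)"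
        by (simp add: algebra_simps)
      ultimately have "2 * (L w * norm (x - z)) \<le> e" using norm_ge_zero[of "x - z"] by linarith
      moreover have "g x w \<le> h z w + L w * norm (x - z)"
        unfolding g_def using lower z(1) by (intro cINF_lower) (auto intro!: bdd_belowI2)
      ultimately show "g x w \<le> h x w + e" using d[OF z(1)] by linarith
    qed
  qed
  ultimately show thesis by (rule that)
qed

section \<open>Summability and rates for power step sizes\<close>

lemma summable_shifted_powr_iff: "summable (\<lambda>k. (real k + 1) powr s) \<longleftrightarrow> s < -1"
  using summable_iff_shift[of "\<lambda>k. real k powr s" 1] summable_real_powr_iff[of s] by (simp add: add.commute)

text \<open>\<open>A\<close> is the order of the weight sum. Each term on the right is at most
  \<open>G * A\<close> times a summand of \<open>B\<close>, so division by the lower bound on the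
  weights cancels \<open>G * A\<close> and leaves the factor \<open>2 - r\<close>.\<close>

lemma rate_from_weighted_bound:
  fixes \<gamma>0 \<eta>0 b r \<Delta> D C l :: real and K :: nat
  assumes \<gamma>0: "0 < \<gamma>0" and \<eta>0: "0 < \<eta>0" and r: "0 \<le> r" "r < 1" and b: "0 \<le> b" "r < 2 * (1 - b)"
    and nonneg: "0 \<le> D" "0 \<le> C" "0 \<le> l"
    and K: "2 powr (1 / (1 - r)) - 1 \<le> real K"
    and bound: "\<Delta> * (\<Sum>k\<le>K. (\<gamma>0 / (real k + 1) powr (1/2)) powr r)
      \<le> D * (\<gamma>0 / (real K + 1) powr (1/2)) powr (r - 1)
        + (1/2) * C * (\<Sum>k\<le>K. (\<gamma>0 / (real k + 1) powr (1/2)) powr (r + 1))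
        + l * (\<Sum>k\<le>K. (\<gamma>0 / (real k + 1) powr (1/2)) powr r * (\<eta>0 / (real k + 1) powr b))"
  shows "\<Delta> \<le> (2 - r) * (D / \<gamma>0 + C * \<gamma>0 / (1 - r)) * (1 / sqrt (real K + 1))
    + (2 - r) * (\<eta>0 * l / (1 - r / 2 - b)) * (1 / (real K + 1) powr b)"
proof -
  define N where "N = real K + 1"
  define A where "A = N powr (1 - r / 2)"
  define G where "G = \<gamma>0 powr r"
  define W where "W = (\<Sum>k\<le>K. (\<gamma>0 / (real k + 1) powr (1/2)) powr r)"
  define B where "B = (D / \<gamma>0 + C * \<gamma>0 / (1 - r)) * (1 / sqrt N) + (\<eta>0 * l / (1 - r / 2 - b)) * (1 / N powr b)"
  have N: "0 < N" by (simp add: N_def)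
  have A: "0 < A" using N by (simp add: A_def)
  have G: "0 < G" using \<gamma>0 by (simp add: G_def)
  have bb: "0 < 1 - r / 2 - b" using b by simp
  have pw: "(\<gamma>0 / (real k + 1) powr (1/2)) powr q = \<gamma>0 powr q * (real k + 1) powr - (q / 2)" for k q
    using \<gamma>0 by (simp add: powr_divide powr_powr powr_minus_divide)
  have Nsq: "1 / sqrt N = N powr - (1/2)" using N by (simp add: powr_minus_divide powr_half_sqrt)
  have Nb: "1 / N powr b = N powr - b" by (simp add: powr_minus_divide)
  have S: "(\<Sum>k\<le>K. g k) = (\<Sum>k<Suc K. g k)" for g :: "nat \<Rightarrow> real" by (simp add: lessThan_Suc_atMost)
  have sK: "real (Suc K) = N" by (simp add: N_def)
  have A1: "N powr ((1 - r) / 2) = A * N powr - (1/2)" "N powr (1 - r / 2 - b) = A * N powr - b"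
    unfolding A_def powr_add[symmetric] by (auto intro!: arg_cong[where f = "(powr) N"] simp: field_simps)
  have G1: "\<gamma>0 powr (r - 1) = G / \<gamma>0" "\<gamma>0 powr (r + 1) = G * \<gamma>0"
    using \<gamma>0 by (simp_all add: G_def powr_diff powr_add)
  have t1: "(\<gamma>0 / (real K + 1) powr (1/2)) powr (r - 1) = G / \<gamma>0 * (A * N powr - (1/2))"
  proof -
    have "- ((r - 1) / 2) = (1 - r) / 2" by (simp add: field_simps)
    then show ?thesis unfolding pw G1 A1(1)[symmetric] by (simp only: N_def)
  qed
  \<comment> \<open>The exponent \<open>1 - (r + 1) / 2\<close> equals \<open>(1 - r) / 2\<close>;
    the resulting factor 2 cancels the 1/2 in front of \<open>C\<close>.\<close>
  have t2: "(\<Sum>k\<le>K. (\<gamma>0 / (real k + 1) powr (1/2)) powr (r + 1)) \<le> G * \<gamma>0 * (2 * (A * N powr - (1/2)) / (1 - r))"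
  proof -
    have "(\<Sum>k\<le>K. (\<gamma>0 / (real k + 1) powr (1/2)) powr (r + 1)) = G * \<gamma>0 * (\<Sum>k<Suc K. (real k + 1) powr - ((r + 1) / 2))"
      unfolding pw G1 S by (simp only: sum_distrib_left)
    also have "\<dots> \<le> G * \<gamma>0 * (real (Suc K) powr (1 - (r + 1) / 2) / (1 - (r + 1) / 2))"
      using G \<gamma>0 r by (intro mult_left_mono sum_powr_upper) auto
    also have "1 - (r + 1) / 2 = (1 - r) / 2" by (simp add: field_simps)
    finally show ?thesis unfolding sK A1 by (simp add: mult_ac)
  qed
  have t3: "(\<Sum>k\<le>K. (\<gamma>0 / (real k + 1) powr (1/2)) powr r * (\<eta>0 / (real k + 1) powr b)) \<le> G * \<eta>0 * (A * N powr - b / (1 - r / 2 - b))"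
  proof -
    have "(\<gamma>0 / (real k + 1) powr (1/2)) powr r * (\<eta>0 / (real k + 1) powr b) = G * \<eta>0 * (real k + 1) powr - (r / 2 + b)" for k
    proof -
      have "(real k + 1) powr - (r / 2 + b) = (real k + 1) powr - (r / 2) * (real k + 1) powr - b"
        unfolding powr_add[symmetric] by simp
      then show ?thesis unfolding pw G_def by (simp add: powr_minus_divide)
    qed
    then have "(\<Sum>k\<le>K. (\<gamma>0 / (real k + 1) powr (1/2)) powr r * (\<eta>0 / (real k + 1) powr b)) = G * \<eta>0 * (\<Sum>k<Suc K. (real k + 1) powr - (r / 2 + b))"
      unfolding S by (simp only: sum_distrib_left)
    also have "\<dots> \<le> G * \<eta>0 * (real (Suc K) powr (1 - (r / 2 + b)) / (1 - (r / 2 + b)))"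
      using G \<eta>0 r b by (intro mult_left_mono sum_powr_upper) auto
    also have "1 - (r / 2 + b) = 1 - r / 2 - b" by simp
    finally show ?thesis unfolding sK A1 .
  qed
  \<comment> \<open>The lower bound on \<open>K\<close> is what gives \<open>A \<ge> 2\<close>; then
    the 1 subtracted in \<open>sum_powr_lower\<close> costs at most half of \<open>A\<close>.
    Division of \<open>A / 2\<close> by \<open>1 - r / 2\<close> gives the denominator
    \<open>2 - r\<close>.\<close>
  have W: "G * (A / (2 - r)) \<le> W"
  proof -
    have "(2::real) = (2 powr (1 / (1 - r))) powr (1 - r)" using r by (simp add: powr_powr)
    also have "\<dots> \<le> N powr (1 - r)" using K r by (intro powr_mono2) (auto simp: N_def)
    also have "\<dots> \<le> A" unfolding A_def using r by (intro powr_mono) (auto simp: N_def)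
    finally have A2: "2 \<le> A" .
    have "A \<le> (N + 1) powr (1 - r / 2)" unfolding A_def using r N by (intro powr_mono2) auto
    then have "A / 2 \<le> (N + 1) powr (1 - r / 2) - 1" using A2 by simp
    then have "A / 2 / (1 - r / 2) \<le> ((real (Suc K) + 1) powr (1 - r / 2) - 1) / (1 - r / 2)"
      unfolding sK using r by (intro divide_right_mono) auto
    also have "\<dots> \<le> (\<Sum>k<Suc K. (real k + 1) powr - (r / 2))" using r by (intro sum_powr_lower) auto
    finally have "A / (2 - r) \<le> (\<Sum>k<Suc K. (real k + 1) powr - (r / 2))"
      using r by (simp add: field_simps del: sum.lessThan_Suc)
    then have "G * (A / (2 - r)) \<le> G * (\<Sum>k<Suc K. (real k + 1) powr - (r / 2))"
      using G by (intro mult_left_mono) auto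
    then show ?thesis unfolding W_def pw S G_def by (simp only: sum_distrib_left)
  qed
  have B0: "0 \<le> B" unfolding B_def using nonneg \<gamma>0 \<eta>0 r bb N by (intro add_nonneg_nonneg mult_nonneg_nonneg divide_nonneg_pos) auto
  have "\<Delta> * W \<le> D * (G / \<gamma>0 * (A * N powr - (1/2))) + (1/2) * C * (G * \<gamma>0 * (2 * (A * N powr - (1/2)) / (1 - r)))
      + l * (G * \<eta>0 * (A * N powr - b / (1 - r / 2 - b)))"
    using bound[unfolded t1] mult_left_mono[OF t2, of "(1/2) * C"] mult_left_mono[OF t3 nonneg(3)] nonneg
    unfolding W_def by linarith
  also have "\<dots> = G * A * B"
    unfolding B_def Nsq Nb by (simp add: algebra_simps)
  finally have dW: "\<Delta> * W \<le> G * A * B" .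
  have "\<Delta> \<le> (2 - r) * B"
  \<comment> \<open>Bounding the weight sum from below is legitimate only for a non-negative gap; a
    negative one is below \<open>(2 - r) * B\<close> anyway.\<close>
  proof (cases "0 \<le> \<Delta>")
    case True
    have "\<Delta> * (G * (A / (2 - r))) \<le> G * A * B" using mult_left_mono[OF W True] dW by linarith
    then have "(G * A) * (\<Delta> / (2 - r)) \<le> (G * A) * B" by (simp add: mult_ac)
    then have "\<Delta> / (2 - r) \<le> B" using mult_pos_pos[OF G A] by (rule mult_left_le_imp_le)
    then show ?thesis using r by (simp add: field_simps)
  next
    case False
    moreover have "0 \<le> (2 - r) * B" using B0 r by simp
    ultimately show ?thesis by linarith
  qed
  moreover have "(2 - r) * (p * q + u * t) = (2 - r) * p * q + (2 - r) * u * t" for p q u t :: real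
    by (simp add: algebra_simps)
  ultimately show ?thesis unfolding B_def N_def by (simp only:)
qed

lemma zsol_counts:
  "projections (zsol X h r \<gamma> \<eta> x0 v w k) = k \<and> samples (zsol X h r \<gamma> \<eta> x0 v w k) = k"
  by (induction k) (auto simp: zsol_step_def Let_def)

lemma (in zeroth_order_scheme) half_sq_distance_nonneg: "0 \<le> D"
  using infdist_sq_le[OF x0] zero_le_power2[of "infdist x0 opt"] by linarith

lemma (in zeroth_order_scheme) expected_rate:
  assumes \<gamma>: "\<gamma> = (\<lambda>k. \<gamma>0 / (real k + 1) powr (1/2))" and \<eta>: "\<eta> = (\<lambda>k. \<eta>0 / (real k + 1) powr b)"
    and pos: "0 < \<gamma>0" "0 < \<eta>0" and r: "0 \<le> r" "r < 1" and b: "0 \<le> b" "r < 2 * (1 - b)"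
    and K: "2 powr (1 / (1 - r)) - 1 \<le> real K"
  shows "expectation (\<lambda>s. f (avg r K s)) - fopt
    \<le> (2 - r) * (D / \<gamma>0 + lip\<^sup>2 * (real CARD('n))\<^sup>2 * \<gamma>0 / (1 - r)) * (1 / sqrt (real K + 1))
      + (2 - r) * (\<eta>0 * lip / (1 - r / 2 - b)) * (1 / (real K + 1) powr b)"
proof (rule rate_from_weighted_bound[OF pos r b half_sq_distance_nonneg _ lip_nonneg K])
  have "decseq \<gamma>"
    unfolding \<gamma> decseq_def using pos by (auto intro!: divide_left_mono powr_mono2)
  from expected_suboptimality[OF this, of r K]
  show "(expectation (\<lambda>s. f (avg r K s)) - fopt) * (\<Sum>k\<le>K. (\<gamma>0 / (real k + 1) powr (1/2)) powr r)
      \<le> D * (\<gamma>0 / (real K + 1) powr (1/2)) powr (r - 1)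
        + (1/2) * (lip\<^sup>2 * (real CARD('n))\<^sup>2) * (\<Sum>k\<le>K. (\<gamma>0 / (real k + 1) powr (1/2)) powr (r + 1))
        + lip * (\<Sum>k\<le>K. (\<gamma>0 / (real k + 1) powr (1/2)) powr r * (\<eta>0 / (real k + 1) powr b))"
    using r unfolding \<gamma> \<eta> by (simp add: mult.commute[of "lip\<^sup>2"])
qed simp

theorem corollary1:
  fixes M :: "'s measure" and N :: "'w measure"
    and X :: "(real^'n) set" and Y :: "(real^'m) set"
    and \<omega> :: "'s \<Rightarrow> 'w" and \<omega>s :: "nat \<Rightarrow> 's \<Rightarrow> 'w" and v :: "nat \<Rightarrow> 's \<Rightarrow> real^'n"
    and ft :: "real^'n \<Rightarrow> real^'m \<Rightarrow> 'w \<Rightarrow> real"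
    and G :: "real^'n \<Rightarrow> real^'m \<Rightarrow> 'w \<Rightarrow> real^'m"
    and F :: "real^'n \<Rightarrow> real^'m \<Rightarrow> real^'m"
    and y :: "real^'n \<Rightarrow> real^'m"
    and fimp :: "real^'n \<Rightarrow> real"
    and L\<^sub>\<omega> Lt\<^sub>\<omega> :: "'w \<Rightarrow> real"
    and L0 n D fopt \<mu>F LF \<gamma>0 \<eta>0 a b r :: real
    and \<gamma> \<eta> :: "nat \<Rightarrow> real"
    and x0 :: "real^'n"
    and state :: "nat \<Rightarrow> 's \<Rightarrow> (real^'n) zsol_state"
    and xbar :: "nat \<Rightarrow> 's \<Rightarrow> real^'n"
    and Xopt :: "(real^'n) set"
  \<comment> \<open>problem\<close>
  assumes M: "prob_space M"
    and \<omega>: "\<omega> \<in> measurable M N"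
    and ft_meas: "\<And>x z. x \<in> enlargement X \<eta>0 \<Longrightarrow> z \<in> Y \<Longrightarrow> ft x z \<in> borel_measurable N"
    and G_meas: "\<And>x z. x \<in> enlargement X \<eta>0 \<Longrightarrow> z \<in> Y \<Longrightarrow> G x z \<in> borel_measurable N"
    and G_int: "\<And>x z. x \<in> enlargement X \<eta>0 \<Longrightarrow> z \<in> Y \<Longrightarrow> integrable M (\<lambda>s. G x z (\<omega> s))"
    and F_def: "F = (\<lambda>x z. \<integral>s. G x z (\<omega> s) \<partial>M)"
    and y_sol: "\<And>x. x \<in> enlargement X \<eta>0 \<Longrightarrow> VI_solutions Y (F x) = {y x}"
    and ft_int: "\<And>x. x \<in> enlargement X \<eta>0 \<Longrightarrow> integrable M (\<lambda>s. ft x (y x) (\<omega> s))"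
    and fimp_def: "fimp = (\<lambda>x. \<integral>s. ft x (y x) (\<omega> s) \<partial>M)"
    and Xopt_def: "Xopt = solution_set X fimp"
    and fopt_def: "fopt = optimal_value X fimp"
    and D_def: "D = half_sq_distance X Xopt"
    and n_def: "n = real CARD('n)"
  \<comment> \<open>(A1)\<close>
    and \<eta>0_pos: "\<eta>0 > 0"
    and L\<^sub>\<omega>_meas: "L\<^sub>\<omega> \<in> borel_measurable N"
    and ft_lip: "\<And>w. w \<in> space N \<Longrightarrow> (L\<^sub>\<omega> w)-lipschitz_on (enlargement X \<eta>0) (\<lambda>x. ft x (y x) w)"
    and L\<^sub>\<omega>_int: "integrable M (\<lambda>s. (L\<^sub>\<omega> (\<omega> s))\<^sup>2)"
    and L0_def: "L0 = sqrt (\<integral>s. (L\<^sub>\<omega> (\<omega> s))\<^sup>2 \<partial>M)"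
    and Lt\<^sub>\<omega>_meas: "Lt\<^sub>\<omega> \<in> borel_measurable N"
    and ft_lip_y: "\<And>w x. w \<in> space N \<Longrightarrow> x \<in> enlargement X \<eta>0 \<Longrightarrow> (Lt\<^sub>\<omega> w)-lipschitz_on Y (\<lambda>z. ft x z w)"
    and Lt\<^sub>\<omega>_int: "integrable M (\<lambda>s. (Lt\<^sub>\<omega> (\<omega> s))\<^sup>2)"
  \<comment> \<open>(A2)\<close>
    and X: "X \<noteq> {}" "closed X" "bounded X" "convex X"
    and Y: "Y \<noteq> {}" "closed Y" "bounded Y" "convex Y"
  \<comment> \<open>(A3)\<close>
    and \<mu>F_pos: "\<mu>F > 0"
    and F_mono: "\<And>x. x \<in> X \<Longrightarrow> strongly_monotone_on \<mu>F Y (F x)"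
    and F_lip: "\<And>x. x \<in> X \<Longrightarrow> LF-lipschitz_on Y (F x)"
  \<comment> \<open>(C)\<close>
    and fimp_convex: "convex_on (enlargement X \<eta>0) fimp"
  \<comment> \<open>step sizes and smoothing radii\<close>
    and \<gamma>0_pos: "\<gamma>0 > 0"
    and \<gamma>_def: "\<gamma> = (\<lambda>k. \<gamma>0 / (real k + 1) powr a)"
    and \<eta>_def: "\<eta> = (\<lambda>k. \<eta>0 / (real k + 1) powr b)"
  \<comment> \<open>(U)\<close>
    and v_sphere: "\<And>k s. s \<in> space M \<Longrightarrow> v k s \<in> sphere 0 (\<eta> k)"
    and v_unif: "\<And>k. distr M borel (v k) = uniform_sphere (\<eta> k)"
    and \<omega>s_distr: "\<And>k. distr M N (\<omega>s k) = distr M N \<omega>"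
    and indep_steps: "prob_space.indep_vars M (\<lambda>_. borel \<Otimes>\<^sub>M N) (\<lambda>k s. (v k s, \<omega>s k s)) UNIV"
    and indep_pair: "\<And>k. prob_space.indep_set M
          {v k -` A \<inter> space M | A. A \<in> sets borel} {\<omega>s k -` A \<inter> space M | A. A \<in> sets N}"
  \<comment> \<open>scheme\<close>
    and r: "0 \<le> r" "r < 1"
    and x0: "x0 \<in> X"
    and state_def: "state = (\<lambda>k s. zsol X (\<lambda>x w. ft x (y x) w) r \<gamma> \<eta> x0 (\<lambda>i. v i s) (\<lambda>i. \<omega>s i s) k)"
    and xbar_def: "xbar = (\<lambda>k s. average (state k s))"
  shows
    "(a = 1/2 \<and> 1/2 \<le> b \<and> b < 1 \<and> r < 2 * (1 - b) \<longrightarrow>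
       (\<forall>K. real K \<ge> 2 powr (1 / (1 - r)) - 1 \<longrightarrow>
         (\<integral>s. fimp (xbar K s) \<partial>M) - fopt
           \<le> (2 - r) * (D / \<gamma>0 + L0\<^sup>2 * n\<^sup>2 * \<gamma>0 / (1 - r)) * (1 / sqrt (real K + 1))
             + (2 - r) * (\<eta>0 * L0 / (1 - r / 2 - b)) * (1 / (real K + 1) powr b))) \<and>
     (\<forall>\<delta>. a = 1/2 \<and> 0 < \<delta> \<and> \<delta> \<le> 1/2 \<and> b = 1 - \<delta> \<and> r = 0 \<longrightarrow>
       (\<forall>K\<ge>1.
         (\<integral>s. fimp (xbar K s) \<partial>M) - fopt
           \<le> 2 * (D / \<gamma>0 + L0\<^sup>2 * n\<^sup>2 * \<gamma>0) * (1 / sqrt (real K + 1))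
             + (2 * \<eta>0 * L0 / \<delta>) * (1 / (real K + 1) powr (1 - \<delta>)))) \<and>
     (a = 1/2 \<and> b = 1/2 \<and> r = 0 \<and> \<gamma>0 = sqrt D / (n * L0) \<and> \<eta>0 \<le> sqrt D * n \<longrightarrow>
       (\<forall>\<epsilon>>0. \<forall>K. real K \<ge> 64 * n\<^sup>2 * L0\<^sup>2 * D / \<epsilon>\<^sup>2 \<longrightarrow>
         (\<integral>s. fimp (xbar K s) \<partial>M) - fopt \<le> \<epsilon> \<and>
         (\<forall>s. projections (state K s) = K \<and> samples (state K s) = K))) \<and>
     (1/2 < a \<and> a \<le> 1 \<and> b > 1 - a \<longrightarrow>
       (\<exists>xstar \<in> borel_measurable M.
         (\<forall>s\<in>space M. xstar s \<in> Xopt) \<and>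
         (AE s in M. (\<lambda>k. (norm (xbar k s - xstar s))\<^sup>2) \<longlonglongrightarrow> 0)))"
proof -
  interpret M: prob_space M by (rule M)
  define S where "S = enlargement X \<eta>0"
  define P where "P = distr M N \<omega>"
  define h0 where "h0 x w = ft x (y x) w" for x w
  have sets_P [measurable_cong]: "sets P = sets N" and space_P: "space P = space N" by (auto simp: P_def)
  have prob_P: "prob_space P" unfolding P_def using \<omega> by (rule M.prob_space_distr)
  have \<omega>P: "\<omega> \<in> M \<rightarrow>\<^sub>M P" using \<omega> by (simp add: P_def)
  have yY: "y x \<in> Y" if "x \<in> S" for x
    using y_sol[of x] that by (auto simp: S_def VI_solutions_def)
  have X_compact: "compact X" using X by (simp add: compact_eq_bounded_closed)
  have S_closed: "closed S"
    unfolding S_def enlargement_def using compact_sums[OF X_compact compact_cball[of 0 \<eta>0]] by (rule compact_imp_closed)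
  have XS: "cball x c \<subseteq> S" if "x \<in> X" "c \<le> \<eta>0" for x c
  proof
    fix z assume "z \<in> cball x c"
    then have "z = x + (z - x)" "z - x \<in> cball 0 \<eta>0" using that by (auto simp: dist_norm norm_minus_commute)
    then show "z \<in> S" unfolding S_def enlargement_def using that by blast
  qed
  have S0: "S \<noteq> {}" using x0 XS[OF x0, of \<eta>0] \<eta>0_pos by force
  have L_P: "L\<^sub>\<omega> \<in> borel_measurable P" using L\<^sub>\<omega>_meas by (simp add: P_def)
  have h0_meas: "h0 x \<in> borel_measurable P" if "x \<in> S" for x
    unfolding h0_def using ft_meas[of x "y x"] yY[OF that] that by (simp add: S_def P_def)
  have h0_lip: "(L\<^sub>\<omega> w)-lipschitz_on S (\<lambda>x. h0 x w)" if "w \<in> space P" for w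
    unfolding h0_def S_def using ft_lip that by (simp add: space_P)
  \<comment> \<open>Joint measurability is needed because the scheme inserts random points; the
    original integrand is measurable only pointwise in \<open>x\<close>.\<close>
  obtain h where h: "(\<lambda>p. h (fst p) (snd p)) \<in> borel_measurable (borel \<Otimes>\<^sub>M P)"
    and heq: "\<And>x w. x \<in> S \<Longrightarrow> w \<in> space P \<Longrightarrow> h x w = h0 x w"
    by (rule measurable_lipschitz_extension[OF S0 h0_meas L_P h0_lip]) auto
  have h_meas: "h x \<in> borel_measurable P" for x
    using measurable_compose[OF measurable_Pair1' h, of x] by simp
  have \<omega>_space: "\<omega> s \<in> space P" if "s \<in> space M" for s using measurable_space[OF \<omega>P that] .
  have vw_N: "(\<lambda>s. (v k s, \<omega>s k s)) \<in> M \<rightarrow>\<^sub>M borel \<Otimes>\<^sub>M N" for k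
    using indep_steps by (auto simp: M.indep_vars_def)
  have v_rv: "v k \<in> borel_measurable M" and \<omega>s_rv: "\<omega>s k \<in> M \<rightarrow>\<^sub>M P" for k
    using measurable_compose[OF vw_N[of k] measurable_fst] measurable_compose[OF vw_N[of k] measurable_snd] by (auto simp: P_def)
  have \<omega>s_law: "distr M P (\<omega>s k) = P" for k
  proof -
    have "distr M P (\<omega>s k) = distr M N (\<omega>s k)" by (rule distr_cong) (auto simp: sets_P)
    then show ?thesis by (simp add: \<omega>s_distr P_def)
  qed
  have vw_law: "distr M (borel \<Otimes>\<^sub>M P) (\<lambda>s. (v k s, \<omega>s k s)) = uniform_sphere (\<eta> k) \<Otimes>\<^sub>M P" for k
  proof -
    have "distr M (borel \<Otimes>\<^sub>M P) (\<lambda>s. (v k s, \<omega>s k s)) = distr M borel (v k) \<Otimes>\<^sub>M distr M P (\<omega>s k)"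
    proof (rule M.distr_pair_eq_product[OF v_rv \<omega>s_rv])
      fix A B assume "A \<in> sets (borel :: (real^'n) measure)" "B \<in> sets P"
      then show "M.prob ((v k -` A \<inter> space M) \<inter> (\<omega>s k -` B \<inter> space M))
          = M.prob (v k -` A \<inter> space M) * M.prob (\<omega>s k -` B \<inter> space M)"
        by (intro M.indep_setD[OF indep_pair]) (auto simp: sets_P)
    qed
    then show ?thesis by (simp add: v_unif \<omega>s_law)
  qed
  have sets_BP: "sets (borel \<Otimes>\<^sub>M P :: ((real^'n) \<times> 'w) measure) = sets (borel \<Otimes>\<^sub>M N)"
    by (rule sets_pair_measure_cong) (auto simp: sets_P)
  have indep: "M.indep_vars (\<lambda>_. borel \<Otimes>\<^sub>M P) (\<lambda>k s. (v k s, \<omega>s k s)) UNIV"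
    using indep_steps unfolding M.indep_vars_def2 sets_BP measurable_cong_sets[OF refl sets_BP] .
  have int_P: "integrable P g \<longleftrightarrow> integrable M (\<lambda>s. g (\<omega> s))" "(\<integral>w. g w \<partial>P) = (\<integral>s. g (\<omega> s) \<partial>M)"
    if "g \<in> borel_measurable P" for g :: "'w \<Rightarrow> real"
    using that \<omega> by (auto simp: P_def integrable_distr_eq integral_distr)
  have \<gamma>_pos: "0 < \<gamma> k" and \<eta>_pos: "0 < \<eta> k" for k using \<gamma>0_pos \<eta>0_pos by (auto simp: \<gamma>_def \<eta>_def)
  \<comment> \<open>Non-negativity of \<open>b\<close> gives \<open>\<eta> k \<le> \<eta>0\<close>,
    which keeps all sampled points inside \<open>S\<close>. Every part of the claim has it; in the
    last one, \<open>b > 1 - a\<close> and \<open>a \<le> 1\<close>.\<close>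
  have scheme: "zeroth_order_scheme M P X S h L\<^sub>\<omega> fimp v \<omega>s \<gamma> \<eta> x0" if b0: "0 \<le> b"
  proof (intro zeroth_order_scheme.intro zeroth_order_scheme_axioms.intro M prob_P)
    show "X \<noteq> {}" by (rule X(1))
    show "integrable P (\<lambda>w. (L\<^sub>\<omega> w)\<^sup>2)" using int_P(1)[of "\<lambda>w. (L\<^sub>\<omega> w)\<^sup>2"] L_P L\<^sub>\<omega>_int by simp
    show "(L\<^sub>\<omega> w)-lipschitz_on S (\<lambda>x. h x w)" if "w \<in> space P" for w
      using h0_lip[OF that] by (rule lipschitz_on_transform) (simp add: heq that)
    have eqi: "h x (\<omega> s) = ft x (y x) (\<omega> s)" if "x \<in> S" "s \<in> space M" for x s
      using heq[OF that(1) \<omega>_space[OF that(2)]] by (simp add: h0_def)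
    show "integrable P (h x)" if "x \<in> S" for x
      using ft_int[of x] that eqi[OF that] unfolding int_P(1)[OF h_meas] S_def
      by (subst Bochner_Integration.integrable_cong[OF refl]) auto
    show "fimp x = (\<integral>w. h x w \<partial>P)" if "x \<in> S" for x
      unfolding int_P(2)[OF h_meas] fimp_def using eqi[OF that] by (intro Bochner_Integration.integral_cong) auto
    show "cball x (\<eta> k) \<subseteq> S" if "x \<in> X" for x k
    proof (rule XS[OF that])
      have "1 \<le> (real k + 1) powr b" using b0 by (intro ge_one_powr_ge_zero) auto
      then show "\<eta> k \<le> \<eta>0" using \<eta>0_pos by (simp add: \<eta>_def divide_le_eq mult_le_cancel_left1)
    qed
    show "convex_on S fimp" using fimp_convex by (simp add: S_def)
    show "norm (v k s) = \<eta> k" if "s \<in> space M" for k s using v_sphere[OF that, of k] by simp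
  qed (use h L_P S_closed X X_compact \<gamma>_pos \<eta>_pos v_unif \<omega>s_law vw_law indep x0 in auto)
  have lip_eq: "zeroth_order_scheme.lip P L\<^sub>\<omega> = L0" if b0: "0 \<le> b"
    unfolding zeroth_order_scheme.lip_def[OF scheme[OF b0]] L0_def
    using int_P(2)[of "\<lambda>w. (L\<^sub>\<omega> w)\<^sup>2"] L_P by simp
  have xbar_eq: "xbar k s = zeroth_order_scheme.avg X h v \<omega>s \<gamma> \<eta> x0 r k s" if b0: "0 \<le> b" and s: "s \<in> space M" for k s
    unfolding xbar_def state_def
    using zeroth_order_scheme.zsol_eq[OF scheme[OF b0], of "\<lambda>x w. ft x (y x) w" s r k] heq s
    by (simp add: h0_def)
  have opt_eq: "zeroth_order_scheme.opt X fimp = Xopt" "zeroth_order_scheme.fopt X fimp = fopt" if b0: "0 \<le> b"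
    unfolding zeroth_order_scheme.opt_def[OF scheme[OF b0]] zeroth_order_scheme.fopt_def[OF scheme[OF b0]]
    by (simp_all add: Xopt_def fopt_def)
  have rate: "(\<integral>s. fimp (xbar K s) \<partial>M) - fopt
      \<le> (2 - r) * (D / \<gamma>0 + L0\<^sup>2 * n\<^sup>2 * \<gamma>0 / (1 - r)) * (1 / sqrt (real K + 1))
        + (2 - r) * (\<eta>0 * L0 / (1 - r / 2 - b)) * (1 / (real K + 1) powr b)"
    if a: "a = 1/2" and b0: "0 \<le> b" and rb: "r < 2 * (1 - b)" and K: "real K \<ge> 2 powr (1 / (1 - r)) - 1" for K
  proof -
    interpret Z: zeroth_order_scheme M P X S h L\<^sub>\<omega> fimp v \<omega>s \<gamma> \<eta> x0 by (rule scheme[OF b0])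
    have "(\<integral>s. fimp (xbar K s) \<partial>M) = (\<integral>s. fimp (Z.avg r K s) \<partial>M)"
      by (intro Bochner_Integration.integral_cong) (auto simp: xbar_eq[OF b0])
    then show ?thesis
      using Z.expected_rate[OF _ \<eta>_def \<gamma>0_pos \<eta>0_pos r b0 rb K] a
      by (simp add: \<gamma>_def lip_eq[OF b0] opt_eq[OF b0] n_def D_def)
  qed
  have partb: "(\<integral>s. fimp (xbar K s) \<partial>M) - fopt \<le> \<epsilon>"
    if ab: "a = 1/2" "b = 1/2" "r = 0" and g: "\<gamma>0 = sqrt D / (n * L0)" and e0: "\<eta>0 \<le> sqrt D * n"
      and \<epsilon>: "\<epsilon> > 0" and K: "real K \<ge> 64 * n\<^sup>2 * L0\<^sup>2 * D / \<epsilon>\<^sup>2" for \<epsilon> K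
  proof -
    have n: "0 < n" by (simp add: n_def)
    have L0: "0 \<le> L0" by (simp add: L0_def)
    \<comment> \<open>Division by zero yields 0, so \<open>L0 = 0\<close> would contradict
      \<open>\<gamma>0 > 0\<close>; the same equation excludes \<open>D = 0\<close> below.\<close>
    have "L0 \<noteq> 0" using g \<gamma>0_pos by auto
    then have L0: "0 < L0" using L0 by simp
    have "0 < sqrt D" using g \<gamma>0_pos n L0 by (metis mult_pos_pos zero_less_divide_iff less_asym)
    then have D: "0 < D" by simp
    have "0 < 64 * n\<^sup>2 * L0\<^sup>2 * D / \<epsilon>\<^sup>2" using n L0 D \<epsilon> by simp
    \<comment> \<open>For \<open>r = 0\<close> the threshold of the rate is \<open>2 - 1\<close>,
      and a natural number above a positive bound meets it.\<close>
    then have K1: "1 \<le> real K" using K by (cases K) auto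
    define q where "q = sqrt (real K + 1)"
    have q: "0 < q" by (simp add: q_def)
    define R where "R = sqrt D"
    have R: "0 < R" "D = R\<^sup>2" using D by (auto simp: R_def)
    have "(\<integral>s. fimp (xbar K s) \<partial>M) - fopt \<le> 2 * (D / \<gamma>0 + L0\<^sup>2 * n\<^sup>2 * \<gamma>0) * (1 / q) + 2 * (\<eta>0 * L0 / (1/2)) * (1 / q)"
      using rate[of K] ab K1 by (simp add: q_def powr_half_sqrt)
    \<comment> \<open>The choice of \<open>\<gamma>0\<close> balances the two summands: each equals
      \<open>R * n * L0\<close>.\<close>
    also have "D / \<gamma>0 + L0\<^sup>2 * n\<^sup>2 * \<gamma>0 = 2 * (R * n * L0)"
      unfolding g R_def[symmetric] unfolding R(2) using R(1) n L0 by (simp add: power2_eq_square field_simps)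
    also have "2 * (2 * (R * n * L0)) * (1 / q) + 2 * (\<eta>0 * L0 / (1/2)) * (1 / q) \<le> 2 * (2 * (R * n * L0)) * (1 / q) + 2 * ((R * n) * L0 / (1/2)) * (1 / q)"
      using e0 L0 q by (intro add_left_mono mult_right_mono mult_left_mono divide_right_mono) (auto simp: R_def)
    \<comment> \<open>The step-size term and the radius term contribute 4 each, the latter by
      \<open>\<eta>0 \<le> R * n\<close>; squaring gives the 64.\<close>
    also have "\<dots> = 8 * n * L0 * R / q" by (simp add: field_simps)
    also have "\<dots> \<le> \<epsilon>"
    proof -
      have "(8 * n * L0 * R)\<^sup>2 = 64 * n\<^sup>2 * L0\<^sup>2 * D" unfolding R(2) by (simp add: power_mult_distrib)
      also have "\<dots> \<le> real K * \<epsilon>\<^sup>2" using K \<epsilon> by (simp add: pos_divide_le_eq)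
      also have "\<dots> \<le> (\<epsilon> * q)\<^sup>2" by (simp add: power_mult_distrib q_def algebra_simps)
      finally have "8 * n * L0 * R \<le> \<epsilon> * q" by (rule power2_le_imp_le) (use \<epsilon> q in auto)
      then show ?thesis using q by (simp add: pos_divide_le_eq)
    qed
    finally show ?thesis .
  qed
  have partc: "\<exists>xstar \<in> borel_measurable M. (\<forall>s\<in>space M. xstar s \<in> Xopt) \<and>
         (AE s in M. (\<lambda>k. (norm (xbar k s - xstar s))\<^sup>2) \<longlonglongrightarrow> 0)"
    if a: "1/2 < a" "a \<le> 1" and b: "b > 1 - a"
  proof -
    have b0: "0 \<le> b" using a b by simp
    interpret Z: zeroth_order_scheme M P X S h L\<^sub>\<omega> fimp v \<omega>s \<gamma> \<eta> x0 by (rule scheme[OF b0])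
    have \<gamma>p: "\<gamma> k powr q = \<gamma>0 powr q * (real k + 1) powr - (a * q)" for k q
      using \<gamma>0_pos by (simp add: \<gamma>_def powr_divide powr_powr powr_minus_divide)
    have ns: "\<not> summable (\<lambda>k. \<gamma> k powr q)" if "a * q \<le> 1" for q
    proof
      assume "summable (\<lambda>k. \<gamma> k powr q)"
      then have "summable (\<lambda>k. (real k + 1) powr - (a * q))"
        unfolding \<gamma>p using \<gamma>0_pos by (simp add: summable_cmult_iff)
      then show False using that unfolding summable_shifted_powr_iff by simp
    qed
    have "summable (\<lambda>k. \<gamma> k powr 2)"
      unfolding \<gamma>p using a by (intro summable_mult) (simp add: summable_shifted_powr_iff)
    moreover have "\<gamma> k powr 2 = (\<gamma> k)\<^sup>2" for k using \<gamma>_pos[of k] by (simp add: powr_numeral)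
    ultimately have s1: "summable (\<lambda>k. (\<gamma> k)\<^sup>2)" by simp
    have "\<gamma> k * \<eta> k = (\<gamma>0 * \<eta>0) * (real k + 1) powr - (a + b)" for k
    proof -
      have "(real k + 1) powr - (a + b) = 1 / ((real k + 1) powr a * (real k + 1) powr b)"
        unfolding powr_minus_divide powr_add ..
      then show ?thesis by (simp only: \<gamma>_def \<eta>_def) simp
    qed
    then have s2: "summable (\<lambda>k. \<gamma> k * \<eta> k)"
      using b by (simp add: summable_shifted_powr_iff summable_mult)
    have "\<gamma> k powr 1 = \<gamma> k" for k using \<gamma>_pos[of k] by simp
    then have s3: "\<not> summable \<gamma>" using ns[of 1] a by simp
    \<comment> \<open>The averaging weights decay like the power \<open>a * r\<close> of the index,
      which is at most 1, so their sum diverges and the averages follow the iterates.\<close>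
    have "a * r \<le> 1 * 1" using a r by (intro mult_mono) auto
    then have s4: "\<not> summable (\<lambda>k. \<gamma> k powr r)" by (intro ns) simp
    obtain xstar where xs: "xstar \<in> borel_measurable M" "\<forall>s\<in>space M. xstar s \<in> Z.opt"
      and lim: "AE s in M. (\<lambda>k. Z.avg r k s) \<longlonglongrightarrow> xstar s"
      using Z.AE_avg_converges[OF s1 s2 s3 s4] by blast
    have "AE s in M. (\<lambda>k. (norm (xbar k s - xstar s))\<^sup>2) \<longlonglongrightarrow> 0"
      using lim AE_space
    proof eventually_elim
      case (elim s)
      have "(\<lambda>k. (norm (Z.avg r k s - xstar s))\<^sup>2) \<longlonglongrightarrow> (norm (xstar s - xstar s))\<^sup>2"
        by (intro tendsto_intros elim(1))
      then show ?case by (simp add: xbar_eq[OF b0 elim(2)])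
    qed
    then show ?thesis using xs by (auto simp: opt_eq[OF b0])
  qed
  show ?thesis
  proof (intro conjI impI allI)
    fix K assume h: "a = 1/2 \<and> 1/2 \<le> b \<and> b < 1 \<and> r < 2 * (1 - b)" and K: "2 powr (1 / (1 - r)) - 1 \<le> real K"
    then show "(\<integral>s. fimp (xbar K s) \<partial>M) - fopt
           \<le> (2 - r) * (D / \<gamma>0 + L0\<^sup>2 * n\<^sup>2 * \<gamma>0 / (1 - r)) * (1 / sqrt (real K + 1))
             + (2 - r) * (\<eta>0 * L0 / (1 - r / 2 - b)) * (1 / (real K + 1) powr b)"
      by (intro rate) auto
  next
    fix \<delta> :: real and K :: nat assume h: "a = 1/2 \<and> 0 < \<delta> \<and> \<delta> \<le> 1/2 \<and> b = 1 - \<delta> \<and> r = 0" and K: "1 \<le> K"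
    have "1 - (1 - \<delta>) = \<delta>" by simp
    then show "(\<integral>s. fimp (xbar K s) \<partial>M) - fopt
           \<le> 2 * (D / \<gamma>0 + L0\<^sup>2 * n\<^sup>2 * \<gamma>0) * (1 / sqrt (real K + 1))
             + (2 * \<eta>0 * L0 / \<delta>) * (1 / (real K + 1) powr (1 - \<delta>))"
      using rate[of K] h K by (simp add: mult.assoc)
  next
    fix \<epsilon> :: real and K :: nat
    assume h: "a = 1/2 \<and> b = 1/2 \<and> r = 0 \<and> \<gamma>0 = sqrt D / (n * L0) \<and> \<eta>0 \<le> sqrt D * n"
      and "0 < \<epsilon>" "64 * n\<^sup>2 * L0\<^sup>2 * D / \<epsilon>\<^sup>2 \<le> real K"
    then show "(\<integral>s. fimp (xbar K s) \<partial>M) - fopt \<le> \<epsilon>" by (intro partb) auto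
  next
    fix K s
    show "projections (state K s) = K" "samples (state K s) = K"
      by (simp_all add: state_def zsol_counts)
  qed (use partc in auto)
qed

end
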